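(* Let $F_1$ and $F_2$ be two fields containing an algebraically closed field $K$. Let $\mathcal{F},\mathcal{G}\colon\mathbf{alg}_K\to\mathbf{Alg}_K$ be two extension invariant algebra functors with $|K|>\dim_K(\mathcal{F}(K))$ and $|K|>\dim_K(\mathcal{G}(K))$. Then $\mathcal{F}(F_1)$ and $\mathcal{G}(F_1)$ are isomorphic as $F_1$-algebras if and only if $\mathcal{F}(F_2)$ and $\mathcal{G}(F_2)$ are isomorphic as $F_2$-algebras.
   Context: $\mathbf{alg}_K$ is the category of associative and commutative $K$-algebras with non-zero unit (morphisms are unital $K$-algebra homomorphisms). $\mathbf{Alg}_K$ is the category of all $K$-algebras, not necessarily associative, commutative or unital. A $K$-algebra functor is a functor $\mathcal{F}\colon\mathbf{alg}_K\to\mathbf{Alg}_K$ such that $\mathcal{F}(R)$ is an $R$-algebra for every $R\in\mathbf{alg}_K$. A $K$-algebra functor $\mathcal{F}$ is extension invariant if for every $R\in\mathbf{alg}_K$ there is an $R$-algebra isomorphism $\tau_R\colon\mathcal{F}(R)\to\mathcal{F}(K)\otimes_K R$ that is natural in $R$, i.e. for every homomorphism $\alpha\colon R\to R'$ in $\mathbf{alg}_K$ one has $(1_{\mathcal{F}(K)}\otimes_K\alpha)\circ\tau_R=\tau_{R'}\circ\mathcal{F}(\alpha)$. $|K|$ denotes the cardinality of $K$; dimensions are (possibly infinite) cardinals. *)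

theory Defs
  imports "HOL-Algebra.Algebra"
begin

unbundle cardinal_syntax

section \<open>The category of commutative algebras\<close>

text \<open>
  Commutative algebras are those of the library locale \<^locale>\<open>algebra\<close>. All objects of the
  category have their carrier inside one type \<open>'u\<close>, which also contains the carrier of \<open>K\<close>;
  the type \<open>'u\<close> is arbitrary, so it plays the role of a universe. Morphisms are made extensional
  (\<^const>\<open>undefined\<close> off the carrier) so that a morphism is determined by its values on the carrier.
  A field containing \<open>K\<close> is an object that is a field: its structure map \<open>k \<mapsto> k \<odot> \<one>\<close> embeds \<open>K\<close>.
\<close>

definition alg_obj :: "('u, 'c) ring_scheme \<Rightarrow> ('u, 'u) module set" where
  "alg_obj K = {R. algebra K R \<and> \<one>\<^bsub>R\<^esub> \<noteq> \<zero>\<^bsub>R\<^esub>}"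

definition alg_hom ::
    "('u, 'c) ring_scheme \<Rightarrow> ('u, 'u) module \<Rightarrow> ('u, 'u) module \<Rightarrow> ('u \<Rightarrow> 'u) set" where
  "alg_hom K R R' =
     {\<alpha> \<in> ring_hom R R' \<inter> extensional (carrier R).
        \<forall>k \<in> carrier K. \<forall>x \<in> carrier R. \<alpha> (k \<odot>\<^bsub>R\<^esub> x) = k \<odot>\<^bsub>R'\<^esub> \<alpha> x}"

definition base_alg :: "('u, 'c) ring_scheme \<Rightarrow> ('u, 'u) module" where
  "base_alg K = \<lparr>carrier = carrier K, monoid.mult = monoid.mult K, one = one K, ring.zero = ring.zero K, add = add K,
                 smult = monoid.mult K\<rparr>"


section \<open>Algebras that need not be associative, commutative or unital\<close>

text \<open>
  These are kept in the record type \<^type>\<open>module\<close>; its field \<^const>\<open>one\<close> carries no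
  information here: neither the axioms nor the homomorphisms mention it.
\<close>

locale nonassoc_algebra = module +
  assumes mult_closed:
      "\<lbrakk>x \<in> carrier M; y \<in> carrier M\<rbrakk> \<Longrightarrow> x \<otimes>\<^bsub>M\<^esub> y \<in> carrier M"
    and mult_l_distr:
      "\<lbrakk>x \<in> carrier M; y \<in> carrier M; z \<in> carrier M\<rbrakk> \<Longrightarrow>
       (x \<oplus>\<^bsub>M\<^esub> y) \<otimes>\<^bsub>M\<^esub> z = x \<otimes>\<^bsub>M\<^esub> z \<oplus>\<^bsub>M\<^esub> y \<otimes>\<^bsub>M\<^esub> z"
    and mult_r_distr:
      "\<lbrakk>x \<in> carrier M; y \<in> carrier M; z \<in> carrier M\<rbrakk> \<Longrightarrow>
       z \<otimes>\<^bsub>M\<^esub> (x \<oplus>\<^bsub>M\<^esub> y) = z \<otimes>\<^bsub>M\<^esub> x \<oplus>\<^bsub>M\<^esub> z \<otimes>\<^bsub>M\<^esub> y"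
    and smult_mult_left:
      "\<lbrakk>a \<in> carrier R; x \<in> carrier M; y \<in> carrier M\<rbrakk> \<Longrightarrow>
       (a \<odot>\<^bsub>M\<^esub> x) \<otimes>\<^bsub>M\<^esub> y = a \<odot>\<^bsub>M\<^esub> (x \<otimes>\<^bsub>M\<^esub> y)"
    and smult_mult_right:
      "\<lbrakk>a \<in> carrier R; x \<in> carrier M; y \<in> carrier M\<rbrakk> \<Longrightarrow>
       x \<otimes>\<^bsub>M\<^esub> (a \<odot>\<^bsub>M\<^esub> y) = a \<odot>\<^bsub>M\<^esub> (x \<otimes>\<^bsub>M\<^esub> y)"

definition nalg_hom ::
    "('r, 'c) ring_scheme \<Rightarrow> ('r, 'v) module \<Rightarrow> ('r, 'w) module \<Rightarrow> ('v \<Rightarrow> 'w) set" where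
  "nalg_hom R M N =
     {h \<in> carrier M \<rightarrow>\<^sub>E carrier N.
        (\<forall>x \<in> carrier M. \<forall>y \<in> carrier M. h (x \<oplus>\<^bsub>M\<^esub> y) = h x \<oplus>\<^bsub>N\<^esub> h y) \<and>
        (\<forall>x \<in> carrier M. \<forall>y \<in> carrier M. h (x \<otimes>\<^bsub>M\<^esub> y) = h x \<otimes>\<^bsub>N\<^esub> h y) \<and>
        (\<forall>a \<in> carrier R. \<forall>x \<in> carrier M. h (a \<odot>\<^bsub>M\<^esub> x) = a \<odot>\<^bsub>N\<^esub> h x)}"

definition nalg_iso ::
    "('r, 'c) ring_scheme \<Rightarrow> ('r, 'v) module \<Rightarrow> ('r, 'w) module \<Rightarrow> ('v \<Rightarrow> 'w) set" where
  "nalg_iso R M N = {h \<in> nalg_hom R M N. bij_betw h (carrier M) (carrier N)}"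

definition nalg_isomorphic ::
    "('r, 'c) ring_scheme \<Rightarrow> ('r, 'v) module \<Rightarrow> ('r, 'w) module \<Rightarrow> bool" where
  "nalg_isomorphic R M N \<longleftrightarrow> nalg_iso R M N \<noteq> {}"

text \<open>The \<open>K\<close>-algebra underlying an \<open>R\<close>-algebra \<open>M\<close>, along the structure map \<open>k \<mapsto> k \<odot> \<one>\<close>
  of the \<open>K\<close>-algebra \<open>R\<close>.\<close>

definition restrict_scalars :: "('u, 'u) module \<Rightarrow> ('u, 'v) module \<Rightarrow> ('u, 'v) module" where
  "restrict_scalars R M = M\<lparr>smult := (\<lambda>k x. (k \<odot>\<^bsub>R\<^esub> \<one>\<^bsub>R\<^esub>) \<odot>\<^bsub>M\<^esub> x)\<rparr>"


section \<open>Dimension as a cardinal\<close>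

definition module_basis :: "('r, 'c) ring_scheme \<Rightarrow> ('r, 'v, 'd) module_scheme \<Rightarrow> 'v set \<Rightarrow> bool" where
  "module_basis K M B \<longleftrightarrow>
     B \<subseteq> carrier M \<and>
     (\<forall>A a. finite A \<and> A \<subseteq> B \<and> a \<in> A \<rightarrow> carrier K \<and>
            (\<Oplus>\<^bsub>M\<^esub>b\<in>A. a b \<odot>\<^bsub>M\<^esub> b) = \<zero>\<^bsub>M\<^esub> \<longrightarrow> (\<forall>b \<in> A. a b = \<zero>\<^bsub>K\<^esub>)) \<and>
     (\<forall>x \<in> carrier M. \<exists>A a. finite A \<and> A \<subseteq> B \<and> a \<in> A \<rightarrow> carrier K \<and>
            x = (\<Oplus>\<^bsub>M\<^esub>b\<in>A. a b \<odot>\<^bsub>M\<^esub> b))"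

text \<open>Over a field bases exist and are equinumerous, so the choice does not matter.\<close>

definition module_dim :: "('r, 'c) ring_scheme \<Rightarrow> ('r, 'v, 'd) module_scheme \<Rightarrow> 'v rel" where
  "module_dim K M = |SOME B. module_basis K M B|"


section \<open>Extension of scalars\<close>

text \<open>
  \<open>A \<otimes>\<^sub>K R\<close> is the free abelian group on \<open>carrier A \<times> carrier R\<close> modulo the subgroup generated by
  the relators of biadditivity and \<open>K\<close>-balancedness. \<^term>\<open>frag_of (x, r)\<close> is the generator
  representing the pure tensor of \<open>x\<close> and \<open>r\<close>, and \<^const>\<open>frag_extend\<close> extends a map on
  generators to a group homomorphism.
\<close>

inductive_set tensor_null ::
    "('u, 'c) ring_scheme \<Rightarrow> ('u, 'v) module \<Rightarrow> ('u, 'u) module \<Rightarrow> ('v \<times> 'u \<Rightarrow>\<^sub>0 int) set"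
  for K A R where
  zero: "0 \<in> tensor_null K A R"
| add_left: "\<lbrakk>x \<in> carrier A; y \<in> carrier A; r \<in> carrier R\<rbrakk> \<Longrightarrow>
    frag_of (x \<oplus>\<^bsub>A\<^esub> y, r) - (frag_of (x, r) + frag_of (y, r)) \<in> tensor_null K A R"
| add_right: "\<lbrakk>x \<in> carrier A; r \<in> carrier R; s \<in> carrier R\<rbrakk> \<Longrightarrow>
    frag_of (x, r \<oplus>\<^bsub>R\<^esub> s) - (frag_of (x, r) + frag_of (x, s)) \<in> tensor_null K A R"
| balanced: "\<lbrakk>k \<in> carrier K; x \<in> carrier A; r \<in> carrier R\<rbrakk> \<Longrightarrow>
    frag_of (k \<odot>\<^bsub>A\<^esub> x, r) - frag_of (x, k \<odot>\<^bsub>R\<^esub> r) \<in> tensor_null K A R"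
| diff: "\<lbrakk>c \<in> tensor_null K A R; d \<in> tensor_null K A R\<rbrakk> \<Longrightarrow> c - d \<in> tensor_null K A R"

definition tensor_free :: "('u, 'v) module \<Rightarrow> ('u, 'u) module \<Rightarrow> ('v \<times> 'u \<Rightarrow>\<^sub>0 int) set" where
  "tensor_free A R = carrier (free_Abelian_group (carrier A \<times> carrier R))"

definition tensor_rel ::
    "('u, 'c) ring_scheme \<Rightarrow> ('u, 'v) module \<Rightarrow> ('u, 'u) module \<Rightarrow> ('v \<times> 'u \<Rightarrow>\<^sub>0 int) rel" where
  "tensor_rel K A R =
     {(c, d). c \<in> tensor_free A R \<and> d \<in> tensor_free A R \<and> c - d \<in> tensor_null K A R}"

definition tensor_mult ::
    "('u, 'v) module \<Rightarrow> ('u, 'u) module \<Rightarrow>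
     ('v \<times> 'u \<Rightarrow>\<^sub>0 int) \<Rightarrow> ('v \<times> 'u \<Rightarrow>\<^sub>0 int) \<Rightarrow> ('v \<times> 'u \<Rightarrow>\<^sub>0 int)" where
  "tensor_mult A R c d =
     frag_extend (\<lambda>(x, r). frag_extend (\<lambda>(y, s). frag_of (x \<otimes>\<^bsub>A\<^esub> y, r \<otimes>\<^bsub>R\<^esub> s)) d) c"

text \<open>\<open>A \<otimes>\<^sub>K R\<close> as an \<open>R\<close>-algebra, for a \<open>K\<close>-algebra \<open>A\<close> and a commutative \<open>K\<close>-algebra \<open>R\<close>.\<close>

definition tensor ::
    "('u, 'c) ring_scheme \<Rightarrow> ('u, 'v) module \<Rightarrow> ('u, 'u) module \<Rightarrow>
     ('u, ('v \<times> 'u \<Rightarrow>\<^sub>0 int) set) module" where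
  "tensor K A R =
     \<lparr>carrier = tensor_free A R // tensor_rel K A R,
      monoid.mult = (\<lambda>U V. \<Union>c\<in>U. \<Union>d\<in>V. tensor_rel K A R `` {tensor_mult A R c d}),
      one = undefined,
      ring.zero = tensor_rel K A R `` {0},
      add = (\<lambda>U V. \<Union>c\<in>U. \<Union>d\<in>V. tensor_rel K A R `` {c + d}),
      smult = (\<lambda>s U. \<Union>c\<in>U. tensor_rel K A R ``
                 {frag_extend (\<lambda>(x, r). frag_of (x, s \<otimes>\<^bsub>R\<^esub> r)) c})\<rparr>"

text \<open>The map \<open>1\<^sub>A \<otimes>\<^sub>K \<alpha>\<close> from \<open>A \<otimes>\<^sub>K R\<close> to \<open>A \<otimes>\<^sub>K R'\<close>.\<close>

definition tensor_map ::
    "('u, 'c) ring_scheme \<Rightarrow> ('u, 'v) module \<Rightarrow> ('u, 'u) module \<Rightarrow> ('u, 'u) module \<Rightarrow> ('u \<Rightarrow> 'u) \<Rightarrow>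
     ('v \<times> 'u \<Rightarrow>\<^sub>0 int) set \<Rightarrow> ('v \<times> 'u \<Rightarrow>\<^sub>0 int) set" where
  "tensor_map K A R R' \<alpha> =
     (\<lambda>U \<in> carrier (tensor K A R). \<Union>c\<in>U. tensor_rel K A R' ``
        {frag_extend (\<lambda>(x, r). frag_of (x, \<alpha> r)) c})"


section \<open>Algebra functors\<close>

text \<open>
  \<open>Fo R\<close> is the \<open>R\<close>-algebra assigned to \<open>R\<close>; the value of the functor in the category of all
  \<open>K\<close>-algebras is \<^term>\<open>restrict_scalars R (Fo R)\<close>. \<open>Fm R R' \<alpha>\<close> is the morphism assigned to
  \<open>\<alpha> : R \<rightarrow> R'\<close>; it is only required to be \<open>K\<close>-linear.
\<close>

locale algebra_functor =
  fixes K :: "('u, 'c) ring_scheme"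
    and Fo :: "('u, 'u) module \<Rightarrow> ('u, 'v) module"
    and Fm :: "('u, 'u) module \<Rightarrow> ('u, 'u) module \<Rightarrow> ('u \<Rightarrow> 'u) \<Rightarrow> 'v \<Rightarrow> 'v"
  assumes obj: "R \<in> alg_obj K \<Longrightarrow> nonassoc_algebra R (Fo R)"
    and hom: "\<lbrakk>R \<in> alg_obj K; R' \<in> alg_obj K; \<alpha> \<in> alg_hom K R R'\<rbrakk> \<Longrightarrow>
      Fm R R' \<alpha> \<in> nalg_hom K (restrict_scalars R (Fo R)) (restrict_scalars R' (Fo R'))"
    and ident: "R \<in> alg_obj K \<Longrightarrow>
      Fm R R (\<lambda>x \<in> carrier R. x) = (\<lambda>x \<in> carrier (Fo R). x)"
    and comp: "\<lbrakk>R \<in> alg_obj K; R' \<in> alg_obj K; R'' \<in> alg_obj K;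
        \<alpha> \<in> alg_hom K R R'; \<beta> \<in> alg_hom K R' R''\<rbrakk> \<Longrightarrow>
      Fm R R'' (compose (carrier R) \<beta> \<alpha>) = compose (carrier (Fo R)) (Fm R' R'' \<beta>) (Fm R R' \<alpha>)"

locale extension_invariant_functor = algebra_functor +
  assumes ext_inv:
    "\<exists>\<tau>. (\<forall>R \<in> alg_obj K. \<tau> R \<in> nalg_iso R (Fo R) (tensor K (Fo (base_alg K)) R)) \<and>
         (\<forall>R \<in> alg_obj K. \<forall>R' \<in> alg_obj K. \<forall>\<alpha> \<in> alg_hom K R R'.
            compose (carrier (Fo R)) (tensor_map K (Fo (base_alg K)) R R' \<alpha>) (\<tau> R)
            = compose (carrier (Fo R)) (\<tau> R') (Fm R R' \<alpha>))"

end

theory Submission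
  imports Defs
begin

text \<open>
  Write \<open>A\<close> and \<open>B\<close> for the \<open>K\<close>-algebras \<open>\<F>(K)\<close> and \<open>\<G>(K)\<close>. Extension invariance identifies \<open>\<F>(F)\<close> with
  \<open>A \<otimes> F\<close> and \<open>\<G>(F)\<close> with \<open>B \<otimes> F\<close>, so it is enough to show, for a single field \<open>F\<close> over \<open>K\<close>, that
  \<open>A \<otimes> F \<cong> B \<otimes> F\<close> over \<open>F\<close> if and only if \<open>A \<cong> B\<close> over \<open>K\<close>
  (\<open>isomorphic_over_field_iff_over_base\<close>): the right-hand side does not mention \<open>F\<close>.

  From \<open>A \<cong> B\<close> one gets \<open>A \<otimes> F \<cong> B \<otimes> F\<close> because an extension of scalars is unique
  (\<open>scalar_extension_unique\<close>). Conversely, choose bases \<open>I\<close> of \<open>A\<close> and \<open>J\<close> of \<open>B\<close>. An isomorphism of the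
  extended algebras and its inverse are given by matrices over \<open>F\<close> with finitely many nonzero entries
  in each row. That these matrices are inverse to each other and respect multiplication are polynomial
  identities in their entries whose coefficients are structure constants of \<open>A\<close> and \<open>B\<close>. A ring
  homomorphism into \<open>K\<close> that is defined on the entries and fixes the structure constants therefore
  carries the matrices to an isomorphism of \<open>A\<close> with \<open>B\<close> (\<open>scalar_extension_descent\<close>).

  Such a homomorphism exists because fewer than \<open>|K|\<close> elements are involved (\<open>specialization\<close>). It is
  built by adjoining one element of \<open>F\<close> at a time to a subring \<open>R\<close> on which it is already defined
  (\<open>specialization_step\<close>): an element that is algebraic over \<open>R\<close> goes to a root of the image of a
  polynomial of least degree that it satisfies, any other one to an element of \<open>K\<close> off a small set. If \<open>K\<close> is
  countable, there are only finitely many elements to adjoin, and all of \<open>K\<close> can be kept fixed; this is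
  the classical specialization argument behind the Nullstellensatz. If \<open>K\<close> is uncountable, the
  structure constants and the entries generate a ring \<open>M\<close> with \<open>|M| < |K|\<close>; fixing only \<open>K \<inter> M\<close>, a maximal
  injective partial homomorphism from \<open>M\<close> to \<open>K\<close> is defined on all of \<open>M\<close>, since there is always room in
  \<open>K\<close> for one more transcendental element.
\<close>

section \<open>Bases, coordinates and linear functionals\<close>

definition linear_maps ::
    "('r, 'c) ring_scheme \<Rightarrow> ('r, 'v, 'd) module_scheme \<Rightarrow> ('r, 'w, 'e) module_scheme \<Rightarrow> ('v \<Rightarrow> 'w) set" where
  "linear_maps R M N = {h \<in> carrier M \<rightarrow> carrier N.
     (\<forall>x \<in> carrier M. \<forall>y \<in> carrier M. h (x \<oplus>\<^bsub>M\<^esub> y) = h x \<oplus>\<^bsub>N\<^esub> h y) \<and>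
     (\<forall>a \<in> carrier R. \<forall>x \<in> carrier M. h (a \<odot>\<^bsub>M\<^esub> x) = a \<odot>\<^bsub>N\<^esub> h x)}"

lemma linear_maps_closed: "\<lbrakk>h \<in> linear_maps R M N; x \<in> carrier M\<rbrakk> \<Longrightarrow> h x \<in> carrier N"
  and linear_maps_add: "\<lbrakk>h \<in> linear_maps R M N; x \<in> carrier M; y \<in> carrier M\<rbrakk> \<Longrightarrow> h (x \<oplus>\<^bsub>M\<^esub> y) = h x \<oplus>\<^bsub>N\<^esub> h y"
  and linear_maps_smult: "\<lbrakk>h \<in> linear_maps R M N; a \<in> carrier R; x \<in> carrier M\<rbrakk> \<Longrightarrow> h (a \<odot>\<^bsub>M\<^esub> x) = a \<odot>\<^bsub>N\<^esub> h x"
  unfolding linear_maps_def by auto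

lemma linear_maps_zero:
  assumes "module R M" "module R N" "h \<in> linear_maps R M N"
  shows "h \<zero>\<^bsub>M\<^esub> = \<zero>\<^bsub>N\<^esub>"
proof -
  interpret M: module R M by fact
  interpret N: module R N by fact
  show ?thesis
    using linear_maps_smult[OF assms(3), of "\<zero>\<^bsub>R\<^esub>" "\<zero>\<^bsub>M\<^esub>"] linear_maps_closed[OF assms(3), of "\<zero>\<^bsub>M\<^esub>"] by simp
qed

lemma base_alg_simps [simp]:
  "carrier (base_alg K) = carrier K" "monoid.mult (base_alg K) = monoid.mult K" "one (base_alg K) = one K"
  "ring.zero (base_alg K) = ring.zero K" "add (base_alg K) = add K" "smult (base_alg K) = monoid.mult K"
  by (simp_all add: base_alg_def)

lemma module_base_alg:
  assumes "cring K"
  shows "module K (base_alg K)"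
proof -
  interpret cring K by fact
  have "abelian_group (base_alg K)"
  proof (rule abelian_groupI)
    fix x assume "x \<in> carrier (base_alg K)"
    then show "\<exists>y \<in> carrier (base_alg K). y \<oplus>\<^bsub>base_alg K\<^esub> x = \<zero>\<^bsub>base_alg K\<^esub>"
      by (intro bexI[of _ "\<ominus>\<^bsub>K\<^esub> x"]) (simp_all add: l_neg)
  qed (simp_all add: a_ac)
  then show ?thesis
    by (intro moduleI assms) (auto simp: l_distr r_distr m_assoc)
qed

context module
begin

lemma smult_funcset:
  "\<lbrakk>a \<in> A \<rightarrow> carrier R; v \<in> A \<rightarrow> carrier M\<rbrakk> \<Longrightarrow> (\<lambda>b. a b \<odot>\<^bsub>M\<^esub> v b) \<in> A \<rightarrow> carrier M"
  by (intro funcsetI smult_closed) auto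

lemma finsum_coeffs_extend:
  assumes "finite T" "A \<subseteq> T" "v \<in> T \<rightarrow> carrier M" "a \<in> A \<rightarrow> carrier R"
  shows "(\<Oplus>\<^bsub>M\<^esub>b\<in>A. a b \<odot>\<^bsub>M\<^esub> v b) = (\<Oplus>\<^bsub>M\<^esub>b\<in>T. (if b \<in> A then a b else \<zero>) \<odot>\<^bsub>M\<^esub> v b)"
proof (rule M.add.finprod_mono_neutral_cong_left[OF assms(1,2)])
  show "(if b \<in> A then a b else \<zero>) \<odot>\<^bsub>M\<^esub> v b = \<zero>\<^bsub>M\<^esub>" if "b \<in> T - A" for b
    using that smult_l_null[OF funcset_mem[OF assms(3), of b]] by simp
  show "a b \<odot>\<^bsub>M\<^esub> v b = (if b \<in> A then a b else \<zero>) \<odot>\<^bsub>M\<^esub> v b" if "b \<in> A" for b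
    using that by simp
  show "(\<lambda>b. (if b \<in> A then a b else \<zero>) \<odot>\<^bsub>M\<^esub> v b) \<in> T \<rightarrow> carrier M"
    using assms(3,4) by (intro funcsetI smult_closed) auto
qed

lemma finsum_coeffs_add:
  assumes "v \<in> A \<rightarrow> carrier M" "a \<in> A \<rightarrow> carrier R" "c \<in> A \<rightarrow> carrier R"
  shows "(\<Oplus>\<^bsub>M\<^esub>b\<in>A. (a b \<oplus> c b) \<odot>\<^bsub>M\<^esub> v b) = (\<Oplus>\<^bsub>M\<^esub>b\<in>A. a b \<odot>\<^bsub>M\<^esub> v b) \<oplus>\<^bsub>M\<^esub> (\<Oplus>\<^bsub>M\<^esub>b\<in>A. c b \<odot>\<^bsub>M\<^esub> v b)"
proof -
  have "(\<Oplus>\<^bsub>M\<^esub>b\<in>A. (a b \<oplus> c b) \<odot>\<^bsub>M\<^esub> v b) = (\<Oplus>\<^bsub>M\<^esub>b\<in>A. a b \<odot>\<^bsub>M\<^esub> v b \<oplus>\<^bsub>M\<^esub> c b \<odot>\<^bsub>M\<^esub> v b)"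
    using assms by (intro M.finsum_cong') (auto simp: Pi_def smult_l_distr)
  also have "\<dots> = (\<Oplus>\<^bsub>M\<^esub>b\<in>A. a b \<odot>\<^bsub>M\<^esub> v b) \<oplus>\<^bsub>M\<^esub> (\<Oplus>\<^bsub>M\<^esub>b\<in>A. c b \<odot>\<^bsub>M\<^esub> v b)"
    using assms by (intro M.finsum_addf) (auto simp: Pi_def)
  finally show ?thesis .
qed

lemma finsum_coeffs_smult:
  assumes "finite A" "v \<in> A \<rightarrow> carrier M" "a \<in> A \<rightarrow> carrier R" "k \<in> carrier R"
  shows "(\<Oplus>\<^bsub>M\<^esub>b\<in>A. (k \<otimes> a b) \<odot>\<^bsub>M\<^esub> v b) = k \<odot>\<^bsub>M\<^esub> (\<Oplus>\<^bsub>M\<^esub>b\<in>A. a b \<odot>\<^bsub>M\<^esub> v b)"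
proof -
  have "(\<Oplus>\<^bsub>M\<^esub>b\<in>A. (k \<otimes> a b) \<odot>\<^bsub>M\<^esub> v b) = (\<Oplus>\<^bsub>M\<^esub>b\<in>A. k \<odot>\<^bsub>M\<^esub> (a b \<odot>\<^bsub>M\<^esub> v b))"
    using assms by (intro M.finsum_cong') (auto simp: Pi_def smult_assoc1)
  also have "\<dots> = k \<odot>\<^bsub>M\<^esub> (\<Oplus>\<^bsub>M\<^esub>b\<in>A. a b \<odot>\<^bsub>M\<^esub> v b)"
    using assms by (intro finsum_smult_ldistr[symmetric]) (auto simp: Pi_def)
  finally show ?thesis .
qed

lemma basis_carrier: "\<lbrakk>module_basis R M B; b \<in> B\<rbrakk> \<Longrightarrow> b \<in> carrier M"
  unfolding module_basis_def by auto

lemma basis_independent: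
  assumes B: "module_basis R M B" and A: "finite A" "A \<subseteq> B" "a \<in> A \<rightarrow> carrier R"
    and 0: "(\<Oplus>\<^bsub>M\<^esub>b\<in>A. a b \<odot>\<^bsub>M\<^esub> b) = \<zero>\<^bsub>M\<^esub>" and b: "b \<in> A"
  shows "a b = \<zero>"
proof -
  have "\<forall>A a. finite A \<and> A \<subseteq> B \<and> a \<in> A \<rightarrow> carrier R \<and>
            (\<Oplus>\<^bsub>M\<^esub>b\<in>A. a b \<odot>\<^bsub>M\<^esub> b) = \<zero>\<^bsub>M\<^esub> \<longrightarrow> (\<forall>b \<in> A. a b = \<zero>)"
    using B unfolding module_basis_def by (elim conjE)
  from this[rule_format, of A a b] show ?thesis using A 0 b by simp
qed

lemma basis_spanE:
  assumes B: "module_basis R M B" and x: "x \<in> carrier M"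
  obtains A a where "finite A" "A \<subseteq> B" "a \<in> A \<rightarrow> carrier R" "x = (\<Oplus>\<^bsub>M\<^esub>b\<in>A. a b \<odot>\<^bsub>M\<^esub> b)"
proof -
  have "\<forall>x \<in> carrier M. \<exists>A a. finite A \<and> A \<subseteq> B \<and> a \<in> A \<rightarrow> carrier R \<and> x = (\<Oplus>\<^bsub>M\<^esub>b\<in>A. a b \<odot>\<^bsub>M\<^esub> b)"
    using B unfolding module_basis_def by (elim conjE)
  from bspec[OF this x] show ?thesis by (elim exE conjE) (rule that)
qed

lemma basis_induct [consumes 2, case_names basis zero add smult]:
  assumes B: "module_basis R M B" and x: "x \<in> carrier M"
    and basis: "\<And>b. b \<in> B \<Longrightarrow> P b"
    and zero: "P \<zero>\<^bsub>M\<^esub>"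
    and add: "\<And>x y. \<lbrakk>x \<in> carrier M; y \<in> carrier M; P x; P y\<rbrakk> \<Longrightarrow> P (x \<oplus>\<^bsub>M\<^esub> y)"
    and smult: "\<And>a x. \<lbrakk>a \<in> carrier R; x \<in> carrier M; P x\<rbrakk> \<Longrightarrow> P (a \<odot>\<^bsub>M\<^esub> x)"
  shows "P x"
proof -
  obtain A a where A: "finite A" "A \<subseteq> B" "a \<in> A \<rightarrow> carrier R" "x = (\<Oplus>\<^bsub>M\<^esub>b\<in>A. a b \<odot>\<^bsub>M\<^esub> b)"
    by (rule basis_spanE[OF B x])
  have "P (\<Oplus>\<^bsub>M\<^esub>b\<in>A. a b \<odot>\<^bsub>M\<^esub> b)" using A(1-3)
  proof (induction A rule: finite_induct)
    case empty
    then show ?case using zero by simp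
  next
    case (insert c A)
    have c: "c \<in> carrier M" using insert.prems basis_carrier[OF B] by auto
    have cl: "(\<lambda>b. a b \<odot>\<^bsub>M\<^esub> b) \<in> A \<rightarrow> carrier M"
      using insert.prems basis_carrier[OF B] by (intro smult_funcset) auto
    have ac: "a c \<in> carrier R" "c \<in> B" using insert.prems by auto
    have acc: "a c \<odot>\<^bsub>M\<^esub> c \<in> carrier M" by (rule smult_closed[OF ac(1) c])
    have "(\<Oplus>\<^bsub>M\<^esub>b\<in>insert c A. a b \<odot>\<^bsub>M\<^esub> b) = a c \<odot>\<^bsub>M\<^esub> c \<oplus>\<^bsub>M\<^esub> (\<Oplus>\<^bsub>M\<^esub>b\<in>A. a b \<odot>\<^bsub>M\<^esub> b)"
      by (rule M.finsum_insert[OF insert.hyps cl acc])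
    moreover have "P (\<Oplus>\<^bsub>M\<^esub>b\<in>A. a b \<odot>\<^bsub>M\<^esub> b)" using insert.prems by (intro insert.IH) auto
    ultimately show ?case
      using add[OF acc M.finsum_closed[OF cl] smult[OF ac(1) c basis[OF ac(2)]]] by simp
  qed
  then show ?thesis unfolding A(4) .
qed

end

text \<open>
  The value at \<open>x\<close> is read off from a finite expansion of \<open>x\<close> in \<open>B\<close>. It does not depend on the expansion:
  two of them may be padded with zeros to a common finite set, and then independence makes their
  coefficients equal.
\<close>

lemma linear_extension:
  fixes R :: "('r, 'c) ring_scheme" and M :: "('r, 'v, 'd) module_scheme" and W :: "('r, 'w, 'e) module_scheme"
  assumes M: "module R M" and W: "module R W" and B: "module_basis R M B" and g: "g \<in> B \<rightarrow> carrier W"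
  obtains h where "h \<in> linear_maps R M W" "\<And>b. b \<in> B \<Longrightarrow> h b = g b"
proof -
  interpret M: module R M by fact
  interpret W: module R W by fact
  have BM: "B \<subseteq> carrier M" using M.basis_carrier[OF B] by auto
  define rep where "rep x A a \<longleftrightarrow> finite A \<and> A \<subseteq> B \<and> a \<in> A \<rightarrow> carrier R \<and> x = (\<Oplus>\<^bsub>M\<^esub>b\<in>A. a b \<odot>\<^bsub>M\<^esub> b)" for x A a
  define val where "val A a = (\<Oplus>\<^bsub>W\<^esub>b\<in>A. a b \<odot>\<^bsub>W\<^esub> g b)" for A a
  have v: "(\<lambda>b. b) \<in> T \<rightarrow> carrier M" "g \<in> T \<rightarrow> carrier W" if "T \<subseteq> B" for T
    using that BM g by auto
  have val_closed: "val A a \<in> carrier W" if "rep x A a" for x A a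
    using that g unfolding val_def rep_def by (intro W.finsum_closed W.smult_funcset) auto
  define pad where "pad A a b = (if b \<in> A then a b else \<zero>\<^bsub>R\<^esub>)" for A :: "'v set" and a b
  have pad_closed: "pad A a \<in> T \<rightarrow> carrier R" if "rep x A a" for x A a T
    using that by (auto simp: pad_def rep_def)
  have pad: "rep x T (pad A a)" "val T (pad A a) = val A a" if "rep x A a" "finite T" "A \<subseteq> T" "T \<subseteq> B" for x A a T
    using that M.finsum_coeffs_extend[of T A "\<lambda>b. b" a] W.finsum_coeffs_extend[of T A g a] v[OF that(4)]
    unfolding rep_def val_def pad_def by auto
  have unique: "val A a = val A' a'" if r: "rep x A a" and r': "rep x A' a'" for x A a A' a'
  proof -
    define T where "T = A \<union> A'"
    have T: "finite T" "A \<subseteq> T" "A' \<subseteq> T" "T \<subseteq> B" using r r' by (auto simp: T_def rep_def)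
    define c c' where "c = pad A a" and "c' = pad A' a'"
    have c: "rep x T c" "val T c = val A a" "c \<in> T \<rightarrow> carrier R" using pad[OF r T(1,2,4)] pad_closed[OF r] by (auto simp: c_def)
    have c': "rep x T c'" "val T c' = val A' a'" "c' \<in> T \<rightarrow> carrier R" using pad[OF r' T(1,3,4)] pad_closed[OF r'] by (auto simp: c'_def)
    have nc': "(\<lambda>b. \<ominus>\<^bsub>R\<^esub> \<one>\<^bsub>R\<^esub> \<otimes>\<^bsub>R\<^esub> c' b) \<in> T \<rightarrow> carrier R" using c'(3) by auto
    have x: "x = (\<Oplus>\<^bsub>M\<^esub>b\<in>T. c b \<odot>\<^bsub>M\<^esub> b)" "x = (\<Oplus>\<^bsub>M\<^esub>b\<in>T. c' b \<odot>\<^bsub>M\<^esub> b)" "x \<in> carrier M"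
    proof -
      show "x = (\<Oplus>\<^bsub>M\<^esub>b\<in>T. c b \<odot>\<^bsub>M\<^esub> b)" "x = (\<Oplus>\<^bsub>M\<^esub>b\<in>T. c' b \<odot>\<^bsub>M\<^esub> b)" using c c' by (auto simp: rep_def)
      then show "x \<in> carrier M" using M.M.finsum_closed[OF M.smult_funcset[OF c(3) v(1)[OF T(4)]]] by simp
    qed
    have "(\<Oplus>\<^bsub>M\<^esub>b\<in>T. (c b \<oplus>\<^bsub>R\<^esub> \<ominus>\<^bsub>R\<^esub> \<one>\<^bsub>R\<^esub> \<otimes>\<^bsub>R\<^esub> c' b) \<odot>\<^bsub>M\<^esub> b) = x \<oplus>\<^bsub>M\<^esub> (\<ominus>\<^bsub>R\<^esub> \<one>\<^bsub>R\<^esub>) \<odot>\<^bsub>M\<^esub> x"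
      using M.finsum_coeffs_add[OF v(1)[OF T(4)] c(3) nc'] M.finsum_coeffs_smult[OF T(1) v(1)[OF T(4)] c'(3)] x by simp
    also have "\<dots> = \<zero>\<^bsub>M\<^esub>" using x(3) by (simp add: M.smult_l_minus M.r_neg)
    finally have 0: "(\<Oplus>\<^bsub>M\<^esub>b\<in>T. (c b \<oplus>\<^bsub>R\<^esub> \<ominus>\<^bsub>R\<^esub> \<one>\<^bsub>R\<^esub> \<otimes>\<^bsub>R\<^esub> c' b) \<odot>\<^bsub>M\<^esub> b) = \<zero>\<^bsub>M\<^esub>" .
    have eq: "c b = c' b" if b: "b \<in> T" for b
    proof -
      have "c b \<oplus>\<^bsub>R\<^esub> \<ominus>\<^bsub>R\<^esub> \<one>\<^bsub>R\<^esub> \<otimes>\<^bsub>R\<^esub> c' b = \<zero>\<^bsub>R\<^esub>"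
        using M.basis_independent[OF B T(1,4) _ 0 b] c(3) c'(3) by (simp add: Pi_def)
      moreover have "c b \<in> carrier R" "c' b \<in> carrier R" using b c(3) c'(3) by auto
      ultimately show ?thesis by (simp add: M.R.l_minus flip: M.R.minus_eq)
    qed
    have "val T c = val T c'" unfolding val_def
      using eq c'(3) v[OF T(4)] by (intro W.finsum_cong') (auto simp: Pi_def)
    then show ?thesis using c(2) c'(2) by simp
  qed
  define h where "h x = (let p = SOME p. rep x (fst p) (snd p) in val (fst p) (snd p))" for x
  have h: "h x = val A a" if "rep x A a" for x A a
  proof -
    let ?p = "SOME p. rep x (fst p) (snd p)"
    have "rep x (fst ?p) (snd ?p)"
      by (rule someI[of "\<lambda>p. rep x (fst p) (snd p)" "(A, a)"]) (simp add: that)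
    from unique[OF this that] show ?thesis by (simp add: h_def Let_def)
  qed
  have ex: "\<exists>A a. rep x A a" if "x \<in> carrier M" for x
    unfolding rep_def by (rule M.basis_spanE[OF B that]) blast
  have "h \<in> linear_maps R M W"
    unfolding linear_maps_def
  proof (intro CollectI conjI ballI funcsetI)
    fix x assume x: "x \<in> carrier M"
    then obtain A a where r: "rep x A a" using ex by blast
    then show "h x \<in> carrier W" using h[OF r] val_closed[OF r] by simp
    fix y assume y: "y \<in> carrier M"
    then obtain A' a' where r': "rep y A' a'" using ex by blast
    define T where "T = A \<union> A'"
    have T: "finite T" "A \<subseteq> T" "A' \<subseteq> T" "T \<subseteq> B" using r r' by (auto simp: T_def rep_def)
    define c c' where "c = pad A a" and "c' = pad A' a'"
    have c: "rep x T c" "c \<in> T \<rightarrow> carrier R" using pad[OF r T(1,2,4)] pad_closed[OF r] by (auto simp: c_def)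
    have c': "rep y T c'" "c' \<in> T \<rightarrow> carrier R" using pad[OF r' T(1,3,4)] pad_closed[OF r'] by (auto simp: c'_def)
    have "rep (x \<oplus>\<^bsub>M\<^esub> y) T (\<lambda>b. c b \<oplus>\<^bsub>R\<^esub> c' b)"
      using M.finsum_coeffs_add[OF v(1)[OF T(4)] c(2) c'(2)] T c c' unfolding rep_def by (simp add: Pi_def)
    then have "h (x \<oplus>\<^bsub>M\<^esub> y) = val T (\<lambda>b. c b \<oplus>\<^bsub>R\<^esub> c' b)" by (rule h)
    also have "\<dots> = h x \<oplus>\<^bsub>W\<^esub> h y"
      unfolding h[OF c(1)] h[OF c'(1)] val_def by (rule W.finsum_coeffs_add[OF v(2)[OF T(4)] c(2) c'(2)])
    finally show "h (x \<oplus>\<^bsub>M\<^esub> y) = h x \<oplus>\<^bsub>W\<^esub> h y" .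
  next
    fix k x assume k: "k \<in> carrier R" and x: "x \<in> carrier M"
    then obtain A a where r: "rep x A a" using ex by blast
    then have A: "finite A" "A \<subseteq> B" "a \<in> A \<rightarrow> carrier R" by (auto simp: rep_def)
    have "rep (k \<odot>\<^bsub>M\<^esub> x) A (\<lambda>b. k \<otimes>\<^bsub>R\<^esub> a b)"
      using M.finsum_coeffs_smult[OF A(1) v(1)[OF A(2)] A(3) k] r k unfolding rep_def by (simp add: Pi_def)
    then have "h (k \<odot>\<^bsub>M\<^esub> x) = val A (\<lambda>b. k \<otimes>\<^bsub>R\<^esub> a b)" by (rule h)
    also have "\<dots> = k \<odot>\<^bsub>W\<^esub> h x"
      unfolding h[OF r] val_def by (rule W.finsum_coeffs_smult[OF A(1) v(2)[OF A(2)] A(3) k])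
    finally show "h (k \<odot>\<^bsub>M\<^esub> x) = k \<odot>\<^bsub>W\<^esub> h x" .
  qed
  moreover have "h b = g b" if b: "b \<in> B" for b
  proof -
    have bM: "b \<in> carrier M" and gb: "g b \<in> carrier W" using b BM g by auto
    have "rep b {b} (\<lambda>_. \<one>\<^bsub>R\<^esub>)" unfolding rep_def using b bM by simp
    then have "h b = val {b} (\<lambda>_. \<one>\<^bsub>R\<^esub>)" by (rule h)
    then show ?thesis unfolding val_def using gb by simp
  qed
  ultimately show ?thesis using that by blast
qed

text \<open>
  The ring \<open>R\<close> as a module over itself is \<^term>\<open>base_alg R\<close>, so a linear functional is a linear map to
  \<^term>\<open>base_alg R\<close>. Outside this section bases are used only through their coordinate
  functionals, \<open>basis_induct\<close> and \<open>linear_extension\<close>, which avoids finite sums.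
\<close>

lemma coordinate_functionals:
  fixes R :: "('r, 'c) ring_scheme" and M :: "('r, 'v, 'd) module_scheme"
  assumes M: "module R M" and B: "module_basis R M B"
  obtains \<delta> where "\<And>b. b \<in> B \<Longrightarrow> \<delta> b \<in> linear_maps R M (base_alg R)"
    "\<And>b c. \<lbrakk>b \<in> B; c \<in> B\<rbrakk> \<Longrightarrow> \<delta> b c = (if c = b then \<one>\<^bsub>R\<^esub> else \<zero>\<^bsub>R\<^esub>)"
    "\<And>x y. \<lbrakk>x \<in> carrier M; y \<in> carrier M; \<And>b. b \<in> B \<Longrightarrow> \<delta> b x = \<delta> b y\<rbrakk> \<Longrightarrow> x = y"
proof -
  interpret M: module R M by fact
  have base: "module R (base_alg R)" by (rule module_base_alg) (rule M.R.cring_axioms)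
  have "\<exists>h. h \<in> linear_maps R M (base_alg R) \<and> (\<forall>c \<in> B. h c = (if c = b then \<one>\<^bsub>R\<^esub> else \<zero>\<^bsub>R\<^esub>))" for b
  proof -
    have "(\<lambda>c. if c = b then \<one>\<^bsub>R\<^esub> else \<zero>\<^bsub>R\<^esub>) \<in> B \<rightarrow> carrier (base_alg R)" by simp
    from linear_extension[OF M base B this] show ?thesis by metis
  qed
  then obtain \<delta> where \<delta>: "\<And>b. \<delta> b \<in> linear_maps R M (base_alg R)"
    "\<And>b c. c \<in> B \<Longrightarrow> \<delta> b c = (if c = b then \<one>\<^bsub>R\<^esub> else \<zero>\<^bsub>R\<^esub>)" by metis
  have zero: "x = \<zero>\<^bsub>M\<^esub>" if x: "x \<in> carrier M" and 0: "\<And>b. b \<in> B \<Longrightarrow> \<delta> b x = \<zero>\<^bsub>R\<^esub>" for x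
  proof -
    obtain A a where A: "finite A" "A \<subseteq> B" "a \<in> A \<rightarrow> carrier R" "x = (\<Oplus>\<^bsub>M\<^esub>b\<in>A. a b \<odot>\<^bsub>M\<^esub> b)"
      by (rule M.basis_spanE[OF B x])
    have coord: "\<delta> b (\<Oplus>\<^bsub>M\<^esub>c\<in>A. a c \<odot>\<^bsub>M\<^esub> c) = (if b \<in> A then a b else \<zero>\<^bsub>R\<^esub>)" if "b \<in> B" for b
      using A(1-3)
    proof (induction A rule: finite_induct)
      case empty
      then show ?case using linear_maps_zero[OF M base \<delta>(1)] by simp
    next
      case (insert c A)
      have c: "c \<in> carrier M" "a c \<in> carrier R" using insert.prems M.basis_carrier[OF B] by auto
      have cl: "(\<lambda>b. a b \<odot>\<^bsub>M\<^esub> b) \<in> A \<rightarrow> carrier M"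
        using insert.prems M.basis_carrier[OF B] by (intro M.smult_funcset) auto
      have "(\<Oplus>\<^bsub>M\<^esub>b\<in>insert c A. a b \<odot>\<^bsub>M\<^esub> b) = a c \<odot>\<^bsub>M\<^esub> c \<oplus>\<^bsub>M\<^esub> (\<Oplus>\<^bsub>M\<^esub>b\<in>A. a b \<odot>\<^bsub>M\<^esub> b)"
        using insert.hyps insert.prems c cl by (intro M.M.finsum_insert) auto
      moreover have "\<delta> b (\<Oplus>\<^bsub>M\<^esub>c\<in>A. a c \<odot>\<^bsub>M\<^esub> c) = (if b \<in> A then a b else \<zero>\<^bsub>R\<^esub>)"
        using insert by (simp add: Pi_def)
      moreover have "(\<Oplus>\<^bsub>M\<^esub>b\<in>A. a b \<odot>\<^bsub>M\<^esub> b) \<in> carrier M" using cl by (rule M.M.finsum_closed)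
      ultimately have "\<delta> b (\<Oplus>\<^bsub>M\<^esub>c\<in>insert c A. a c \<odot>\<^bsub>M\<^esub> c)
          = a c \<otimes>\<^bsub>R\<^esub> \<delta> b c \<oplus>\<^bsub>R\<^esub> (if b \<in> A then a b else \<zero>\<^bsub>R\<^esub>)"
        using c by (simp add: linear_maps_add[OF \<delta>(1)] linear_maps_smult[OF \<delta>(1)])
      moreover have "b \<in> A \<Longrightarrow> a b \<in> carrier R" using insert.prems by auto
      ultimately show ?case using \<delta>(2)[of c b] insert.prems insert.hyps c by auto
    qed
    have az: "a b = \<zero>\<^bsub>R\<^esub>" if "b \<in> A" for b
      using 0[of b] coord[of b] that A(2,4) by (simp add: subset_iff)
    have "x = (\<Oplus>\<^bsub>M\<^esub>b\<in>A. \<zero>\<^bsub>M\<^esub>)"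
      unfolding A(4) using az A(2) M.basis_carrier[OF B] by (intro M.M.finsum_cong') (auto simp: subset_iff)
    then show ?thesis by (simp add: M.M.finsum_zero)
  qed
  have "x = y" if x: "x \<in> carrier M" and y: "y \<in> carrier M" and eq: "\<And>b. b \<in> B \<Longrightarrow> \<delta> b x = \<delta> b y" for x y
  proof -
    define z where "z = (\<ominus>\<^bsub>R\<^esub> \<one>\<^bsub>R\<^esub>) \<odot>\<^bsub>M\<^esub> y"
    have z: "z \<in> carrier M" "z = \<ominus>\<^bsub>M\<^esub> y" using y by (simp_all add: z_def M.smult_l_minus)
    have "x \<oplus>\<^bsub>M\<^esub> z = \<zero>\<^bsub>M\<^esub>"
    proof (rule zero)
      show "x \<oplus>\<^bsub>M\<^esub> z \<in> carrier M" using x z(1) by (rule M.M.add.m_closed)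
      fix b assume "b \<in> B"
      have cl: "\<delta> b y \<in> carrier R" using linear_maps_closed[OF \<delta>(1) y] by simp
      have "\<delta> b (x \<oplus>\<^bsub>M\<^esub> z) = \<delta> b y \<oplus>\<^bsub>R\<^esub> (\<ominus>\<^bsub>R\<^esub> \<one>\<^bsub>R\<^esub>) \<otimes>\<^bsub>R\<^esub> \<delta> b y"
        using linear_maps_add[OF \<delta>(1) x z(1), of b] linear_maps_smult[OF \<delta>(1) _ y, of "\<ominus>\<^bsub>R\<^esub> \<one>\<^bsub>R\<^esub>" b]
          eq[OF \<open>b \<in> B\<close>] by (simp add: z_def)
      then show "\<delta> b (x \<oplus>\<^bsub>M\<^esub> z) = \<zero>\<^bsub>R\<^esub>" using cl by (simp add: M.R.l_minus M.R.r_neg)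
    qed
    then show ?thesis using x y z M.M.minus_equality[of x z] by simp
  qed
  then show ?thesis using that[of \<delta>] \<delta> by blast
qed

text \<open>A maximal independent set, which exists by Zorn's lemma, spans.\<close>

lemma basis_exists:
  fixes K :: "('r, 'c) ring_scheme" and M :: "('r, 'v, 'd) module_scheme"
  assumes K: "field K" and M: "module K M"
  shows "\<exists>B. module_basis K M B"
proof -
  interpret K: field K by fact
  interpret M: module K M by fact
  define indep where "indep B \<longleftrightarrow> B \<subseteq> carrier M \<and> (\<forall>A a. finite A \<and> A \<subseteq> B \<and> a \<in> A \<rightarrow> carrier K \<and>
            (\<Oplus>\<^bsub>M\<^esub>b\<in>A. a b \<odot>\<^bsub>M\<^esub> b) = \<zero>\<^bsub>M\<^esub> \<longrightarrow> (\<forall>b \<in> A. a b = \<zero>\<^bsub>K\<^esub>))" for B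
  have "\<exists>B \<in> {B. indep B}. \<forall>B' \<in> {B. indep B}. B \<subseteq> B' \<longrightarrow> B' = B"
  proof (rule subset_Zorn_nonempty)
    have "indep {}" by (auto simp: indep_def)
    then show "{B. indep B} \<noteq> {}" by blast
    fix \<C> assume \<C>: "\<C> \<noteq> {}" "subset.chain {B. indep B} \<C>"
    have mem: "indep B" if "B \<in> \<C>" for B using \<C>(2) that by (auto simp: subset_chain_def)
    show "\<Union>\<C> \<in> {B. indep B}"
    proof (clarsimp simp only: mem_Collect_eq, subst indep_def, intro conjI allI impI ballI)
      show "\<Union>\<C> \<subseteq> carrier M" using mem by (auto simp: indep_def)
      fix A a b assume A: "finite A \<and> A \<subseteq> \<Union>\<C> \<and> a \<in> A \<rightarrow> carrier K \<and> (\<Oplus>\<^bsub>M\<^esub>b\<in>A. a b \<odot>\<^bsub>M\<^esub> b) = \<zero>\<^bsub>M\<^esub>" and b: "b \<in> A"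
      then obtain B where B: "B \<in> \<C>" "A \<subseteq> B"
        using finite_subset_Union_chain[of A \<C> "{B. indep B}"] \<C> by blast
      have "\<forall>A a. finite A \<and> A \<subseteq> B \<and> a \<in> A \<rightarrow> carrier K \<and>
            (\<Oplus>\<^bsub>M\<^esub>b\<in>A. a b \<odot>\<^bsub>M\<^esub> b) = \<zero>\<^bsub>M\<^esub> \<longrightarrow> (\<forall>b \<in> A. a b = \<zero>\<^bsub>K\<^esub>)"
        using mem[OF B(1)] unfolding indep_def by (elim conjE)
      from this[rule_format, of A a b] show "a b = \<zero>\<^bsub>K\<^esub>" using A b B(2) by simp
    qed
  qed
  then obtain B where B: "indep B" and max: "\<And>B'. \<lbrakk>indep B'; B \<subseteq> B'\<rbrakk> \<Longrightarrow> B' = B" by blast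
  have BM: "B \<subseteq> carrier M" using B by (simp add: indep_def)
  have ind: "a b = \<zero>\<^bsub>K\<^esub>" if "finite A" "A \<subseteq> B" "a \<in> A \<rightarrow> carrier K" "(\<Oplus>\<^bsub>M\<^esub>b\<in>A. a b \<odot>\<^bsub>M\<^esub> b) = \<zero>\<^bsub>M\<^esub>" "b \<in> A" for A a b
  proof -
    have "\<forall>A a. finite A \<and> A \<subseteq> B \<and> a \<in> A \<rightarrow> carrier K \<and>
            (\<Oplus>\<^bsub>M\<^esub>b\<in>A. a b \<odot>\<^bsub>M\<^esub> b) = \<zero>\<^bsub>M\<^esub> \<longrightarrow> (\<forall>b \<in> A. a b = \<zero>\<^bsub>K\<^esub>)"
      using B unfolding indep_def by (elim conjE)
    from this[rule_format, of A a b] show ?thesis using that by simp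
  qed
  have span: "\<exists>A a. finite A \<and> A \<subseteq> B \<and> a \<in> A \<rightarrow> carrier K \<and> x = (\<Oplus>\<^bsub>M\<^esub>b\<in>A. a b \<odot>\<^bsub>M\<^esub> b)"
    if x: "x \<in> carrier M" for x
  proof (rule ccontr)
    assume no: "\<not> ?thesis"
    have "indep (insert x B)"
    proof (subst indep_def, intro conjI allI impI ballI)
      show "insert x B \<subseteq> carrier M" using x BM by auto
      fix A a b assume A: "finite A \<and> A \<subseteq> insert x B \<and> a \<in> A \<rightarrow> carrier K \<and> (\<Oplus>\<^bsub>M\<^esub>b\<in>A. a b \<odot>\<^bsub>M\<^esub> b) = \<zero>\<^bsub>M\<^esub>" and b: "b \<in> A"
      define A' where "A' = A - {x}"
      have A': "finite A'" "A' \<subseteq> B" "a \<in> A' \<rightarrow> carrier K" using A by (auto simp: A'_def)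
      define s where "s = (\<Oplus>\<^bsub>M\<^esub>b\<in>A'. a b \<odot>\<^bsub>M\<^esub> b)"
      have cl: "(\<lambda>b. a b \<odot>\<^bsub>M\<^esub> b) \<in> A' \<rightarrow> carrier M" using A' BM by (intro M.smult_funcset) auto
      have s: "s \<in> carrier M" unfolding s_def using cl by (rule M.M.finsum_closed)
      show "a b = \<zero>\<^bsub>K\<^esub>"
      proof (cases "x \<in> A")
        case False
        then have "A \<subseteq> B" using A by auto
        then show ?thesis using ind[of A a b] A b by simp
      next
        case True
        then have ax: "a x \<in> carrier K" using A by auto
        have "A = insert x A'" using True by (auto simp: A'_def)
        then have "(\<Oplus>\<^bsub>M\<^esub>b\<in>A. a b \<odot>\<^bsub>M\<^esub> b) = a x \<odot>\<^bsub>M\<^esub> x \<oplus>\<^bsub>M\<^esub> s"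
          unfolding s_def using A'(1) cl ax x by (simp only:) (intro M.M.finsum_insert, auto simp: A'_def)
        then have sum0: "a x \<odot>\<^bsub>M\<^esub> x \<oplus>\<^bsub>M\<^esub> s = \<zero>\<^bsub>M\<^esub>" using A by simp
        have ax0: "a x = \<zero>\<^bsub>K\<^esub>"
        proof (rule ccontr)
          assume nz: "a x \<noteq> \<zero>\<^bsub>K\<^esub>"
          \<comment> \<open>solving the relation for \<open>x\<close> would put \<open>x\<close> into the span of \<open>B\<close>\<close>
          define k where "k = inv\<^bsub>K\<^esub> (a x)"
          have k: "k \<in> carrier K" "k \<otimes>\<^bsub>K\<^esub> a x = \<one>\<^bsub>K\<^esub>"
            using ax nz by (auto simp: k_def K.field_Units)
          have "x = \<ominus>\<^bsub>M\<^esub> (k \<odot>\<^bsub>M\<^esub> s)"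
          proof -
            have "k \<odot>\<^bsub>M\<^esub> (a x \<odot>\<^bsub>M\<^esub> x \<oplus>\<^bsub>M\<^esub> s) = \<zero>\<^bsub>M\<^esub>" using sum0 k by simp
            then have "x \<oplus>\<^bsub>M\<^esub> k \<odot>\<^bsub>M\<^esub> s = \<zero>\<^bsub>M\<^esub>"
              using k ax x s by (simp add: M.smult_r_distr flip: M.smult_assoc1)
            then show ?thesis using M.M.minus_equality[of x "k \<odot>\<^bsub>M\<^esub> s"] x s k by simp
          qed
          also have "\<dots> = (\<ominus>\<^bsub>K\<^esub> k) \<odot>\<^bsub>M\<^esub> s" using k s by (simp add: M.smult_l_minus)
          also have "\<dots> = (\<Oplus>\<^bsub>M\<^esub>b\<in>A'. (\<ominus>\<^bsub>K\<^esub> k \<otimes>\<^bsub>K\<^esub> a b) \<odot>\<^bsub>M\<^esub> b)"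
            unfolding s_def using A' BM k by (intro M.finsum_coeffs_smult[symmetric]) auto
          finally have "finite A' \<and> A' \<subseteq> B \<and> (\<lambda>b. \<ominus>\<^bsub>K\<^esub> k \<otimes>\<^bsub>K\<^esub> a b) \<in> A' \<rightarrow> carrier K \<and>
              x = (\<Oplus>\<^bsub>M\<^esub>b\<in>A'. (\<ominus>\<^bsub>K\<^esub> k \<otimes>\<^bsub>K\<^esub> a b) \<odot>\<^bsub>M\<^esub> b)"
            using A' k by (auto simp: Pi_def)
          then have "\<exists>A a. finite A \<and> A \<subseteq> B \<and> a \<in> A \<rightarrow> carrier K \<and> x = (\<Oplus>\<^bsub>M\<^esub>b\<in>A. a b \<odot>\<^bsub>M\<^esub> b)"
            by (intro exI)
          with no show False by (rule notE)
        qed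
        then have "s = \<zero>\<^bsub>M\<^esub>" using sum0 x s by simp
        then show ?thesis using ind[OF A', of b] b ax0 unfolding s_def by (cases "b = x") (auto simp: A'_def)
      qed
    qed
    then have "x \<in> B" using max[of "insert x B"] by auto
    then have "finite {x} \<and> {x} \<subseteq> B \<and> (\<lambda>_. \<one>\<^bsub>K\<^esub>) \<in> {x} \<rightarrow> carrier K \<and> x = (\<Oplus>\<^bsub>M\<^esub>b\<in>{x}. \<one>\<^bsub>K\<^esub> \<odot>\<^bsub>M\<^esub> b)"
      using x by simp
    then have "\<exists>A a. finite A \<and> A \<subseteq> B \<and> a \<in> A \<rightarrow> carrier K \<and> x = (\<Oplus>\<^bsub>M\<^esub>b\<in>A. a b \<odot>\<^bsub>M\<^esub> b)"
      by (intro exI)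
    with no show False by (rule notE)
  qed
  have "module_basis K M B"
    unfolding module_basis_def using B[unfolded indep_def] span by simp
  then show ?thesis ..
qed

lemma functionals_separate_points:
  assumes K: "field K" and M: "module K M" and x: "x \<in> carrier M" and y: "y \<in> carrier M"
    and eq: "\<And>f. f \<in> linear_maps K M (base_alg K) \<Longrightarrow> f x = f y"
  shows "x = y"
proof -
  interpret K: field K by fact
  interpret M: module K M by fact
  obtain B where B: "module_basis K M B" using basis_exists[OF K M] by blast
  show ?thesis by (rule coordinate_functionals[OF M B]) (use x y eq in blast)
qed

section \<open>Extending a homomorphism by one element\<close>

lemma (in ring) eval_map_rev_upt:
  assumes "a \<in> {..<n} \<rightarrow> carrier R" "x \<in> carrier R"
  shows "eval (map a (rev [0..<n])) x = (\<Oplus>i\<in>{..<n}. a i \<otimes> x [^] i)"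
  using assms(1)
proof (induction n)
  case 0
  then show ?case by simp
next
  case (Suc n)
  have "eval (map a (rev [0..<n])) x = (\<Oplus>i\<in>{..<n}. a i \<otimes> x [^] i)"
    using Suc by (simp add: Pi_def)
  moreover have "(\<Oplus>i\<in>{..<Suc n}. a i \<otimes> x [^] i)
      = a n \<otimes> x [^] n \<oplus> (\<Oplus>i\<in>{..<n}. a i \<otimes> x [^] i)"
    unfolding lessThan_Suc using Suc.prems assms(2) by (subst finsum_insert) (auto simp: Pi_def)
  ultimately show ?case by simp
qed

text \<open>
  The root axiom of \<^locale>\<open>algebraically_closed\<close> speaks about polynomials as lists of coefficients, leading
  one first; here it is turned into a statement about sums of powers, the form in which evaluation
  of elements of \<^term>\<open>UP R\<close> produces them.
\<close>

lemma (in algebraically_closed) finite_nonempty_polynomial_roots: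
  fixes n :: nat
  assumes a: "a \<in> {..n} \<rightarrow> carrier L" and lead: "a n \<noteq> \<zero>"
  shows "finite {x \<in> carrier L. (\<Oplus>i\<in>{..n}. a i \<otimes> x [^] i) = \<zero>}"
    and "n > 0 \<Longrightarrow> {x \<in> carrier L. (\<Oplus>i\<in>{..n}. a i \<otimes> x [^] i) = \<zero>} \<noteq> {}"
proof -
  define p where "p = map a (rev [0..<Suc n])"
  have p: "p \<in> carrier (poly_ring L)"
    using a lead unfolding p_def by (auto simp: univ_poly_def polynomial_def Pi_def)
  have p0: "p \<noteq> []" and deg: "length p - 1 = n" by (auto simp: p_def)
  have ev: "eval p x = (\<Oplus>i\<in>{..n}. a i \<otimes> x [^] i)" if "x \<in> carrier L" for x
    using eval_map_rev_upt[of a "Suc n" x] a that unfolding p_def lessThan_Suc_atMost by (simp add: Pi_def)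
  have roots: "{x \<in> carrier L. (\<Oplus>i\<in>{..n}. a i \<otimes> x [^] i) = \<zero>} = set_mset (roots p)"
    using roots_mem_iff_is_root[OF p] p0 ev unfolding is_root_def by auto
  show "finite {x \<in> carrier L. (\<Oplus>i\<in>{..n}. a i \<otimes> x [^] i) = \<zero>}" unfolding roots by simp
  assume "n > 0"
  then show "{x \<in> carrier L. (\<Oplus>i\<in>{..n}. a i \<otimes> x [^] i) = \<zero>} \<noteq> {}"
    using roots_over_carrier[OF p] deg unfolding roots splitted_def by auto
qed

lemma (in domain) nat_pow_nonzero:
  assumes "x \<in> carrier R" "x \<noteq> \<zero>"
  shows "x [^] (n::nat) \<noteq> \<zero>"
  using assms by (induction n) (auto simp: integral_iff)

text \<open>
  Evaluation \<open>E\<close> at an algebraic element \<open>x\<close> is the motivating case, and \<open>p\<close> is a polynomial of least degree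
  with \<open>E p = \<zero>\<close>. Over a field, \<open>p\<close> would be the minimal polynomial, and \<open>E f \<noteq> \<zero>\<close> would have an inverse in the
  image of \<open>E\<close>. Over a domain, only pseudo-division is available, and what remains of the inverse is an
  element \<open>E v\<close> for which \<open>E f \<otimes> E v\<close> is a nonzero constant. Euclid's algorithm for \<open>p\<close> and \<open>f\<close> ends in a nonzero
  constant, because a nonzero remainder has a smaller degree than \<open>p\<close> and hence a nonzero image, while a
  nonconstant divisor of a multiple of \<open>p\<close> would leave a quotient of smaller degree than \<open>p\<close> in the kernel.
\<close>

lemma (in UP_domain) image_divides_constant:
  assumes E: "ring_hom_cring P S E" and S: "domain S"
    and inj: "\<And>a. \<lbrakk>a \<in> carrier R; E (up_ring.monom P a 0) = \<zero>\<^bsub>S\<^esub>\<rbrakk> \<Longrightarrow> a = \<zero>"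
    and p: "p \<in> carrier P" "p \<noteq> \<zero>\<^bsub>P\<^esub>" "E p = \<zero>\<^bsub>S\<^esub>"
    and min: "\<And>q. \<lbrakk>q \<in> carrier P; q \<noteq> \<zero>\<^bsub>P\<^esub>; E q = \<zero>\<^bsub>S\<^esub>\<rbrakk> \<Longrightarrow> deg R p \<le> deg R q"
    and f: "f \<in> carrier P" "E f \<noteq> \<zero>\<^bsub>S\<^esub>"
  shows "\<exists>v \<in> carrier P. \<exists>a \<in> carrier R. a \<noteq> \<zero> \<and> E f \<otimes>\<^bsub>S\<^esub> E v = E (up_ring.monom P a 0)"
proof -
  interpret S: domain S by (rule S)
  interpret E: ring_hom_cring P S E by (rule E)
  have smult: "E (a \<odot>\<^bsub>P\<^esub> g) = E (up_ring.monom P a 0) \<otimes>\<^bsub>S\<^esub> E g" if "a \<in> carrier R" "g \<in> carrier P" for a g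
    using that by (simp flip: monom_mult_is_smult)
  \<comment> \<open>Euclid's algorithm, by induction on the degree\<close>
  have small: "\<exists>v \<in> carrier P. \<exists>a \<in> carrier R. a \<noteq> \<zero> \<and> E g \<otimes>\<^bsub>S\<^esub> E v = E (up_ring.monom P a 0)"
    if "g \<in> carrier P" "E g \<noteq> \<zero>\<^bsub>S\<^esub>" "deg R g < deg R p" for g
    using that
  proof (induction "deg R g" arbitrary: g rule: less_induct)
    case less
    have g: "g \<in> carrier P" "E g \<noteq> \<zero>\<^bsub>S\<^esub>" and g0: "g \<noteq> \<zero>\<^bsub>P\<^esub>" using less.prems by auto
    show ?case
    proof (cases "deg R g = 0")
      case True
      then have "g = up_ring.monom P (up_ring.coeff P g 0) 0" using g(1) by (rule deg_zero_impl_monom[rotated])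
      moreover have "up_ring.coeff P g 0 \<in> carrier R" using g by simp
      moreover have "E g \<otimes>\<^bsub>S\<^esub> E \<one>\<^bsub>P\<^esub> = E g" using g by simp
      ultimately show ?thesis using g by (metis E.hom_zero P.one_closed monom_zero)
    next
      case False
      obtain q r and k :: nat where q: "q \<in> carrier P" and r: "r \<in> carrier P"
        and eq: "up_ring.coeff P g (deg R g) [^] k \<odot>\<^bsub>P\<^esub> p = g \<otimes>\<^bsub>P\<^esub> q \<oplus>\<^bsub>P\<^esub> r"
        and dr: "r = \<zero>\<^bsub>P\<^esub> \<or> deg R r < deg R g"
        using long_div_theorem[OF g(1) p(1) g0] by blast
      let ?c = "up_ring.coeff P g (deg R g) [^] k"
      have c: "?c \<in> carrier R" using g by simp
      have c0: "?c \<noteq> \<zero>" using lcoeff_nonzero2[OF g(1) g0] g(1) by (simp add: R.nat_pow_nonzero)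
      have "\<zero>\<^bsub>S\<^esub> = E (?c \<odot>\<^bsub>P\<^esub> p)" using c p by (simp add: smult)
      also have "\<dots> = E g \<otimes>\<^bsub>S\<^esub> E q \<oplus>\<^bsub>S\<^esub> E r" unfolding eq using g q r by simp
      finally have Eeq: "E g \<otimes>\<^bsub>S\<^esub> E q \<oplus>\<^bsub>S\<^esub> E r = \<zero>\<^bsub>S\<^esub>" ..
      have "r \<noteq> \<zero>\<^bsub>P\<^esub>"
      proof
        assume r0: "r = \<zero>\<^bsub>P\<^esub>"
        then have "E q = \<zero>\<^bsub>S\<^esub>" using Eeq g q by (auto simp: S.integral_iff)
        moreover have eq': "?c \<odot>\<^bsub>P\<^esub> p = g \<otimes>\<^bsub>P\<^esub> q" using eq r0 g q by simp
        have deg1: "deg R (?c \<odot>\<^bsub>P\<^esub> p) = deg R p" using c0 c p by simp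
        then have "g \<otimes>\<^bsub>P\<^esub> q \<noteq> \<zero>\<^bsub>P\<^esub>" using less.prems(3) unfolding eq' by auto
        then have q0: "q \<noteq> \<zero>\<^bsub>P\<^esub>" using g by auto
        ultimately have "deg R p \<le> deg R q" using min q by blast
        moreover have "deg R p = deg R g + deg R q" using deg1 eq' deg_mult[OF g0 q0 g(1) q] by simp
        ultimately show False using False by simp
      qed
      with dr have dr: "deg R r < deg R g" and "r \<noteq> \<zero>\<^bsub>P\<^esub>" by auto
      then have Er: "E r \<noteq> \<zero>\<^bsub>S\<^esub>" using min[OF r] less.prems(3) by fastforce
      obtain v a where v: "v \<in> carrier P" "a \<in> carrier R" "a \<noteq> \<zero>" "E r \<otimes>\<^bsub>S\<^esub> E v = E (up_ring.monom P a 0)"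
        using less.hyps[OF dr r Er] dr less.prems(3) by auto
      have "E r = \<ominus>\<^bsub>S\<^esub> (E g \<otimes>\<^bsub>S\<^esub> E q)"
        using S.minus_equality[of "E r" "E g \<otimes>\<^bsub>S\<^esub> E q"] Eeq g q r by (simp add: S.a_comm)
      then have "E g \<otimes>\<^bsub>S\<^esub> E (\<ominus>\<^bsub>P\<^esub> (q \<otimes>\<^bsub>P\<^esub> v)) = E r \<otimes>\<^bsub>S\<^esub> E v"
        using g q v by (simp add: S.l_minus S.r_minus S.m_assoc)
      then show ?thesis using v q by (metis P.a_inv_closed P.m_closed)
    qed
  qed
  obtain q r and k :: nat where q: "q \<in> carrier P" and r: "r \<in> carrier P"
    and eq: "up_ring.coeff P p (deg R p) [^] k \<odot>\<^bsub>P\<^esub> f = p \<otimes>\<^bsub>P\<^esub> q \<oplus>\<^bsub>P\<^esub> r"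
    and dr: "r = \<zero>\<^bsub>P\<^esub> \<or> deg R r < deg R p"
    using long_div_theorem[OF p(1) f(1) p(2)] by blast
  let ?c = "up_ring.coeff P p (deg R p) [^] k"
  have c: "?c \<in> carrier R" using p by simp
  have c0: "?c \<noteq> \<zero>" using lcoeff_nonzero2[OF p(1,2)] p(1) by (simp add: R.nat_pow_nonzero)
  have "E (?c \<odot>\<^bsub>P\<^esub> f) = E r" unfolding eq using p q r by simp
  then have Er: "E r = E (up_ring.monom P ?c 0) \<otimes>\<^bsub>S\<^esub> E f" using c f by (simp add: smult)
  have "E (up_ring.monom P ?c 0) \<noteq> \<zero>\<^bsub>S\<^esub>" using inj c c0 by blast
  then have Er0: "E r \<noteq> \<zero>\<^bsub>S\<^esub>" unfolding Er using f c by (simp add: S.integral_iff)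
  with dr r have "deg R r < deg R p" by auto
  from small[OF r Er0 this] obtain v a
    where v: "v \<in> carrier P" "a \<in> carrier R" "a \<noteq> \<zero>" "E r \<otimes>\<^bsub>S\<^esub> E v = E (up_ring.monom P a 0)" by blast
  have "E f \<otimes>\<^bsub>S\<^esub> E (?c \<odot>\<^bsub>P\<^esub> v) = E r \<otimes>\<^bsub>S\<^esub> E v"
    unfolding Er using c f v by (simp add: smult S.m_ac)
  then show ?thesis using v c by (metis UP_smult_closed)
qed

text \<open>
  The remainder of a pseudo-division of \<open>f\<close> by \<open>p\<close> is in the kernel and of smaller degree than \<open>p\<close>, so it
  vanishes. Hence a homomorphism into a domain that kills \<open>p\<close> but not its leading coefficient kills the kernel of \<open>E\<close>.
\<close>

lemma (in UP_domain) kernel_multiple: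
  assumes E: "ring_hom_cring P S E" and S: "domain S"
    and p: "p \<in> carrier P" "p \<noteq> \<zero>\<^bsub>P\<^esub>" "E p = \<zero>\<^bsub>S\<^esub>"
    and min: "\<And>q. \<lbrakk>q \<in> carrier P; q \<noteq> \<zero>\<^bsub>P\<^esub>; E q = \<zero>\<^bsub>S\<^esub>\<rbrakk> \<Longrightarrow> deg R p \<le> deg R q"
    and f: "f \<in> carrier P" "E f = \<zero>\<^bsub>S\<^esub>"
  shows "\<exists>q \<in> carrier P. \<exists>k::nat. up_ring.coeff P p (deg R p) [^] k \<odot>\<^bsub>P\<^esub> f = p \<otimes>\<^bsub>P\<^esub> q"
proof -
  interpret S: domain S by (rule S)
  interpret E: ring_hom_cring P S E by (rule E)
  obtain q r and k :: nat where q: "q \<in> carrier P" and r: "r \<in> carrier P"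
    and eq: "up_ring.coeff P p (deg R p) [^] k \<odot>\<^bsub>P\<^esub> f = p \<otimes>\<^bsub>P\<^esub> q \<oplus>\<^bsub>P\<^esub> r"
    and dr: "r = \<zero>\<^bsub>P\<^esub> \<or> deg R r < deg R p"
    using long_div_theorem[OF p(1) f(1) p(2)] by blast
  have "E (up_ring.coeff P p (deg R p) [^] k \<odot>\<^bsub>P\<^esub> f) = \<zero>\<^bsub>S\<^esub>"
    using p f by (simp flip: monom_mult_is_smult)
  then have "E r = \<zero>\<^bsub>S\<^esub>" unfolding eq using p q r by simp
  then have "r = \<zero>\<^bsub>P\<^esub>" using dr min[OF r] by fastforce
  then show ?thesis using eq p q by auto
qed

text \<open>In a field with \<open>q\<close> elements every \<open>x\<close> satisfies \<open>x\<^sup>q = x\<close>, so \<open>T\<^sup>q - T + 1\<close> has no root.\<close>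

lemma (in algebraically_closed) infinite_carrier: "infinite (carrier L)"
proof
  assume fin: "finite (carrier L)"
  define q where "q = card (carrier L)"
  have "card {\<zero>, \<one>} \<le> q" unfolding q_def by (rule card_mono[OF fin]) auto
  then have q: "q \<ge> 2" by simp
  interpret U: group "Multiplicative_Group.mult_of L" by (rule field_mult_group)
  have pow: "x [^] q = x" if x: "x \<in> carrier L" for x
  proof (cases "x = \<zero>")
    case True
    then show ?thesis using q by (simp add: nat_pow_zero)
  next
    case False
    then have "x [^]\<^bsub>Multiplicative_Group.mult_of L\<^esub> order (Multiplicative_Group.mult_of L) = \<one>"
      using U.pow_order_eq_1[of x] x by simp
    then have "x [^] (q - 1) = \<one>"
      using order_mult_of[OF fin] by (simp add: Multiplicative_Group.nat_pow_mult_of order_def q_def)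
    then have "x [^] Suc (q - 1) = x" using x by simp
    then show ?thesis using q by (simp del: nat_pow_Suc)
  qed
  define a where "a i = (if i = 0 then \<one> else if i = 1 then \<ominus> \<one> else if i = q then \<one> else \<zero>)" for i
  have val: "(\<Oplus>i\<in>{..q}. a i \<otimes> x [^] i) = \<one>" if x: "x \<in> carrier L" for x
  proof -
    have "(\<Oplus>i\<in>{..q}. a i \<otimes> x [^] i) = (\<Oplus>i\<in>{0, 1, q}. a i \<otimes> x [^] i)"
      using q x by (intro add.finprod_mono_neutral_cong_right) (auto simp: a_def)
    also have "\<dots> = \<one> \<oplus> (\<ominus> x \<oplus> x)"
      using q x pow by (simp add: a_def l_minus)
    also have "\<dots> = \<one>" using x by (simp add: l_neg)
    finally show ?thesis .
  qed
  have "{x \<in> carrier L. (\<Oplus>i\<in>{..q}. a i \<otimes> x [^] i) = \<zero>} \<noteq> {}"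
    using q by (intro finite_nonempty_polynomial_roots(2)) (auto simp: a_def)
  then show False using val by auto
qed

lemma card_of_UNION_finite_ordLess:
  assumes "infinite K" "|D| <o |K|" "\<And>d. d \<in> D \<Longrightarrow> finite (Y d)"
  shows "|\<Union>(Y ` D)| <o |K|"
proof (cases "finite D")
  case True
  then show ?thesis using assms by (intro finite_ordLess_infinite2) auto
next
  case False
  then have "|\<Union>(Y ` D)| \<le>o |D|"
    using assms(3) by (intro card_of_UNION_ordLeq_infinite)
      (auto intro: ordLess_imp_ordLeq finite_ordLess_infinite2)
  then show ?thesis using assms(2) ordLeq_ordLess_trans by blast
qed

lemma ring_hom_factor:
  assumes "ring P" "ring S" "ring T" "h \<in> ring_hom P S" "g \<in> ring_hom P T"
    and ker: "\<And>f. \<lbrakk>f \<in> carrier P; h f = \<zero>\<^bsub>S\<^esub>\<rbrakk> \<Longrightarrow> g f = \<zero>\<^bsub>T\<^esub>"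
  obtains \<psi> where "\<psi> \<in> ring_hom (S\<lparr>carrier := h ` carrier P\<rparr>) T" "\<And>f. f \<in> carrier P \<Longrightarrow> \<psi> (h f) = g f"
proof -
  interpret h: ring_hom_ring P S h using assms by (simp add: ring_hom_ringI2)
  interpret g: ring_hom_ring P T g using assms by (simp add: ring_hom_ringI2)
  have eq: "g f = g f'" if "f \<in> carrier P" "f' \<in> carrier P" "h f = h f'" for f f'
  proof -
    have "h (f \<ominus>\<^bsub>P\<^esub> f') = \<zero>\<^bsub>S\<^esub>" using that by (simp add: h.R.minus_eq h.S.r_neg)
    then have "g f \<ominus>\<^bsub>T\<^esub> g f' = \<zero>\<^bsub>T\<^esub>" using ker[of "f \<ominus>\<^bsub>P\<^esub> f'"] that by (simp add: h.R.minus_eq g.S.minus_eq)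
    then show ?thesis using that by simp
  qed
  define \<psi> where "\<psi> y = g (inv_into (carrier P) h y)" for y
  have \<psi>: "\<psi> (h f) = g f" if "f \<in> carrier P" for f
    unfolding \<psi>_def using that by (intro eq) (auto intro: inv_into_into f_inv_into_f)
  have "\<psi> \<in> ring_hom (S\<lparr>carrier := h ` carrier P\<rparr>) T"
  proof (rule ring_hom_memI)
    show "\<psi> \<one>\<^bsub>S\<lparr>carrier := h ` carrier P\<rparr>\<^esub> = \<one>\<^bsub>T\<^esub>" using \<psi>[of "\<one>\<^bsub>P\<^esub>"] by simp
  qed (auto simp: \<psi> simp flip: h.hom_mult h.hom_add)
  then show ?thesis using \<psi> that by blast
qed

lemma (in ring) subring_finsum_closed:
  assumes "subring H R" "f \<in> A \<rightarrow> H"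
  shows "finsum R f A \<in> H"
  using assms(2)
proof (induction A rule: infinite_finite_induct)
  case (insert a A)
  then show ?case using subringE(1,7)[OF assms(1)] by (subst finsum_insert) (auto simp: Pi_def)
qed (auto simp: subringE(2)[OF assms(1)])

lemma (in ring) subring_nat_pow_closed:
  assumes "subring H R" "x \<in> H"
  shows "x [^] (n::nat) \<in> H"
  using assms by (induction n) (auto simp: subringE)

text \<open>
  The ring \<open>R'\<close> is \<open>R[x]\<close>, and \<open>D\<close> is a set of elements that should not be sent to zero. Since \<open>\<phi>\<close> is not known
  in advance, the obstructions to the extension are collected in \<open>R\<close> independently of it: one element
  \<open>c\<close>, and one element \<open>a b\<close> for every nonzero \<open>b\<close> of \<open>R[x]\<close>.

  If \<open>x\<close> is algebraic over \<open>R\<close>, then \<open>c\<close> is the leading coefficient of a polynomial of least degree with root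
  \<open>x\<close>, so that its image under \<open>\<phi>\<close> is not constant and has a root \<open>\<xi>\<close> in \<open>K\<close>, which becomes the value at \<open>x\<close>; and
  \<open>a b\<close> is a nonzero multiple of \<open>b\<close> in \<open>R[x]\<close> that lies in \<open>R\<close>. If \<open>x\<close> is transcendental, every \<open>\<xi>\<close> is possible, and
  \<open>a b\<close> is the leading coefficient of \<open>b\<close> as a polynomial in \<open>x\<close>; the elements \<open>\<xi>\<close> that send some member of \<open>D\<close> to
  zero are the roots of fewer than \<open>|K|\<close> nonzero polynomials.
\<close>

lemma specialization_step:
  fixes F :: "('f, 'm) ring_scheme" and K :: "('k, 'n) ring_scheme"
  assumes F: "domain F" and K: "algebraically_closed K" and R: "subring R F" and x: "x \<in> carrier F"
  obtains R' c a where "subring R' F" "insert x R \<subseteq> R'"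
    and "\<And>M. \<lbrakk>subring M F; insert x R \<subseteq> M\<rbrakk> \<Longrightarrow> R' \<subseteq> M"
    and "c \<in> R" "c \<noteq> \<zero>\<^bsub>F\<^esub>"
    and "\<And>b. \<lbrakk>b \<in> R'; b \<noteq> \<zero>\<^bsub>F\<^esub>\<rbrakk> \<Longrightarrow> a b \<in> R \<and> a b \<noteq> \<zero>\<^bsub>F\<^esub>"
    and "\<And>\<phi> D. \<lbrakk>\<phi> \<in> ring_hom (F\<lparr>carrier := R\<rparr>) K; \<phi> c \<noteq> \<zero>\<^bsub>K\<^esub>; D \<subseteq> R' - {\<zero>\<^bsub>F\<^esub>}; |D| <o |carrier K|;
            \<And>b. b \<in> D \<Longrightarrow> \<phi> (a b) \<noteq> \<zero>\<^bsub>K\<^esub>\<rbrakk> \<Longrightarrow>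
          \<exists>\<phi>' \<in> ring_hom (F\<lparr>carrier := R'\<rparr>) K. (\<forall>r\<in>R. \<phi>' r = \<phi> r) \<and> (\<forall>b\<in>D. \<phi>' b \<noteq> \<zero>\<^bsub>K\<^esub>)"
proof -
  interpret F: domain F by (rule F)
  interpret K: algebraically_closed K by (rule K)
  define D where "D = F\<lparr>carrier := R\<rparr>"
  have dD: "domain D" unfolding D_def using F.subring_is_domain[OF R] .
  interpret D: domain D by (rule dD)
  have sel[simp]: "carrier D = R" "\<zero>\<^bsub>D\<^esub> = \<zero>\<^bsub>F\<^esub>" "\<one>\<^bsub>D\<^esub> = \<one>\<^bsub>F\<^esub>" by (auto simp: D_def)
  have RF: "R \<subseteq> carrier F" using subringE(1)[OF R] .
  define P where "P = UP D"
  interpret UP_domain D P by unfold_locales (simp add: P_def)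
  have "id \<in> ring_hom D F" using RF by (intro ring_hom_memI) (auto simp: D_def)
  then interpret ev: UP_pre_univ_prop D F id P
    by unfold_locales (auto simp: P_def)
  define E where "E = UnivPoly.eval D F id x"
  have E: "E \<in> ring_hom P F" unfolding E_def by (rule ev.eval_ring_hom[OF x])
  interpret E: ring_hom_cring P F E
    using E by unfold_locales
  have Econst: "E (up_ring.monom P r 0) = r" if "r \<in> R" for r
    using ev.eval_const[OF x] that by (simp add: E_def)
  have EX: "E (up_ring.monom P \<one>\<^bsub>D\<^esub> 1) = x"
    using ev.eval_monom1[OF x] by (simp add: E_def)
  define R' where "R' = E ` carrier P"
  have R'sub: "subring R' F"
    unfolding R'_def by (rule ring_hom_ring.img_is_subring[OF ring_hom_ringI2[OF P.ring_axioms F.ring_axioms E] P.carrier_is_subring])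
  have RR': "r \<in> R'" if "r \<in> R" for r
    unfolding R'_def using Econst[OF that] that by (metis image_eqI monom_closed sel(1))
  have xR': "x \<in> R'"
    unfolding R'_def using EX by (metis image_eqI monom_closed D.one_closed)
  have least: "R' \<subseteq> M" if M: "subring M F" "insert x R \<subseteq> M" for M
  proof -
    have "E f \<in> M" if f: "f \<in> carrier P" for f
      unfolding E_def eval_on_carrier[OF f]
    proof (rule F.subring_finsum_closed[OF M(1)], rule)
      fix i
      have "up_ring.coeff P f i \<in> M" using coeff_closed[OF f, of i] M by auto
      then show "id (up_ring.coeff P f i) \<otimes>\<^bsub>F\<^esub> x [^]\<^bsub>F\<^esub> i \<in> M"
        using M F.subring_nat_pow_closed[OF M(1)] subringE(6)[OF M(1)] by simp
    qed
    then show ?thesis unfolding R'_def by auto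
  qed
  have extend: "\<exists>\<phi>' \<in> ring_hom (F\<lparr>carrier := R'\<rparr>) K. (\<forall>r\<in>R. \<phi>' r = \<phi> r) \<and> (\<forall>f\<in>carrier P. \<phi>' (E f) = UnivPoly.eval D K \<phi> \<xi> f)"
    if \<phi>: "\<phi> \<in> ring_hom D K" and \<xi>: "\<xi> \<in> carrier K"
      and ker: "\<And>f. \<lbrakk>f \<in> carrier P; E f = \<zero>\<^bsub>F\<^esub>\<rbrakk> \<Longrightarrow> UnivPoly.eval D K \<phi> \<xi> f = \<zero>\<^bsub>K\<^esub>" for \<phi> \<xi>
  proof -
    interpret e: UP_pre_univ_prop D K \<phi> P
      using \<phi> by unfold_locales (auto simp: P_def)
    have hom: "UnivPoly.eval D K \<phi> \<xi> \<in> ring_hom P K" by (rule e.eval_ring_hom[OF \<xi>])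
    obtain \<psi> where \<psi>: "\<psi> \<in> ring_hom (F\<lparr>carrier := E ` carrier P\<rparr>) K"
      "\<And>f. f \<in> carrier P \<Longrightarrow> \<psi> (E f) = UnivPoly.eval D K \<phi> \<xi> f"
      by (rule ring_hom_factor[OF P.ring_axioms F.ring_axioms K.ring_axioms E hom ker]) blast+
    have "\<psi> r = \<phi> r" if "r \<in> R" for r
      using \<psi>(2)[of "up_ring.monom P r 0"] Econst[OF that] e.eval_const[OF \<xi>, of r] that by simp
    then show ?thesis using \<psi> unfolding R'_def by blast
  qed
  have fin_roots: "finite {\<xi> \<in> carrier K. UnivPoly.eval D K \<phi> \<xi> f = \<zero>\<^bsub>K\<^esub>}"
      "deg D f > 0 \<Longrightarrow> {\<xi> \<in> carrier K. UnivPoly.eval D K \<phi> \<xi> f = \<zero>\<^bsub>K\<^esub>} \<noteq> {}"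
    if \<phi>: "\<phi> \<in> ring_hom D K" and f: "f \<in> carrier P" and lead: "\<phi> (up_ring.coeff P f (deg D f)) \<noteq> \<zero>\<^bsub>K\<^esub>" for \<phi> f
    using K.finite_nonempty_polynomial_roots[of "\<lambda>i. \<phi> (up_ring.coeff P f i)" "deg D f"] lead
      ring_hom_closed[OF \<phi> coeff_closed[OF f]]
    unfolding eval_on_carrier[OF f] by auto
  show thesis
  proof (cases "\<exists>p \<in> carrier P. p \<noteq> \<zero>\<^bsub>P\<^esub> \<and> E p = \<zero>\<^bsub>F\<^esub>")
    case True
    then obtain p0 where p0: "p0 \<in> carrier P \<and> p0 \<noteq> \<zero>\<^bsub>P\<^esub> \<and> E p0 = \<zero>\<^bsub>F\<^esub>" by blast
    obtain p where p': "p \<in> carrier P \<and> p \<noteq> \<zero>\<^bsub>P\<^esub> \<and> E p = \<zero>\<^bsub>F\<^esub>"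
      and min': "\<forall>q. q \<in> carrier P \<and> q \<noteq> \<zero>\<^bsub>P\<^esub> \<and> E q = \<zero>\<^bsub>F\<^esub> \<longrightarrow> deg D p \<le> deg D q"
      using ex_has_least_nat[of "\<lambda>p. p \<in> carrier P \<and> p \<noteq> \<zero>\<^bsub>P\<^esub> \<and> E p = \<zero>\<^bsub>F\<^esub>" p0 "deg D", OF p0]
      by (elim exE conjE) (rule that, simp_all)
    have p: "p \<in> carrier P" "p \<noteq> \<zero>\<^bsub>P\<^esub>" "E p = \<zero>\<^bsub>F\<^esub>" using p' by simp_all
    have min: "deg D p \<le> deg D q" if "q \<in> carrier P" "q \<noteq> \<zero>\<^bsub>P\<^esub>" "E q = \<zero>\<^bsub>F\<^esub>" for q
      using min' that by simp
    define c where "c = up_ring.coeff P p (deg D p)"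
    have c: "c \<in> R" "c \<noteq> \<zero>\<^bsub>F\<^esub>" using coeff_closed[OF p(1)] lcoeff_nonzero2[OF p(1,2)] by (auto simp: c_def)
    have degp: "deg D p > 0"
    proof (rule ccontr)
      assume "\<not> deg D p > 0"
      then have eq: "p = up_ring.monom P (up_ring.coeff P p 0) 0" using deg_zero_impl_monom[OF p(1)] by simp
      then have "E p = up_ring.coeff P p 0" using Econst coeff_closed[OF p(1)] by (metis sel(1))
      then show False using p(2,3) eq by (metis monom_zero sel(2))
    qed
    have "\<exists>v \<in> carrier P. \<exists>a \<in> carrier D. a \<noteq> \<zero>\<^bsub>D\<^esub> \<and> E f \<otimes>\<^bsub>F\<^esub> E v = E (up_ring.monom P a 0)"
      if "f \<in> carrier P" "E f \<noteq> \<zero>\<^bsub>F\<^esub>" for f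
      by (rule image_divides_constant[OF E.ring_hom_cring_axioms F _ p min that]) (simp add: Econst)
    then have ex: "\<exists>v \<in> R'. \<exists>a \<in> R. a \<noteq> \<zero>\<^bsub>F\<^esub> \<and> b \<otimes>\<^bsub>F\<^esub> v = a" if "b \<in> R'" "b \<noteq> \<zero>\<^bsub>F\<^esub>" for b
      using that unfolding R'_def by (smt (verit) Econst image_iff sel(1,2))
    define v where "v b = (SOME v. v \<in> R' \<and> b \<otimes>\<^bsub>F\<^esub> v \<in> R \<and> b \<otimes>\<^bsub>F\<^esub> v \<noteq> \<zero>\<^bsub>F\<^esub>)" for b
    define a where "a b = b \<otimes>\<^bsub>F\<^esub> v b" for b
    have av: "v b \<in> R' \<and> a b \<in> R \<and> a b \<noteq> \<zero>\<^bsub>F\<^esub> \<and> b \<otimes>\<^bsub>F\<^esub> v b = a b"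
      if "b \<in> R'" "b \<noteq> \<zero>\<^bsub>F\<^esub>" for b
      using someI_ex[of "\<lambda>v. v \<in> R' \<and> b \<otimes>\<^bsub>F\<^esub> v \<in> R \<and> b \<otimes>\<^bsub>F\<^esub> v \<noteq> \<zero>\<^bsub>F\<^esub>"] ex[OF that]
      unfolding a_def v_def by blast
    show thesis
    proof (rule that[OF R'sub _ least c])
      show "insert x R \<subseteq> R'" using RR' xR' by auto
      show "a b \<in> R \<and> a b \<noteq> \<zero>\<^bsub>F\<^esub>" if "b \<in> R'" "b \<noteq> \<zero>\<^bsub>F\<^esub>" for b using av that by blast
      fix \<phi> B
      assume "\<phi> \<in> ring_hom (F\<lparr>carrier := R\<rparr>) K" and \<phi>c: "\<phi> c \<noteq> \<zero>\<^bsub>K\<^esub>" and B: "B \<subseteq> R' - {\<zero>\<^bsub>F\<^esub>}"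
        and aB: "\<And>b. b \<in> B \<Longrightarrow> \<phi> (a b) \<noteq> \<zero>\<^bsub>K\<^esub>"
      then have \<phi>: "\<phi> \<in> ring_hom D K" by (simp add: D_def)
      obtain \<xi> where \<xi>: "\<xi> \<in> carrier K" "UnivPoly.eval D K \<phi> \<xi> p = \<zero>\<^bsub>K\<^esub>"
        using fin_roots(2)[OF \<phi> p(1) _ degp] \<phi>c unfolding c_def by blast
      interpret e: UP_pre_univ_prop D K \<phi> P
        using \<phi> by unfold_locales (auto simp: P_def)
      have hom: "UnivPoly.eval D K \<phi> \<xi> \<in> ring_hom P K" by (rule e.eval_ring_hom[OF \<xi>(1)])
      interpret e': ring_hom_cring P K "UnivPoly.eval D K \<phi> \<xi>" using hom by unfold_locales
      have ker: "UnivPoly.eval D K \<phi> \<xi> f = \<zero>\<^bsub>K\<^esub>" if f: "f \<in> carrier P" "E f = \<zero>\<^bsub>F\<^esub>" for f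
      proof -
        obtain q and k :: nat where q: "q \<in> carrier P" and eq: "c [^]\<^bsub>D\<^esub> k \<odot>\<^bsub>P\<^esub> f = p \<otimes>\<^bsub>P\<^esub> q"
          using kernel_multiple[OF E.ring_hom_cring_axioms F p min f] unfolding c_def by blast
        have ck: "c [^]\<^bsub>D\<^esub> k \<in> R" using D.nat_pow_closed[of c k] c by simp
        have "UnivPoly.eval D K \<phi> \<xi> (c [^]\<^bsub>D\<^esub> k \<odot>\<^bsub>P\<^esub> f) = \<phi> (c [^]\<^bsub>D\<^esub> k) \<otimes>\<^bsub>K\<^esub> UnivPoly.eval D K \<phi> \<xi> f"
          using ck f e.eval_const[OF \<xi>(1)] by (simp flip: monom_mult_is_smult)
        then have "\<phi> (c [^]\<^bsub>D\<^esub> k) \<otimes>\<^bsub>K\<^esub> UnivPoly.eval D K \<phi> \<xi> f = \<zero>\<^bsub>K\<^esub>"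
          unfolding eq using p q \<xi>(2) by simp
        moreover have "\<phi> (c [^]\<^bsub>D\<^esub> k) = \<phi> c [^]\<^bsub>K\<^esub> k" using c by simp
        ultimately show ?thesis
          using K.nat_pow_nonzero[OF _ \<phi>c] c f by (simp add: K.integral_iff)
      qed
      obtain \<phi>' where \<phi>': "\<phi>' \<in> ring_hom (F\<lparr>carrier := R'\<rparr>) K" "\<forall>r\<in>R. \<phi>' r = \<phi> r"
        using extend[OF \<phi> \<xi>(1) ker] by blast
      have "\<phi>' b \<noteq> \<zero>\<^bsub>K\<^esub>" if b: "b \<in> B" for b
      proof
        assume 0: "\<phi>' b = \<zero>\<^bsub>K\<^esub>"
        have vb: "v b \<in> R'" "a b \<in> R" "b \<otimes>\<^bsub>F\<^esub> v b = a b" "b \<in> R'" using av b B by auto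
        have "\<phi>' (a b) = \<phi>' b \<otimes>\<^bsub>K\<^esub> \<phi>' (v b)"
          using ring_hom_mult[OF \<phi>'(1), of b "v b"] vb by simp
        moreover have "\<phi>' (v b) \<in> carrier K" using ring_hom_closed[OF \<phi>'(1)] vb by simp
        ultimately show False using 0 \<phi>'(2) vb aB[OF b] by simp
      qed
      then show "\<exists>\<phi>' \<in> ring_hom (F\<lparr>carrier := R'\<rparr>) K. (\<forall>r\<in>R. \<phi>' r = \<phi> r) \<and> (\<forall>b\<in>B. \<phi>' b \<noteq> \<zero>\<^bsub>K\<^esub>)"
        using \<phi>' by blast
    qed
  next
    case False
    define g where "g = inv_into (carrier P) E"
    have g: "g b \<in> carrier P" "E (g b) = b" if "b \<in> R'" for b
      using that inv_into_into[of b E "carrier P"] f_inv_into_f[of b E "carrier P"] unfolding g_def R'_def by simp_all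
    define a where "a b = up_ring.coeff P (g b) (deg D (g b))" for b
    have a: "a b \<in> R \<and> a b \<noteq> \<zero>\<^bsub>F\<^esub>" if b: "b \<in> R'" "b \<noteq> \<zero>\<^bsub>F\<^esub>" for b
    proof -
      have "g b \<noteq> \<zero>\<^bsub>P\<^esub>" using g[OF b(1)] b(2) by auto
      then show ?thesis using lcoeff_nonzero2[OF g(1)[OF b(1)]] coeff_closed[OF g(1)[OF b(1)]] by (simp add: a_def)
    qed
    show thesis
    proof (rule that[OF R'sub _ least])
      show "insert x R \<subseteq> R'" using RR' xR' by auto
      show "\<one>\<^bsub>F\<^esub> \<in> R" using subringE(3)[OF R] .
      show "\<one>\<^bsub>F\<^esub> \<noteq> \<zero>\<^bsub>F\<^esub>" by simp
      show "a b \<in> R \<and> a b \<noteq> \<zero>\<^bsub>F\<^esub>" if "b \<in> R'" "b \<noteq> \<zero>\<^bsub>F\<^esub>" for b using a that by blast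
      fix \<phi> B
      assume "\<phi> \<in> ring_hom (F\<lparr>carrier := R\<rparr>) K" and B: "B \<subseteq> R' - {\<zero>\<^bsub>F\<^esub>}" "|B| <o |carrier K|"
        and aB: "\<And>b. b \<in> B \<Longrightarrow> \<phi> (a b) \<noteq> \<zero>\<^bsub>K\<^esub>"
      then have \<phi>: "\<phi> \<in> ring_hom D K" by (simp add: D_def)
      define bad where "bad = (\<Union>b\<in>B. {\<xi> \<in> carrier K. UnivPoly.eval D K \<phi> \<xi> (g b) = \<zero>\<^bsub>K\<^esub>})"
      have "|bad| <o |carrier K|" unfolding bad_def
      proof (rule card_of_UNION_finite_ordLess[OF K.infinite_carrier B(2)])
        fix b assume b: "b \<in> B"
        then have "b \<in> R'" using B by auto
        then show "finite {\<xi> \<in> carrier K. UnivPoly.eval D K \<phi> \<xi> (g b) = \<zero>\<^bsub>K\<^esub>}"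
          using fin_roots(1)[OF \<phi> g(1)] aB[OF b] unfolding a_def by blast
      qed
      then have "\<not> carrier K \<subseteq> bad" using card_of_mono1 not_ordLess_ordLeq by blast
      then obtain \<xi> where \<xi>: "\<xi> \<in> carrier K" "\<xi> \<notin> bad" by blast
      interpret e: UP_pre_univ_prop D K \<phi> P
        using \<phi> by unfold_locales (auto simp: P_def)
      have hom: "UnivPoly.eval D K \<phi> \<xi> \<in> ring_hom P K" by (rule e.eval_ring_hom[OF \<xi>(1)])
      interpret e': ring_hom_cring P K "UnivPoly.eval D K \<phi> \<xi>" using hom by unfold_locales
      have ker: "UnivPoly.eval D K \<phi> \<xi> f = \<zero>\<^bsub>K\<^esub>" if "f \<in> carrier P" "E f = \<zero>\<^bsub>F\<^esub>" for f
        using False that by (metis e'.hom_zero)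
      obtain \<phi>' where \<phi>': "\<phi>' \<in> ring_hom (F\<lparr>carrier := R'\<rparr>) K" "\<forall>r\<in>R. \<phi>' r = \<phi> r"
          "\<forall>f\<in>carrier P. \<phi>' (E f) = UnivPoly.eval D K \<phi> \<xi> f"
        using extend[OF \<phi> \<xi>(1) ker] by blast
      have "\<phi>' b \<noteq> \<zero>\<^bsub>K\<^esub>" if b: "b \<in> B" for b
      proof -
        have bR: "b \<in> R'" using b B by auto
        have "\<phi>' b = UnivPoly.eval D K \<phi> \<xi> (g b)" using \<phi>'(3) g[OF bR] by metis
        then show ?thesis using \<xi> b unfolding bad_def by auto
      qed
      then show "\<exists>\<phi>' \<in> ring_hom (F\<lparr>carrier := R'\<rparr>) K. (\<forall>r\<in>R. \<phi>' r = \<phi> r) \<and> (\<forall>b\<in>B. \<phi>' b \<noteq> \<zero>\<^bsub>K\<^esub>)"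
        using \<phi>' by blast
    qed
  qed
qed

section \<open>Specializing few elements of a field into an algebraically closed field\<close>

text \<open>
  The generated ring is reached by closing the set of generators countably often under the ring
  operations, and none of these steps increases an infinite cardinal bound.
\<close>

lemma (in ring) card_of_generate_ring:
  assumes X: "|A| \<le>o |B|" and B: "infinite B"
  shows "|generate_ring R A| \<le>o |B|"
proof -
  define step where "step S = S \<union> {\<one>} \<union> (\<lambda>x. \<ominus> x) ` S \<union> (\<lambda>(x, y). x \<otimes> y) ` (S \<times> S) \<union> (\<lambda>(x, y). x \<oplus> y) ` (S \<times> S)" for S
  define L where "L n = (step ^^ n) A" for n
  have B': "S \<subseteq> T \<Longrightarrow> |T| \<le>o |B| \<Longrightarrow> |S| \<le>o |B|" for S T :: "'a set"
    using card_of_mono1 ordLeq_transitive by blast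
  have img1: "|f ` S| \<le>o |B|" if "|S| \<le>o |B|" for f :: "'a \<Rightarrow> 'a" and S
    using card_of_image that ordLeq_transitive by blast
  have img2: "|f ` S| \<le>o |B|" if "|S| \<le>o |B|" for f :: "'a \<times> 'a \<Rightarrow> 'a" and S
    using card_of_image that ordLeq_transitive by blast
  have Un: "|S \<union> T| \<le>o |B|" if "|S| \<le>o |B|" "|T| \<le>o |B|" for S T :: "'a set"
    using card_of_Un_ordLeq_infinite_Field[of "|B|" S T] that B by (simp add: Field_card_of)
  have Times: "|S \<times> S| \<le>o |B|" if "|S| \<le>o |B|" for S :: "'a set"
    using card_of_Times_ordLeq_infinite_Field[of "|B|" S S] that B by (simp add: Field_card_of)
  have one: "|{\<one>}| \<le>o |B|" using B by (simp add: ordLess_imp_ordLeq finite_ordLess_infinite2)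
  have "|L n| \<le>o |B|" for n
  proof (induction n)
    case 0
    then show ?case using X by (simp add: L_def)
  next
    case (Suc n)
    have "L (Suc n) = step (L n)" by (simp add: L_def)
    then show ?case unfolding step_def using Suc by (simp only:) (intro Un img1 img2 Times one Suc)
  qed
  then have "|\<Union>(range L)| \<le>o |B|"
    using B by (intro card_of_UNION_ordLeq_infinite) (auto simp: infinite_iff_card_of_nat)
  moreover have mono: "L m \<subseteq> L n" if "m \<le> n" for m n
    using that by (induction rule: dec_induct) (auto simp: L_def step_def)
  have "generate_ring R A \<subseteq> \<Union>(range L)"
  proof
    fix x assume "x \<in> generate_ring R A"
    then show "x \<in> \<Union>(range L)"
    proof (induction rule: generate_ring.induct)
      case one
      have "\<one> \<in> L (Suc 0)" by (simp add: L_def step_def)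
      then show ?case by blast
    next
      case (incl h)
      then have "h \<in> L 0" by (simp add: L_def)
      then show ?case by blast
    next
      case (a_inv h)
      then obtain n where "h \<in> L n" by blast
      then have "\<ominus> h \<in> L (Suc n)" by (simp add: L_def step_def)
      then show ?case by blast
    next
      case (eng_add h1 h2)
      then obtain m n where "h1 \<in> L m" "h2 \<in> L n" by blast
      then have "h1 \<in> L (max m n)" "h2 \<in> L (max m n)" using mono[of m "max m n"] mono[of n "max m n"] by auto
      then have "h1 \<oplus> h2 \<in> L (Suc (max m n))" by (auto simp: L_def step_def)
      then show ?case by blast
    next
      case (eng_mult h1 h2)
      then obtain m n where "h1 \<in> L m" "h2 \<in> L n" by blast
      then have "h1 \<in> L (max m n)" "h2 \<in> L (max m n)" using mono[of m "max m n"] mono[of n "max m n"] by auto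
      then have "h1 \<otimes> h2 \<in> L (Suc (max m n))" by (auto simp: L_def step_def)
      then show ?case by blast
    qed
  qed
  ultimately show ?thesis using B' card_of_mono1 ordLeq_transitive by blast
qed

locale field_embedding = F: field F + K: algebraically_closed K
  for F :: "('f, 'm) ring_scheme" and K :: "('k, 'n) ring_scheme" +
  fixes \<iota> :: "'k \<Rightarrow> 'f"
  assumes \<iota>: "\<iota> \<in> ring_hom K F"
begin

lemma inj_\<iota>: "inj_on \<iota> (carrier K)"
proof -
  show ?thesis using non_trivial_field_hom_is_inj[OF \<iota> K.field_axioms F.field_axioms] .
qed

lemma subring_image: "subring (\<iota> ` carrier K) F"
  using ring_hom_ring.img_is_subring[OF ring_hom_ringI2[OF K.ring_axioms F.ring_axioms \<iota>] K.carrier_is_subring] .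

definition retraction :: "'f \<Rightarrow> 'k" where "retraction = inv_into (carrier K) \<iota>"

lemma retraction_\<iota>: "k \<in> carrier K \<Longrightarrow> retraction (\<iota> k) = k"
  unfolding retraction_def using inj_\<iota> by simp

lemma retraction_hom: "R \<subseteq> \<iota> ` carrier K \<Longrightarrow> retraction \<in> ring_hom (F\<lparr>carrier := R\<rparr>) K"
proof (rule ring_hom_memI)
  assume R: "R \<subseteq> \<iota> ` carrier K"
  interpret h: ring_hom_ring K F \<iota> using \<iota> by (simp add: ring_hom_ringI2 K.ring_axioms F.ring_axioms)
  fix x assume x: "x \<in> carrier (F\<lparr>carrier := R\<rparr>)"
  then obtain k where k: "x = \<iota> k" "k \<in> carrier K" using R by auto
  then show "retraction x \<in> carrier K" by (simp add: retraction_\<iota>)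
  fix y assume "y \<in> carrier (F\<lparr>carrier := R\<rparr>)"
  then obtain l where l: "y = \<iota> l" "l \<in> carrier K" using R by auto
  show "retraction (x \<otimes>\<^bsub>F\<lparr>carrier := R\<rparr>\<^esub> y) = retraction x \<otimes>\<^bsub>K\<^esub> retraction y"
    unfolding k l using k l retraction_\<iota>[of "k \<otimes>\<^bsub>K\<^esub> l"] by (simp add: retraction_\<iota>)
  show "retraction (x \<oplus>\<^bsub>F\<lparr>carrier := R\<rparr>\<^esub> y) = retraction x \<oplus>\<^bsub>K\<^esub> retraction y"
    unfolding k l using k l retraction_\<iota>[of "k \<oplus>\<^bsub>K\<^esub> l"] by (simp add: retraction_\<iota>)
next
  interpret h: ring_hom_ring K F \<iota> using \<iota> by (simp add: ring_hom_ringI2 K.ring_axioms F.ring_axioms)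
  show "retraction \<one>\<^bsub>F\<lparr>carrier := R\<rparr>\<^esub> = \<one>\<^bsub>K\<^esub>" using retraction_\<iota>[of "\<one>\<^bsub>K\<^esub>"] by simp
qed

text \<open>
  One cannot ask for \<open>\<phi> b \<noteq> \<zero>\<close> for all \<open>b\<close> at once, as \<open>K\<close> may be the algebraic closure of a prime field. Asking for
  it for one \<open>b\<close> at a time, with \<open>\<phi>\<close> depending on \<open>b\<close>, is what makes the induction work: the two
  obstructions \<open>c\<close> and \<open>a b\<close> of \<open>specialization_step\<close> are nonzero, and so is their product.
\<close>

lemma finite_specialization:
  assumes "finite S" "S \<subseteq> carrier F"
  shows "\<exists>R. subring R F \<and> \<iota> ` carrier K \<union> S \<subseteq> R \<and>
    (\<forall>b \<in> R - {\<zero>\<^bsub>F\<^esub>}. \<exists>\<phi> \<in> ring_hom (F\<lparr>carrier := R\<rparr>) K. (\<forall>k \<in> carrier K. \<phi> (\<iota> k) = k) \<and> \<phi> b \<noteq> \<zero>\<^bsub>K\<^esub>)"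
  using assms
proof (induction S rule: finite_induct)
  case empty
  have "\<exists>\<phi> \<in> ring_hom (F\<lparr>carrier := \<iota> ` carrier K\<rparr>) K. (\<forall>k \<in> carrier K. \<phi> (\<iota> k) = k) \<and> \<phi> b \<noteq> \<zero>\<^bsub>K\<^esub>"
    if b: "b \<in> \<iota> ` carrier K - {\<zero>\<^bsub>F\<^esub>}" for b
  proof (intro bexI[of _ retraction] conjI ballI)
    obtain k where k: "b = \<iota> k" "k \<in> carrier K" using b by auto
    have "\<iota> \<zero>\<^bsub>K\<^esub> = \<zero>\<^bsub>F\<^esub>" using ring_hom_zero[OF \<iota> K.ring_axioms F.ring_axioms] .
    then show "retraction b \<noteq> \<zero>\<^bsub>K\<^esub>" using k b retraction_\<iota>[OF k(2)] by auto
  qed (auto simp: retraction_\<iota> retraction_hom)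
  then show ?case using subring_image by (intro exI[of _ "\<iota> ` carrier K"]) auto
next
  case (insert x S)
  then obtain R where R: "subring R F" "\<iota> ` carrier K \<union> S \<subseteq> R"
    and \<phi>R: "\<And>b. \<lbrakk>b \<in> R; b \<noteq> \<zero>\<^bsub>F\<^esub>\<rbrakk> \<Longrightarrow> \<exists>\<phi> \<in> ring_hom (F\<lparr>carrier := R\<rparr>) K. (\<forall>k \<in> carrier K. \<phi> (\<iota> k) = k) \<and> \<phi> b \<noteq> \<zero>\<^bsub>K\<^esub>"
    by auto
  have x: "x \<in> carrier F" using insert by auto
  show ?case
  proof (rule specialization_step[OF F.domain_axioms K.algebraically_closed_axioms R(1) x])
    fix R' c a
    assume R': "subring R' F" "insert x R \<subseteq> R'" and c: "c \<in> R" "c \<noteq> \<zero>\<^bsub>F\<^esub>"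
      and a: "\<And>b. \<lbrakk>b \<in> R'; b \<noteq> \<zero>\<^bsub>F\<^esub>\<rbrakk> \<Longrightarrow> a b \<in> R \<and> a b \<noteq> \<zero>\<^bsub>F\<^esub>"
      and ext: "\<And>\<phi> D. \<lbrakk>\<phi> \<in> ring_hom (F\<lparr>carrier := R\<rparr>) K; \<phi> c \<noteq> \<zero>\<^bsub>K\<^esub>; D \<subseteq> R' - {\<zero>\<^bsub>F\<^esub>}; |D| <o |carrier K|;
            \<And>b. b \<in> D \<Longrightarrow> \<phi> (a b) \<noteq> \<zero>\<^bsub>K\<^esub>\<rbrakk> \<Longrightarrow>
          \<exists>\<phi>' \<in> ring_hom (F\<lparr>carrier := R'\<rparr>) K. (\<forall>r\<in>R. \<phi>' r = \<phi> r) \<and> (\<forall>b\<in>D. \<phi>' b \<noteq> \<zero>\<^bsub>K\<^esub>)"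
    have "\<exists>\<phi> \<in> ring_hom (F\<lparr>carrier := R'\<rparr>) K. (\<forall>k \<in> carrier K. \<phi> (\<iota> k) = k) \<and> \<phi> b \<noteq> \<zero>\<^bsub>K\<^esub>"
      if b: "b \<in> R'" "b \<noteq> \<zero>\<^bsub>F\<^esub>" for b
    proof -
      have RF: "R \<subseteq> carrier F" using subringE(1)[OF R(1)] .
      have ab: "a b \<in> R" "a b \<noteq> \<zero>\<^bsub>F\<^esub>" using a[OF b] by auto
      then have "c \<otimes>\<^bsub>F\<^esub> a b \<in> R" "c \<otimes>\<^bsub>F\<^esub> a b \<noteq> \<zero>\<^bsub>F\<^esub>"
        using c RF subringE(6)[OF R(1)] by (auto simp: F.integral_iff subset_iff)
      then obtain \<phi> where \<phi>: "\<phi> \<in> ring_hom (F\<lparr>carrier := R\<rparr>) K" "\<forall>k \<in> carrier K. \<phi> (\<iota> k) = k"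
        and nz: "\<phi> (c \<otimes>\<^bsub>F\<^esub> a b) \<noteq> \<zero>\<^bsub>K\<^esub>" using \<phi>R by blast
      have cl: "\<phi> c \<in> carrier K" "\<phi> (a b) \<in> carrier K" using ring_hom_closed[OF \<phi>(1)] c ab by auto
      have "\<phi> (c \<otimes>\<^bsub>F\<^esub> a b) = \<phi> c \<otimes>\<^bsub>K\<^esub> \<phi> (a b)" using ring_hom_mult[OF \<phi>(1), of c "a b"] c ab by simp
      then have "\<phi> c \<noteq> \<zero>\<^bsub>K\<^esub>" "\<phi> (a b) \<noteq> \<zero>\<^bsub>K\<^esub>" using nz cl by auto
      then obtain \<phi>' where "\<phi>' \<in> ring_hom (F\<lparr>carrier := R'\<rparr>) K" "\<forall>r\<in>R. \<phi>' r = \<phi> r" "\<phi>' b \<noteq> \<zero>\<^bsub>K\<^esub>"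
        using ext[OF \<phi>(1), of "{b}"] b K.infinite_carrier by (auto simp: finite_ordLess_infinite2)
      then show ?thesis using \<phi>(2) R(2) by (intro bexI[of _ \<phi>']) auto
    qed
    then show ?case using R' R(2) by (intro exI[of _ R']) auto
  qed
qed

definition partial_embedding :: "'f set \<Rightarrow> ('f \<Rightarrow> 'k) \<Rightarrow> bool" where
  "partial_embedding R \<phi> \<longleftrightarrow> subring R F \<and> \<phi> \<in> ring_hom (F\<lparr>carrier := R\<rparr>) K \<and> inj_on \<phi> R"

text \<open>
  Here all nonzero elements are kept away from zero. Zorn's lemma is applied to the graphs of injective
  partial homomorphisms from \<open>M\<close> to \<open>K\<close> that extend the inverse of \<open>\<iota>\<close> on \<open>R0\<close>. A maximal one is defined on \<open>M\<close>, because
  \<open>specialization_step\<close> extends it injectively by any further element: an obstruction that is nonzero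
  is not sent to zero by an injective \<open>\<phi>\<close>, and \<open>D\<close> is smaller than \<open>K\<close> as a subset of \<open>M\<close>.
\<close>

lemma small_embedding:
  assumes unc: "|UNIV :: nat set| <o |carrier K|"
    and C: "C \<subseteq> carrier K" "|C| <o |carrier K|"
    and S: "S \<subseteq> carrier F" "|S| <o |carrier K|"
  shows "\<exists>R \<phi>. subring R F \<and> \<iota> ` C \<union> S \<subseteq> R \<and> \<phi> \<in> ring_hom (F\<lparr>carrier := R\<rparr>) K \<and> (\<forall>c \<in> C. \<phi> (\<iota> c) = c)"
proof -
  define M where "M = generate_ring F (\<iota> ` C \<union> S)"
  have \<iota>C: "\<iota> ` C \<subseteq> carrier F" using C \<iota> by (auto dest: ring_hom_closed)
  have gen: "\<iota> ` C \<union> S \<subseteq> carrier F" using \<iota>C S by auto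
  have M: "subring M F" unfolding M_def by (rule F.generate_ring_is_subring[OF gen])
  have incl: "\<iota> ` C \<union> S \<subseteq> M" unfolding M_def by (auto intro: generate_ring.incl)
  have Mcard: "|M| <o |carrier K|"
  proof -
    let ?B = "(UNIV :: nat set) <+> (\<iota> ` C \<union> S)"
    have "|\<iota> ` C| \<le>o |C|" by (rule card_of_image)
    then have "|\<iota> ` C| <o |carrier K|" using C(2) ordLeq_ordLess_trans by blast
    then have "|\<iota> ` C \<union> S| <o |carrier K|"
      using card_of_Un_ordLess_infinite[OF K.infinite_carrier] S(2) by blast
    then have B: "|?B| <o |carrier K|"
      using card_of_Plus_ordLess_infinite[OF K.infinite_carrier unc] by blast
    have "|M| \<le>o |?B|" unfolding M_def
      by (rule F.card_of_generate_ring[OF card_of_Plus2]) simp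
    then show ?thesis using B ordLeq_ordLess_trans by blast
  qed
  have small: "|D| <o |carrier K|" if "D \<subseteq> M" for D
    using card_of_mono1[OF that] Mcard ordLeq_ordLess_trans by blast
  define R0 where "R0 = \<iota> ` carrier K \<inter> M"
  have R0: "subring R0 F" unfolding R0_def by (rule F.subring_inter[OF subring_image M])
  define graphs where "graphs = {G. \<exists>R \<phi>. G = (\<lambda>r. (r, \<phi> r)) ` R \<and> partial_embedding R \<phi> \<and> R \<subseteq> M \<and>
      R0 \<subseteq> R \<and> (\<forall>r \<in> R0. \<phi> r = retraction r)}"
  have "(\<lambda>r. (r, retraction r)) ` R0 \<in> graphs"
    unfolding graphs_def partial_embedding_def
    using R0 retraction_hom[of R0] inj_on_inv_into[of R0 \<iota> "carrier K"] unfolding retraction_def R0_def by blast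
  then have ne: "graphs \<noteq> {}" by blast
  have "\<exists>Gm \<in> graphs. \<forall>G \<in> graphs. Gm \<subseteq> G \<longrightarrow> G = Gm"
  proof (rule subset_Zorn_nonempty[OF ne])
    fix \<C> assume \<C>: "\<C> \<noteq> {}" "subset.chain graphs \<C>"
    define R where "R = fst ` \<Union>\<C>"
    define \<phi> where "\<phi> r = (THE k. (r, k) \<in> \<Union>\<C>)" for r
    have piece: "\<exists>R \<phi>. G = (\<lambda>r. (r, \<phi> r)) ` R \<and> partial_embedding R \<phi> \<and> R \<subseteq> M \<and> R0 \<subseteq> R \<and> (\<forall>r \<in> R0. \<phi> r = retraction r)"
      if "G \<in> \<C>" for G using that \<C>(2) unfolding subset_chain_def graphs_def by blast
    have two: "\<exists>G \<in> \<C>. p \<in> G \<and> q \<in> G" if "p \<in> \<Union>\<C>" "q \<in> \<Union>\<C>" for p q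
      using that \<C>(2) unfolding subset_chain_def by (meson UnionE subsetD)
    have sv: "k = l" if rk: "(r, k) \<in> \<Union>\<C>" "(r, l) \<in> \<Union>\<C>" for r k l
    proof -
      obtain G where "G \<in> \<C>" "(r, k) \<in> G" "(r, l) \<in> G" using two[OF rk] by blast
      then show ?thesis using piece[of G] by auto
    qed
    have \<phi>: "\<phi> r = k" if "(r, k) \<in> \<Union>\<C>" for r k
      unfolding \<phi>_def using sv that by (intro the_equality) blast+
    have G_eq: "\<Union>\<C> = (\<lambda>r. (r, \<phi> r)) ` R"
      unfolding R_def using \<phi> by (auto simp: image_iff) (metis fst_conv)+
    \<comment> \<open>any two elements of \<open>R\<close> lie in the domain of one member of the chain, so \<open>\<phi>\<close> inherits its properties\<close>
    have piece_at: "\<exists>T. partial_embedding T \<phi> \<and> T \<subseteq> R \<and> T \<subseteq> M \<and> R0 \<subseteq> T \<and> (\<forall>r\<in>R0. \<phi> r = retraction r) \<and> x \<in> T \<and> y \<in> T"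
      if xy: "x \<in> R" "y \<in> R" for x y
    proof -
      have "(x, \<phi> x) \<in> \<Union>\<C>" "(y, \<phi> y) \<in> \<Union>\<C>" using xy G_eq by auto
      then obtain G where G: "G \<in> \<C>" "(x, \<phi> x) \<in> G" "(y, \<phi> y) \<in> G" using two by blast
      obtain T \<psi> where T: "G = (\<lambda>r. (r, \<psi> r)) ` T" "partial_embedding T \<psi>" "T \<subseteq> M" "R0 \<subseteq> T" "\<forall>r \<in> R0. \<psi> r = retraction r"
        using piece[OF G(1)] by blast
      have eq: "\<phi> r = \<psi> r" if "r \<in> T" for r using that T(1) G(1) by (intro \<phi>) auto
      have Tsub: "subring T F" "\<psi> \<in> ring_hom (F\<lparr>carrier := T\<rparr>) K" "inj_on \<psi> T"
        using T(2) by (auto simp: partial_embedding_def)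
      have "\<phi> \<in> ring_hom (F\<lparr>carrier := T\<rparr>) K"
        using ring_hom_closed[OF Tsub(2)] ring_hom_mult[OF Tsub(2)] ring_hom_add[OF Tsub(2)] ring_hom_one[OF Tsub(2)]
          subringE(3,6,7)[OF Tsub(1)]
        by (intro ring_hom_memI) (auto simp: eq)
      moreover have "inj_on \<phi> T" using Tsub(3) eq by (simp cong: inj_on_cong)
      moreover have "T \<subseteq> R" unfolding R_def using T(1) G(1) by force
      moreover have "x \<in> T" "y \<in> T" using G T(1) by auto
      ultimately show ?thesis using T eq Tsub(1) unfolding partial_embedding_def by (intro exI[of _ T]) auto
    qed
    have Rne: "\<one>\<^bsub>F\<^esub> \<in> R"
    proof -
      obtain G where G: "G \<in> \<C>" using \<C>(1) by blast
      obtain T \<psi> where T: "G = (\<lambda>r. (r, \<psi> r)) ` T" "partial_embedding T \<psi>" using piece[OF G] by blast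
      have "\<one>\<^bsub>F\<^esub> \<in> T" using T(2) subringE(3) unfolding partial_embedding_def by blast
      then show ?thesis using T(1) G unfolding R_def by force
    qed
    have RM: "R \<subseteq> M" using piece_at by blast
    have R0R: "R0 \<subseteq> R" "\<forall>r\<in>R0. \<phi> r = retraction r" using piece_at[OF Rne Rne] by blast+
    have sub: "subring R F"
    proof (rule F.subringI)
      show "R \<subseteq> carrier F" using RM subringE(1)[OF M] by blast
      show "\<one>\<^bsub>F\<^esub> \<in> R" by (rule Rne)
      fix h1 assume h1: "h1 \<in> R"
      from piece_at[OF h1 h1] obtain T where T: "subring T F" "h1 \<in> T" "T \<subseteq> R"
        unfolding partial_embedding_def by blast
      then show "\<ominus>\<^bsub>F\<^esub> h1 \<in> R" using subringE(5)[OF T(1,2)] by blast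
      fix h2 assume h2: "h2 \<in> R"
      from piece_at[OF h1 h2] obtain T where T: "subring T F" "h1 \<in> T" "h2 \<in> T" "T \<subseteq> R"
        unfolding partial_embedding_def by blast
      then show "h1 \<otimes>\<^bsub>F\<^esub> h2 \<in> R" "h1 \<oplus>\<^bsub>F\<^esub> h2 \<in> R"
        using subringE(6)[OF T(1-3)] subringE(7)[OF T(1-3)] by blast+
    qed
    have hom: "\<phi> \<in> ring_hom (F\<lparr>carrier := R\<rparr>) K"
    proof (rule ring_hom_memI)
      fix x y assume "x \<in> carrier (F\<lparr>carrier := R\<rparr>)" "y \<in> carrier (F\<lparr>carrier := R\<rparr>)"
      then obtain T where T: "\<phi> \<in> ring_hom (F\<lparr>carrier := T\<rparr>) K" "x \<in> T" "y \<in> T"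
        using piece_at[of x y] unfolding partial_embedding_def by auto
      show "\<phi> (x \<otimes>\<^bsub>F\<lparr>carrier := R\<rparr>\<^esub> y) = \<phi> x \<otimes>\<^bsub>K\<^esub> \<phi> y" using ring_hom_mult[OF T(1)] T by simp
      show "\<phi> (x \<oplus>\<^bsub>F\<lparr>carrier := R\<rparr>\<^esub> y) = \<phi> x \<oplus>\<^bsub>K\<^esub> \<phi> y" using ring_hom_add[OF T(1)] T by simp
    next
      fix x assume "x \<in> carrier (F\<lparr>carrier := R\<rparr>)"
      then obtain T where T: "\<phi> \<in> ring_hom (F\<lparr>carrier := T\<rparr>) K" "x \<in> T"
        using piece_at[of x x] unfolding partial_embedding_def by auto
      show "\<phi> x \<in> carrier K" using ring_hom_closed[OF T(1)] T by simp
    next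
      obtain T where T: "\<phi> \<in> ring_hom (F\<lparr>carrier := T\<rparr>) K"
        using piece_at[OF Rne Rne] unfolding partial_embedding_def by auto
      show "\<phi> \<one>\<^bsub>F\<lparr>carrier := R\<rparr>\<^esub> = \<one>\<^bsub>K\<^esub>" using ring_hom_one[OF T] by simp
    qed
    have inj: "inj_on \<phi> R"
    proof (rule inj_onI)
      fix x y assume "x \<in> R" "y \<in> R" "\<phi> x = \<phi> y"
      then show "x = y" using piece_at[of x y] unfolding partial_embedding_def by (auto dest: inj_onD)
    qed
    show "\<Union>\<C> \<in> graphs"
      unfolding graphs_def using G_eq sub hom inj RM R0R unfolding partial_embedding_def by blast
  qed
  then obtain Gm where Gm: "Gm \<in> graphs" and Gm_max: "\<And>G. \<lbrakk>G \<in> graphs; Gm \<subseteq> G\<rbrakk> \<Longrightarrow> G = Gm" by blast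
  from Gm obtain R \<phi> where Gm_eq: "Gm = (\<lambda>r. (r, \<phi> r)) ` R" and emb: "partial_embedding R \<phi>"
    and RM: "R \<subseteq> M" and R0R: "R0 \<subseteq> R" and \<phi>0: "\<forall>r \<in> R0. \<phi> r = retraction r"
    unfolding graphs_def mem_Collect_eq by (elim exE conjE) (rule that)
  have max: "G = (\<lambda>r. (r, \<phi> r)) ` R" if "G \<in> graphs" "(\<lambda>r. (r, \<phi> r)) ` R \<subseteq> G" for G
    using Gm_max that unfolding Gm_eq by simp
  have R: "subring R F" "\<phi> \<in> ring_hom (F\<lparr>carrier := R\<rparr>) K" "inj_on \<phi> R"
    using emb by (auto simp: partial_embedding_def)
  have inj0: "\<phi> r \<noteq> \<zero>\<^bsub>K\<^esub>" if "r \<in> R" "r \<noteq> \<zero>\<^bsub>F\<^esub>" for r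
    using that inj_onD[OF R(3), of r "\<zero>\<^bsub>F\<^esub>"] subringE(2)[OF R(1)]
      ring_hom_zero[OF R(2) F.subring_is_ring[OF R(1)] K.ring_axioms] by auto
  have "M \<subseteq> R"
  proof
    fix x assume x: "x \<in> M"
    then have xF: "x \<in> carrier F" using subringE(1)[OF M] by blast
    show "x \<in> R"
    proof (rule specialization_step[OF F.domain_axioms K.algebraically_closed_axioms R(1) xF])
      fix R' c a
      assume R': "subring R' F" "insert x R \<subseteq> R'" and least: "\<And>M. \<lbrakk>subring M F; insert x R \<subseteq> M\<rbrakk> \<Longrightarrow> R' \<subseteq> M"
        and c: "c \<in> R" "c \<noteq> \<zero>\<^bsub>F\<^esub>"
        and a: "\<And>b. \<lbrakk>b \<in> R'; b \<noteq> \<zero>\<^bsub>F\<^esub>\<rbrakk> \<Longrightarrow> a b \<in> R \<and> a b \<noteq> \<zero>\<^bsub>F\<^esub>"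
        and ext: "\<And>\<phi> D. \<lbrakk>\<phi> \<in> ring_hom (F\<lparr>carrier := R\<rparr>) K; \<phi> c \<noteq> \<zero>\<^bsub>K\<^esub>; D \<subseteq> R' - {\<zero>\<^bsub>F\<^esub>}; |D| <o |carrier K|;
              \<And>b. b \<in> D \<Longrightarrow> \<phi> (a b) \<noteq> \<zero>\<^bsub>K\<^esub>\<rbrakk> \<Longrightarrow>
            \<exists>\<phi>' \<in> ring_hom (F\<lparr>carrier := R'\<rparr>) K. (\<forall>r\<in>R. \<phi>' r = \<phi> r) \<and> (\<forall>b\<in>D. \<phi>' b \<noteq> \<zero>\<^bsub>K\<^esub>)"
      have R'M: "R' \<subseteq> M" using least[OF M] x RM by auto
      have card: "|R' - {\<zero>\<^bsub>F\<^esub>}| <o |carrier K|" using R'M by (intro small) auto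
      have nz: "\<phi> (a b) \<noteq> \<zero>\<^bsub>K\<^esub>" if "b \<in> R' - {\<zero>\<^bsub>F\<^esub>}" for b using a[of b] inj0 that by auto
      have "\<exists>\<phi>'\<in>ring_hom (F\<lparr>carrier := R'\<rparr>) K. (\<forall>r\<in>R. \<phi>' r = \<phi> r) \<and> (\<forall>b\<in>R' - {\<zero>\<^bsub>F\<^esub>}. \<phi>' b \<noteq> \<zero>\<^bsub>K\<^esub>)"
        by (rule ext[OF R(2) inj0[OF c] order_refl card]) (rule nz)
      then
      obtain \<phi>' where \<phi>': "\<phi>' \<in> ring_hom (F\<lparr>carrier := R'\<rparr>) K" "\<forall>r\<in>R. \<phi>' r = \<phi> r" "\<forall>b\<in>R' - {\<zero>\<^bsub>F\<^esub>}. \<phi>' b \<noteq> \<zero>\<^bsub>K\<^esub>"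
        by (elim bexE conjE) (rule that)
      interpret h: ring_hom_ring "F\<lparr>carrier := R'\<rparr>" K \<phi>'
        by (rule ring_hom_ringI2[OF F.subring_is_ring[OF R'(1)] K.ring_axioms \<phi>'(1)])
      have "a_kernel (F\<lparr>carrier := R'\<rparr>) K \<phi>' = {\<zero>\<^bsub>F\<^esub>}"
        unfolding a_kernel_def' using \<phi>'(3) subringE(2)[OF R'(1)] h.hom_zero by auto
      then have "inj_on \<phi>' R'"
        using h.trivial_ker_imp_inj by simp
      then have "(\<lambda>r. (r, \<phi>' r)) ` R' \<in> graphs"
        unfolding graphs_def partial_embedding_def using R' \<phi>' R'M R0R \<phi>0 by (intro CollectI exI[of _ R'] exI[of _ \<phi>']) auto
      then have "(\<lambda>r. (r, \<phi>' r)) ` R' = (\<lambda>r. (r, \<phi> r)) ` R"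
        using R'(2) \<phi>'(2) by (intro max) force+
      then have "fst ` (\<lambda>r. (r, \<phi>' r)) ` R' = fst ` (\<lambda>r. (r, \<phi> r)) ` R" by simp
      then show "x \<in> R" using R'(2) by (simp add: image_image)
    qed
  qed
  then have "\<iota> ` C \<union> S \<subseteq> R" using incl by (rule subset_trans[rotated])
  moreover have "\<phi> (\<iota> c) = c" if c: "c \<in> C" for c
  proof -
    have "c \<in> carrier K" "\<iota> c \<in> R0" using c C(1) incl by (auto simp: R0_def)
    then show ?thesis using \<phi>0 retraction_\<iota> by simp
  qed
  ultimately show ?thesis using R by (intro exI[of _ R] exI[of _ \<phi>]) simp
qed

text \<open>
  If \<open>K\<close> is countable, then being smaller than \<open>K\<close> means being finite, and \<open>C\<close> may be enlarged to \<open>K\<close>. If \<open>K\<close> is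
  uncountable, then a ring generated by fewer than \<open>|K|\<close> elements is smaller than \<open>K\<close>.
\<close>

theorem specialization:
  assumes C: "C \<subseteq> carrier K" "|C| <o |carrier K|"
    and S: "S \<subseteq> carrier F" "|S| <o |carrier K|"
  obtains R \<phi> where "subring R F" "\<iota> ` C \<union> S \<subseteq> R" "\<phi> \<in> ring_hom (F\<lparr>carrier := R\<rparr>) K" "\<And>c. c \<in> C \<Longrightarrow> \<phi> (\<iota> c) = c"
proof (cases "|UNIV :: nat set| <o |carrier K|")
  case True
  obtain R \<phi> where R: "subring R F \<and> \<iota> ` C \<union> S \<subseteq> R \<and> \<phi> \<in> ring_hom (F\<lparr>carrier := R\<rparr>) K \<and> (\<forall>c \<in> C. \<phi> (\<iota> c) = c)"
    using small_embedding[OF True C S] by (elim exE) (rule that)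
  show ?thesis by (rule that[of R \<phi>]) (use R in auto)
next
  case False
  then have "|carrier K| \<le>o |UNIV :: nat set|" using ordLess_or_ordLeq[OF card_of_Well_order card_of_Well_order] by blast
  then have "|S| <o |UNIV :: nat set|" using S(2) ordLess_ordLeq_trans by blast
  then have "finite S" using infinite_iff_card_of_nat not_ordLess_ordLeq by blast
  then obtain R where R: "subring R F" "\<iota> ` carrier K \<union> S \<subseteq> R"
    and \<phi>: "\<forall>b \<in> R - {\<zero>\<^bsub>F\<^esub>}. \<exists>\<phi> \<in> ring_hom (F\<lparr>carrier := R\<rparr>) K. (\<forall>k \<in> carrier K. \<phi> (\<iota> k) = k) \<and> \<phi> b \<noteq> \<zero>\<^bsub>K\<^esub>"
    using finite_specialization[OF _ S(1)] by blast
  have "\<one>\<^bsub>F\<^esub> \<in> R - {\<zero>\<^bsub>F\<^esub>}" using subringE(3)[OF R(1)] by simp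
  then obtain \<psi> where "\<psi> \<in> ring_hom (F\<lparr>carrier := R\<rparr>) K" "\<forall>k \<in> carrier K. \<psi> (\<iota> k) = k" using \<phi> by blast
  then show ?thesis using R C(1) by (intro that[of R \<psi>]) auto
qed

end

section \<open>Semilinear relations and extension of scalars\<close>

text \<open>
  The \<open>\<phi>\<close>-semilinear relation spanned by \<open>Z\<close>. In the cases of interest it is the graph of a partial
  map. Working with the relation allows closure properties to be proved by induction, before it is
  known that the map is well defined.
\<close>

inductive_set semilinear_graph ::
    "'r set \<Rightarrow> ('r \<Rightarrow> 's) \<Rightarrow> ('r, 'v, 'd) module_scheme \<Rightarrow> ('s, 'w, 'e) module_scheme \<Rightarrow> ('v \<times> 'w) set \<Rightarrow> ('v \<times> 'w) set"
  for R \<phi> M N Z where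
  gen: "(x, y) \<in> Z \<Longrightarrow> (x, y) \<in> semilinear_graph R \<phi> M N Z"
| zero: "(\<zero>\<^bsub>M\<^esub>, \<zero>\<^bsub>N\<^esub>) \<in> semilinear_graph R \<phi> M N Z"
| add: "\<lbrakk>(x, y) \<in> semilinear_graph R \<phi> M N Z; (x', y') \<in> semilinear_graph R \<phi> M N Z\<rbrakk> \<Longrightarrow>
    (x \<oplus>\<^bsub>M\<^esub> x', y \<oplus>\<^bsub>N\<^esub> y') \<in> semilinear_graph R \<phi> M N Z"
| smult: "\<lbrakk>r \<in> R; (x, y) \<in> semilinear_graph R \<phi> M N Z\<rbrakk> \<Longrightarrow>
    (r \<odot>\<^bsub>M\<^esub> x, \<phi> r \<odot>\<^bsub>N\<^esub> y) \<in> semilinear_graph R \<phi> M N Z"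

lemma semilinear_graph_carrier:
  assumes M: "module F M" and N: "module K N" and R: "R \<subseteq> carrier F" and \<phi>: "\<phi> \<in> R \<rightarrow> carrier K"
    and Z: "Z \<subseteq> carrier M \<times> carrier N" and xy: "(x, y) \<in> semilinear_graph R \<phi> M N Z"
  shows "x \<in> carrier M" "y \<in> carrier N"
proof -
  interpret M: module F M by fact
  interpret N: module K N by fact
  have "x \<in> carrier M \<and> y \<in> carrier N" using xy
  proof induction
    case (gen x y)
    then show ?case using Z by blast
  next
    case (smult r x y)
    then have "r \<in> carrier F" "\<phi> r \<in> carrier K" using R \<phi> by auto
    then show ?case using smult by simp
  qed simp_all
  then show "x \<in> carrier M" "y \<in> carrier N" by auto
qed

text \<open>
  This is how a semilinear relation is seen to be single-valued: functionals \<open>g\<close> that match functionals \<open>f\<close>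
  on the generators have their value at \<open>y\<close> determined by \<open>x\<close>, and enough such \<open>g\<close> determine \<open>y\<close>.
\<close>

lemma semilinear_graph_functionals:
  assumes M: "module F M" and N: "module K N"
    and R: "subring R F" and \<phi>: "\<phi> \<in> ring_hom (F\<lparr>carrier := R\<rparr>) K"
    and Z: "Z \<subseteq> carrier M \<times> carrier N"
    and f: "f \<in> linear_maps F M (base_alg F)" and g: "g \<in> linear_maps K N (base_alg K)"
    and fg: "\<And>x y. (x, y) \<in> Z \<Longrightarrow> f x \<in> R \<and> \<phi> (f x) = g y"
    and xy: "(x, y) \<in> semilinear_graph R \<phi> M N Z"
  shows "f x \<in> R \<and> \<phi> (f x) = g y"
proof -
  interpret M: module F M by fact
  interpret N: module K N by fact
  have RF: "R \<subseteq> carrier F" using subringE(1)[OF R] .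
  have \<phi>c: "\<phi> \<in> R \<rightarrow> carrier K" using ring_hom_closed[OF \<phi>] by auto
  note carr = semilinear_graph_carrier[OF M N RF \<phi>c Z]
  show ?thesis using xy
  proof induction
    case (gen x y)
    then show ?case by (rule fg)
  next
    case zero
    have "f \<zero>\<^bsub>M\<^esub> = \<zero>\<^bsub>F\<^esub>" "g \<zero>\<^bsub>N\<^esub> = \<zero>\<^bsub>K\<^esub>"
      using linear_maps_zero[OF M module_base_alg[OF M.R.cring_axioms] f] linear_maps_zero[OF N module_base_alg[OF N.R.cring_axioms] g]
      by simp_all
    moreover have "\<phi> \<zero>\<^bsub>F\<^esub> = \<zero>\<^bsub>K\<^esub>"
      using ring_hom_zero[OF \<phi> M.R.subring_is_ring[OF R] N.R.ring_axioms] by simp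
    ultimately show ?case using subringE(2)[OF R] by simp
  next
    case (add x y x' y')
    then show ?case
      using linear_maps_add[OF f carr(1)[OF add.hyps(1)] carr(1)[OF add.hyps(2)]]
        linear_maps_add[OF g carr(2)[OF add.hyps(1)] carr(2)[OF add.hyps(2)]]
        ring_hom_add[OF \<phi>, of "f x" "f x'"] subringE(7)[OF R, of "f x" "f x'"] by simp
  next
    case (smult r x y)
    have "r \<in> carrier F" "\<phi> r \<in> carrier K" using smult.hyps RF \<phi>c by auto
    then show ?case
      using linear_maps_smult[OF f _ carr(1)[OF smult.hyps(2)], of r] linear_maps_smult[OF g _ carr(2)[OF smult.hyps(2)], of "\<phi> r"]
        ring_hom_mult[OF \<phi>, of r "f x"] subringE(6)[OF R, of r "f x"] smult by simp
  qed
qed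

lemma nonassoc_mult_zero:
  assumes "nonassoc_algebra R M" "x \<in> carrier M"
  shows "x \<otimes>\<^bsub>M\<^esub> \<zero>\<^bsub>M\<^esub> = \<zero>\<^bsub>M\<^esub>" "\<zero>\<^bsub>M\<^esub> \<otimes>\<^bsub>M\<^esub> x = \<zero>\<^bsub>M\<^esub>"
proof -
  interpret M: nonassoc_algebra R M by fact
  show "x \<otimes>\<^bsub>M\<^esub> \<zero>\<^bsub>M\<^esub> = \<zero>\<^bsub>M\<^esub>" "\<zero>\<^bsub>M\<^esub> \<otimes>\<^bsub>M\<^esub> x = \<zero>\<^bsub>M\<^esub>"
    using M.smult_mult_left[of "\<zero>\<^bsub>R\<^esub>" "\<zero>\<^bsub>M\<^esub>" x] M.smult_mult_right[of "\<zero>\<^bsub>R\<^esub>" x "\<zero>\<^bsub>M\<^esub>"] M.mult_closed assms(2) by simp_all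
qed

lemma semilinear_graph_mult:
  assumes M: "nonassoc_algebra F M" and N: "nonassoc_algebra K N"
    and R: "R \<subseteq> carrier F" and \<phi>: "\<phi> \<in> R \<rightarrow> carrier K"
    and Z: "Z \<subseteq> carrier M \<times> carrier N"
    and ZZ: "\<And>x y x' y'. \<lbrakk>(x, y) \<in> Z; (x', y') \<in> Z\<rbrakk> \<Longrightarrow> (x \<otimes>\<^bsub>M\<^esub> x', y \<otimes>\<^bsub>N\<^esub> y') \<in> semilinear_graph R \<phi> M N Z"
    and 1: "(x, y) \<in> semilinear_graph R \<phi> M N Z" and 2: "(x', y') \<in> semilinear_graph R \<phi> M N Z"
  shows "(x \<otimes>\<^bsub>M\<^esub> x', y \<otimes>\<^bsub>N\<^esub> y') \<in> semilinear_graph R \<phi> M N Z"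
proof -
  interpret M: nonassoc_algebra F M by fact
  interpret N: nonassoc_algebra K N by fact
  note carr = semilinear_graph_carrier[OF M.module_axioms N.module_axioms R \<phi> Z]
  note M0 = nonassoc_mult_zero[OF M] and N0 = nonassoc_mult_zero[OF N]
  have gen_left: "(a \<otimes>\<^bsub>M\<^esub> x', b \<otimes>\<^bsub>N\<^esub> y') \<in> semilinear_graph R \<phi> M N Z" if ab: "(a, b) \<in> Z" for a b
    using 2
  proof induction
    case (gen x y)
    then show ?case by (rule ZZ[OF ab])
  next
    case zero
    have "a \<in> carrier M" "b \<in> carrier N" using ab Z by auto
    then show ?case using semilinear_graph.zero by (simp add: M0 N0)
  next
    case (add x y x' y')
    have "a \<in> carrier M" "b \<in> carrier N" using ab Z by auto
    then show ?case
      using semilinear_graph.add[OF add.IH] carr[OF add.hyps(1)] carr[OF add.hyps(2)]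
      by (simp add: M.mult_r_distr N.mult_r_distr)
  next
    case (smult r x y)
    have "a \<in> carrier M" "b \<in> carrier N" "r \<in> carrier F" "\<phi> r \<in> carrier K" using ab Z R \<phi> smult.hyps by auto
    then show ?case
      using semilinear_graph.smult[OF smult.hyps(1) smult.IH] carr[OF smult.hyps(2)]
      by (simp add: M.smult_mult_right N.smult_mult_right)
  qed
  note c2 = carr[OF 2]
  show ?thesis using 1
  proof induction
    case (gen x y)
    then show ?case by (rule gen_left)
  next
    case zero
    show ?case using semilinear_graph.zero c2 by (simp add: M0 N0)
  next
    case (add a b a' b')
    then show ?case
      using semilinear_graph.add[OF add.IH] carr[OF add.hyps(1)] carr[OF add.hyps(2)] c2
      by (simp add: M.mult_l_distr N.mult_l_distr)
  next
    case (smult r x y)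
    have "r \<in> carrier F" "\<phi> r \<in> carrier K" using R \<phi> smult.hyps by auto
    then show ?case
      using semilinear_graph.smult[OF smult.hyps(1) smult.IH] carr[OF smult.hyps(2)] c2
      by (simp add: M.smult_mult_left N.smult_mult_left)
  qed
qed

text \<open>
  The extension of scalars \<open>A \<otimes> F\<close>, characterized without reference to a construction: the image of \<open>u\<close>
  spans \<open>N\<close> over \<open>F\<close> (\<open>ext_induct\<close>), and there are no more \<open>F\<close>-linear relations in it than necessary, because every
  \<open>K\<close>-linear map from \<open>A\<close> to \<open>F\<close> comes from a functional on \<open>N\<close> (\<open>ext_functional\<close>). Both conditions are
  invariant under isomorphism.
\<close>

locale scalar_extension =
  fixes K :: "('u, 'c) ring_scheme" and F :: "('u, 'u) module" and A :: "('u, 'v) module" and N :: "('u, 'w) module"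
    and u :: "'v \<Rightarrow> 'w"
  assumes ext_closed: "x \<in> carrier A \<Longrightarrow> u x \<in> carrier N"
    and ext_add: "\<lbrakk>x \<in> carrier A; y \<in> carrier A\<rbrakk> \<Longrightarrow> u (x \<oplus>\<^bsub>A\<^esub> y) = u x \<oplus>\<^bsub>N\<^esub> u y"
    and ext_smult: "\<lbrakk>k \<in> carrier K; x \<in> carrier A\<rbrakk> \<Longrightarrow> u (k \<odot>\<^bsub>A\<^esub> x) = (k \<odot>\<^bsub>F\<^esub> \<one>\<^bsub>F\<^esub>) \<odot>\<^bsub>N\<^esub> u x"
    and ext_mult: "\<lbrakk>x \<in> carrier A; y \<in> carrier A\<rbrakk> \<Longrightarrow> u (x \<otimes>\<^bsub>A\<^esub> y) = u x \<otimes>\<^bsub>N\<^esub> u y"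
    and ext_induct: "\<lbrakk>z \<in> carrier N; \<And>x. x \<in> carrier A \<Longrightarrow> P (u x);
        \<And>y z. \<lbrakk>y \<in> carrier N; z \<in> carrier N; P y; P z\<rbrakk> \<Longrightarrow> P (y \<oplus>\<^bsub>N\<^esub> z);
        \<And>c y. \<lbrakk>c \<in> carrier F; y \<in> carrier N; P y\<rbrakk> \<Longrightarrow> P (c \<odot>\<^bsub>N\<^esub> y)\<rbrakk> \<Longrightarrow> P z"
    and ext_functional: "f \<in> linear_maps K A F \<Longrightarrow>
        \<exists>g \<in> linear_maps F N (base_alg F). \<forall>x \<in> carrier A. g (u x) = f x"

lemma nalg_isoD:
  assumes "h \<in> nalg_iso R M N"
  shows "x \<in> carrier M \<Longrightarrow> h x \<in> carrier N"
    and "\<lbrakk>x \<in> carrier M; y \<in> carrier M\<rbrakk> \<Longrightarrow> h (x \<oplus>\<^bsub>M\<^esub> y) = h x \<oplus>\<^bsub>N\<^esub> h y"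
    and "\<lbrakk>x \<in> carrier M; y \<in> carrier M\<rbrakk> \<Longrightarrow> h (x \<otimes>\<^bsub>M\<^esub> y) = h x \<otimes>\<^bsub>N\<^esub> h y"
    and "\<lbrakk>a \<in> carrier R; x \<in> carrier M\<rbrakk> \<Longrightarrow> h (a \<odot>\<^bsub>M\<^esub> x) = a \<odot>\<^bsub>N\<^esub> h x"
    and "h ` carrier M = carrier N" and "inj_on h (carrier M)"
  using assms unfolding nalg_iso_def nalg_hom_def by (auto simp: bij_betw_def)

lemma scalar_extension_postcomp:
  assumes U: "scalar_extension K F A N u" and h: "h \<in> nalg_iso F N N'"
    and F: "algebra K F" and N: "nonassoc_algebra F N"
  shows "scalar_extension K F A N' (\<lambda>x. h (u x))"
proof -
  interpret U: scalar_extension K F A N u by fact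
  interpret F: algebra K F by fact
  interpret N: nonassoc_algebra F N by fact
  note hc = nalg_isoD(1)[OF h] and hadd = nalg_isoD(2)[OF h] and hmult = nalg_isoD(3)[OF h]
    and hsmult = nalg_isoD(4)[OF h] and inj = nalg_isoD(6)[OF h]
  have surj: "\<exists>y \<in> carrier N. z = h y" if "z \<in> carrier N'" for z
    using that nalg_isoD(5)[OF h] by blast
  show ?thesis
  proof
    show "h (u (k \<odot>\<^bsub>A\<^esub> x)) = (k \<odot>\<^bsub>F\<^esub> \<one>\<^bsub>F\<^esub>) \<odot>\<^bsub>N'\<^esub> h (u x)" if "k \<in> carrier K" "x \<in> carrier A" for k x
      using that U.ext_smult hsmult U.ext_closed F.smult_closed by simp
    show "P z" if z: "z \<in> carrier N'" and base: "\<And>x. x \<in> carrier A \<Longrightarrow> P (h (u x))"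
      and add: "\<And>y z. \<lbrakk>y \<in> carrier N'; z \<in> carrier N'; P y; P z\<rbrakk> \<Longrightarrow> P (y \<oplus>\<^bsub>N'\<^esub> z)"
      and smult: "\<And>c y. \<lbrakk>c \<in> carrier F; y \<in> carrier N'; P y\<rbrakk> \<Longrightarrow> P (c \<odot>\<^bsub>N'\<^esub> y)" for z P
    proof -
      obtain y where y: "y \<in> carrier N" "z = h y" using surj[OF z] by blast
      have "P (h y)" using y(1)
      proof (rule U.ext_induct)
        show "P (h (u x))" if "x \<in> carrier A" for x using base[OF that] .
        show "P (h (y \<oplus>\<^bsub>N\<^esub> z))" if "y \<in> carrier N" "z \<in> carrier N" "P (h y)" "P (h z)" for y z
          unfolding hadd[OF that(1,2)] using add[OF hc[OF that(1)] hc[OF that(2)] that(3,4)] .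
        show "P (h (c \<odot>\<^bsub>N\<^esub> y))" if "c \<in> carrier F" "y \<in> carrier N" "P (h y)" for c y
          unfolding hsmult[OF that(1,2)] using smult[OF that(1) hc[OF that(2)] that(3)] .
      qed
      then show ?thesis using y by simp
    qed
    show "\<exists>g \<in> linear_maps F N' (base_alg F). \<forall>x \<in> carrier A. g (h (u x)) = f x" if f: "f \<in> linear_maps K A F" for f
    proof -
      obtain g where g: "g \<in> linear_maps F N (base_alg F)" "\<forall>x \<in> carrier A. g (u x) = f x"
        using U.ext_functional[OF f] by blast
      define g' where "g' z = g (inv_into (carrier N) h z)" for z
      have g': "g' (h y) = g y" if "y \<in> carrier N" for y using inj that by (simp add: g'_def)
      have "g' \<in> linear_maps F N' (base_alg F)" unfolding linear_maps_def
      proof (intro CollectI conjI ballI funcsetI)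
        fix z assume z: "z \<in> carrier N'"
        obtain y where y: "y \<in> carrier N" "z = h y" using surj[OF z] by blast
        show "g' z \<in> carrier (base_alg F)" using g' y linear_maps_closed[OF g(1)] by simp
        fix z' assume z': "z' \<in> carrier N'"
        obtain y' where y': "y' \<in> carrier N" "z' = h y'" using surj[OF z'] by blast
        have "g' (h (y \<oplus>\<^bsub>N\<^esub> y')) = g (y \<oplus>\<^bsub>N\<^esub> y')"
          using y y' by (intro g' N.M.add.m_closed)
        then show "g' (z \<oplus>\<^bsub>N'\<^esub> z') = g' z \<oplus>\<^bsub>base_alg F\<^esub> g' z'"
          using y y' g' linear_maps_add[OF g(1) y(1) y'(1)] by (simp add: hadd)
      next
        fix c z assume c: "c \<in> carrier F" and z: "z \<in> carrier N'"
        obtain y where y: "y \<in> carrier N" "z = h y" using surj[OF z] by blast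
        have "g' (h (c \<odot>\<^bsub>N\<^esub> y)) = g (c \<odot>\<^bsub>N\<^esub> y)" using y c by (intro g' N.smult_closed)
        then show "g' (c \<odot>\<^bsub>N'\<^esub> z) = c \<odot>\<^bsub>base_alg F\<^esub> g' z"
          using y c g' linear_maps_smult[OF g(1) c y(1)] by (simp add: hsmult)
      qed
      then show ?thesis using g(2) g' U.ext_closed by (intro bexI[of _ g']) simp_all
    qed
  qed (use U.ext_closed U.ext_add U.ext_mult hc hadd hmult in simp_all)
qed

section \<open>Uniqueness of the extension of scalars\<close>

lemma scalar_extension_precomp:
  assumes V: "scalar_extension K F B N v" and g: "g \<in> nalg_iso K A B"
    and A: "nonassoc_algebra K A"
  shows "scalar_extension K F A N (\<lambda>x. v (g x))"
proof -
  interpret V: scalar_extension K F B N v by fact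
  interpret A: nonassoc_algebra K A by fact
  note gc = nalg_isoD(1)[OF g] and gadd = nalg_isoD(2)[OF g] and gmult = nalg_isoD(3)[OF g]
    and gsmult = nalg_isoD(4)[OF g] and inj = nalg_isoD(6)[OF g]
  have surj: "\<exists>y \<in> carrier A. z = g y" if "z \<in> carrier B" for z
    using that nalg_isoD(5)[OF g] by blast
  show ?thesis
  proof
    show "P z" if z: "z \<in> carrier N" and base: "\<And>x. x \<in> carrier A \<Longrightarrow> P (v (g x))"
      and add: "\<And>y z. \<lbrakk>y \<in> carrier N; z \<in> carrier N; P y; P z\<rbrakk> \<Longrightarrow> P (y \<oplus>\<^bsub>N\<^esub> z)"
      and smult: "\<And>c y. \<lbrakk>c \<in> carrier F; y \<in> carrier N; P y\<rbrakk> \<Longrightarrow> P (c \<odot>\<^bsub>N\<^esub> y)" for z P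
    proof (rule V.ext_induct[OF z _ add smult])
      fix x assume "x \<in> carrier B"
      then obtain y where "y \<in> carrier A" "x = g y" using surj by blast
      then show "P (v x)" using base by simp
    qed
    show "\<exists>h \<in> linear_maps F N (base_alg F). \<forall>x \<in> carrier A. h (v (g x)) = f x" if f: "f \<in> linear_maps K A F" for f
    proof -
      define f' where "f' z = f (inv_into (carrier A) g z)" for z
      have f': "f' (g y) = f y" if "y \<in> carrier A" for y using inj that by (simp add: f'_def)
      have "f' \<in> linear_maps K B F" unfolding linear_maps_def
      proof (intro CollectI conjI ballI funcsetI)
        fix z assume z: "z \<in> carrier B"
        obtain y where y: "y \<in> carrier A" "z = g y" using surj[OF z] by blast
        show "f' z \<in> carrier F" using f' y linear_maps_closed[OF f] by simp
        fix z' assume z': "z' \<in> carrier B"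
        obtain y' where y': "y' \<in> carrier A" "z' = g y'" using surj[OF z'] by blast
        have "f' (g (y \<oplus>\<^bsub>A\<^esub> y')) = f (y \<oplus>\<^bsub>A\<^esub> y')"
          using y y' by (intro f' A.M.add.m_closed)
        then show "f' (z \<oplus>\<^bsub>B\<^esub> z') = f' z \<oplus>\<^bsub>F\<^esub> f' z'"
          using y y' f' linear_maps_add[OF f y(1) y'(1)] by (simp add: gadd)
      next
        fix c z assume c: "c \<in> carrier K" and z: "z \<in> carrier B"
        obtain y where y: "y \<in> carrier A" "z = g y" using surj[OF z] by blast
        have "f' (g (c \<odot>\<^bsub>A\<^esub> y)) = f (c \<odot>\<^bsub>A\<^esub> y)" using y c by (intro f' A.smult_closed)
        then show "f' (c \<odot>\<^bsub>B\<^esub> z) = c \<odot>\<^bsub>F\<^esub> f' z"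
          using y c f' linear_maps_smult[OF f c y(1)] by (simp add: gsmult)
      qed
      then obtain h where "h \<in> linear_maps F N (base_alg F)" "\<forall>x \<in> carrier B. h (v x) = f' x"
        using V.ext_functional by blast
      then show ?thesis using f' gc by (intro bexI[of _ h]) simp_all
    qed
  qed (use V.ext_closed V.ext_add V.ext_smult V.ext_mult gc gadd gsmult gmult in simp_all)
qed

lemma nalg_isomorphicI:
  assumes M: "nonassoc_algebra R M"
    and g: "g \<in> linear_maps R M N" and g': "g' \<in> carrier N \<rightarrow> carrier M"
    and mult: "\<And>x y. \<lbrakk>x \<in> carrier M; y \<in> carrier M\<rbrakk> \<Longrightarrow> g (x \<otimes>\<^bsub>M\<^esub> y) = g x \<otimes>\<^bsub>N\<^esub> g y"
    and inv: "\<And>x. x \<in> carrier M \<Longrightarrow> g' (g x) = x" "\<And>y. y \<in> carrier N \<Longrightarrow> g (g' y) = y"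
  shows "nalg_isomorphic R M N"
proof -
  interpret M: nonassoc_algebra R M by fact
  define h where "h = restrict g (carrier M)"
  have h: "h x = g x" if "x \<in> carrier M" for x using that by (simp add: h_def)
  have "h \<in> nalg_hom R M N"
    unfolding nalg_hom_def
  proof (intro CollectI conjI ballI)
    show "h \<in> carrier M \<rightarrow>\<^sub>E carrier N" unfolding h_def using linear_maps_closed[OF g] by auto
    show "h (x \<oplus>\<^bsub>M\<^esub> y) = h x \<oplus>\<^bsub>N\<^esub> h y" if "x \<in> carrier M" "y \<in> carrier M" for x y
      using that linear_maps_add[OF g] by (simp add: h)
    show "h (x \<otimes>\<^bsub>M\<^esub> y) = h x \<otimes>\<^bsub>N\<^esub> h y" if "x \<in> carrier M" "y \<in> carrier M" for x y
      using that mult M.mult_closed by (simp add: h)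
    show "h (a \<odot>\<^bsub>M\<^esub> x) = a \<odot>\<^bsub>N\<^esub> h x" if "a \<in> carrier R" "x \<in> carrier M" for a x
      using that linear_maps_smult[OF g] by (simp add: h)
  qed
  moreover have "bij_betw h (carrier M) (carrier N)"
  proof (rule bij_betw_byWitness[where f' = g'])
    have "g' y \<in> carrier M" if "y \<in> carrier N" for y using g' that by auto
    then show "\<forall>y \<in> carrier N. h (g' y) = y" "g' ` carrier N \<subseteq> carrier M" using inv by (auto simp: h)
    show "\<forall>x \<in> carrier M. g' (h x) = x" "h ` carrier M \<subseteq> carrier N"
      using inv linear_maps_closed[OF g] by (auto simp: h)
  qed
  ultimately show ?thesis unfolding nalg_isomorphic_def nalg_iso_def by blast
qed

text \<open>
  The relation \<open>Q\<close> should be the graph of the isomorphism from \<open>N\<close> to \<open>N'\<close> that takes \<open>u a\<close> to \<open>v a\<close>. A functional \<open>g\<close> on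
  \<open>N'\<close> restricts along \<open>v\<close> to a \<open>K\<close>-linear map on \<open>A\<close>, which extends along \<open>u\<close> to a functional \<open>f\<close> on \<open>N\<close>; then \<open>f y = g z\<close>
  whenever \<open>(y, z) \<in> Q\<close>, and functionals separate points.
\<close>

lemma scalar_extension_graph_unique:
  fixes F :: "('u, 'u) module"
  assumes F: "field F" "algebra K F" and A: "nonassoc_algebra K A"
    and N: "nonassoc_algebra F N" and N': "nonassoc_algebra F N'"
    and U: "scalar_extension K F A N u" and V: "scalar_extension K F A N' v"
    and Q: "Q = semilinear_graph (carrier F) (\<lambda>c. c) N N' ((\<lambda>a. (u a, v a)) ` carrier A)"
    and y: "(y, z) \<in> Q" "(y, z') \<in> Q"
  shows "z = z'"
proof -
  interpret F: field F by fact
  interpret KF: algebra K F by fact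
  interpret A: nonassoc_algebra K A by fact
  interpret N: nonassoc_algebra F N by fact
  interpret N': nonassoc_algebra F N' by fact
  interpret U: scalar_extension K F A N u by fact
  interpret V: scalar_extension K F A N' v by fact
  have id: "(\<lambda>c. c) \<in> ring_hom (F\<lparr>carrier := carrier F\<rparr>) F" by (auto intro: ring_hom_memI)
  have Z: "(\<lambda>a. (u a, v a)) ` carrier A \<subseteq> carrier N \<times> carrier N'" using U.ext_closed V.ext_closed by auto
  have carr: "a \<in> carrier N \<and> b \<in> carrier N'" if "(a, b) \<in> Q" for a b
    using semilinear_graph_carrier[OF N.module_axioms N'.module_axioms _ _ Z, of "carrier F" "\<lambda>c. c" a b] that unfolding Q by auto
  show ?thesis
  proof (rule functionals_separate_points[OF F(1) N'.module_axioms])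
    show "z \<in> carrier N'" "z' \<in> carrier N'" using carr y by auto
    fix g assume g: "g \<in> linear_maps F N' (base_alg F)"
    have gcl: "g w \<in> carrier F" if "w \<in> carrier N'" for w using linear_maps_closed[OF g that] by simp
    have "(\<lambda>x. g (v x)) \<in> linear_maps K A F" unfolding linear_maps_def
    proof (intro CollectI conjI ballI funcsetI)
      show "g (v x) \<in> carrier F" if "x \<in> carrier A" for x using gcl V.ext_closed that by simp
      show "g (v (x \<oplus>\<^bsub>A\<^esub> y)) = g (v x) \<oplus>\<^bsub>F\<^esub> g (v y)" if "x \<in> carrier A" "y \<in> carrier A" for x y
        using that linear_maps_add[OF g] V.ext_closed V.ext_add by simp
      show "g (v (k \<odot>\<^bsub>A\<^esub> x)) = k \<odot>\<^bsub>F\<^esub> g (v x)" if k: "k \<in> carrier K" and x: "x \<in> carrier A" for k x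
      proof -
        have k1: "k \<odot>\<^bsub>F\<^esub> \<one>\<^bsub>F\<^esub> \<in> carrier F" using KF.smult_closed[OF k F.one_closed] .
        have "g (v (k \<odot>\<^bsub>A\<^esub> x)) = (k \<odot>\<^bsub>F\<^esub> \<one>\<^bsub>F\<^esub>) \<otimes>\<^bsub>F\<^esub> g (v x)"
          using linear_maps_smult[OF g k1 V.ext_closed[OF x]] V.ext_smult[OF k x] by simp
        also have "\<dots> = k \<odot>\<^bsub>F\<^esub> g (v x)"
          using KF.smult_assoc2[OF k F.one_closed gcl[OF V.ext_closed[OF x]]] gcl[OF V.ext_closed[OF x]] by simp
        finally show ?thesis .
      qed
    qed
    then obtain f where f: "f \<in> linear_maps F N (base_alg F)" "\<forall>x \<in> carrier A. f (u x) = g (v x)"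
      using U.ext_functional by blast
    have fcl: "f w \<in> carrier F" if "w \<in> carrier N" for w using linear_maps_closed[OF f(1) that] by simp
    have "f a = g b" if "(a, b) \<in> Q" for a b
    proof -
      have "f a \<in> carrier F \<and> f a = g b"
      proof (rule semilinear_graph_functionals[OF N.module_axioms N'.module_axioms F.carrier_is_subring id Z f(1) g])
        show "(a, b) \<in> semilinear_graph (carrier F) (\<lambda>c. c) N N' ((\<lambda>a. (u a, v a)) ` carrier A)" using that unfolding Q .
        show "f x \<in> carrier F \<and> f x = g y" if "(x, y) \<in> (\<lambda>a. (u a, v a)) ` carrier A" for x y
          using that f(2) fcl U.ext_closed by auto
      qed
      then show ?thesis by simp
    qed
    then show "g z = g z'" using y by metis
  qed
qed

lemma semilinear_graph_converse:
  assumes "(x, y) \<in> semilinear_graph R (\<lambda>c. c) M N Z"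
  shows "(y, x) \<in> semilinear_graph R (\<lambda>c. c) N M (Z\<inverse>)"
  using assms by induction (auto intro: semilinear_graph.intros)

text \<open>
  The relation \<open>Q\<close> is total and surjective because the images of \<open>u\<close> and \<open>v\<close> span. It is single-valued, and also
  injective, because its converse is a relation of the same kind.
\<close>

lemma scalar_extension_unique:
  fixes F :: "('u, 'u) module"
  assumes F: "field F" "algebra K F" and A: "nonassoc_algebra K A"
    and N: "nonassoc_algebra F N" and N': "nonassoc_algebra F N'"
    and U: "scalar_extension K F A N u" and V: "scalar_extension K F A N' v"
  shows "nalg_isomorphic F N N'"
proof -
  interpret A: nonassoc_algebra K A by fact
  interpret N: nonassoc_algebra F N by fact
  interpret N': nonassoc_algebra F N' by fact
  interpret U: scalar_extension K F A N u by fact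
  interpret V: scalar_extension K F A N' v by fact
  define Z where "Z = (\<lambda>a. (u a, v a)) ` carrier A"
  define Q where "Q = semilinear_graph (carrier F) (\<lambda>c. c) N N' Z"
  define Q' where "Q' = semilinear_graph (carrier F) (\<lambda>c. c) N' N ((\<lambda>a. (v a, u a)) ` carrier A)"
  have Z: "Z \<subseteq> carrier N \<times> carrier N'" using U.ext_closed V.ext_closed by (auto simp: Z_def)
  have Zconv: "Z\<inverse> = (\<lambda>a. (v a, u a)) ` carrier A" by (auto simp: Z_def)
  have conv: "(z, y) \<in> Q'" if "(y, z) \<in> Q" for y z
    using semilinear_graph_converse[of y z "carrier F" N N' Z] that unfolding Q_def Q'_def Zconv by simp
  have conv': "(y, z) \<in> Q" if "(z, y) \<in> Q'" for y z
    using semilinear_graph_converse[of z y "carrier F" N' N "Z\<inverse>"] that unfolding Q_def Q'_def Zconv[symmetric] by simp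
  have sv: "z = z'" if "(y, z) \<in> Q" "(y, z') \<in> Q" for y z z'
    by (rule scalar_extension_graph_unique[OF F A N N' U V Q_def[unfolded Z_def] that])
  have inj: "y = y'" if "(y, z) \<in> Q" "(y', z) \<in> Q" for y y' z
    by (rule scalar_extension_graph_unique[OF F A N' N V U Q'_def conv[OF that(1)] conv[OF that(2)]])
  have carr: "y \<in> carrier N \<and> z \<in> carrier N'" if "(y, z) \<in> Q" for y z
    using semilinear_graph_carrier[OF N.module_axioms N'.module_axioms _ _ Z, of "carrier F" "\<lambda>c. c" y z] that unfolding Q_def by auto
  have base: "(u a, v a) \<in> Q" if "a \<in> carrier A" for a
    unfolding Q_def using that by (intro semilinear_graph.gen) (auto simp: Z_def)
  have total: "\<exists>z. (y, z) \<in> Q" if "y \<in> carrier N" for y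
    using that
  proof (rule U.ext_induct)
    show "\<exists>z. (u x, z) \<in> Q" if "x \<in> carrier A" for x using base[OF that] by blast
    show "\<exists>z. (y \<oplus>\<^bsub>N\<^esub> y', z) \<in> Q" if "\<exists>z. (y, z) \<in> Q" "\<exists>z. (y', z) \<in> Q" for y y'
      using that unfolding Q_def by (blast intro: semilinear_graph.add)
    show "\<exists>z. (c \<odot>\<^bsub>N\<^esub> y, z) \<in> Q" if "c \<in> carrier F" "\<exists>z. (y, z) \<in> Q" for c y
      using that unfolding Q_def by (blast intro: semilinear_graph.smult)
  qed
  have onto: "\<exists>y. (y, z) \<in> Q" if "z \<in> carrier N'" for z
    using that
  proof (rule V.ext_induct)
    show "\<exists>y. (y, v x) \<in> Q" if "x \<in> carrier A" for x using base[OF that] by blast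
    show "\<exists>y. (y, z \<oplus>\<^bsub>N'\<^esub> z') \<in> Q" if "\<exists>y. (y, z) \<in> Q" "\<exists>y. (y, z') \<in> Q" for z z'
      using that unfolding Q_def by (blast intro: semilinear_graph.add)
    show "\<exists>y. (y, c \<odot>\<^bsub>N'\<^esub> z) \<in> Q" if c: "c \<in> carrier F" and z: "\<exists>y. (y, z) \<in> Q" for c z
      using z semilinear_graph.smult[OF c, of _ _ "\<lambda>c. c" N N' Z] unfolding Q_def by blast
  qed
  define h where "h y = (THE z. (y, z) \<in> Q)" for y
  have h: "h y = z" if "(y, z) \<in> Q" for y z
    unfolding h_def by (rule the_equality[where P = "\<lambda>z. (y, z) \<in> Q", OF that]) (rule sv[OF _ that])
  have hQ: "(y, h y) \<in> Q" if "y \<in> carrier N" for y using total[OF that] h by metis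
  define h' where "h' z = (THE y. (y, z) \<in> Q)" for z
  have h': "h' z = y" if "(y, z) \<in> Q" for y z
    unfolding h'_def by (rule the_equality[where P = "\<lambda>y. (y, z) \<in> Q", OF that]) (rule inj[OF _ that])
  have h'Q: "(h' z, z) \<in> Q" if "z \<in> carrier N'" for z using onto[OF that] h' by metis
  have hlin: "h \<in> linear_maps F N N'" unfolding linear_maps_def
  proof (intro CollectI conjI ballI funcsetI)
    show "h y \<in> carrier N'" if "y \<in> carrier N" for y using carr[OF hQ[OF that]] by simp
    show "h (y \<oplus>\<^bsub>N\<^esub> y') = h y \<oplus>\<^bsub>N'\<^esub> h y'" if "y \<in> carrier N" "y' \<in> carrier N" for y y'
      using hQ[OF that(1)] hQ[OF that(2)] unfolding Q_def by (intro h[unfolded Q_def] semilinear_graph.add)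
    show "h (c \<odot>\<^bsub>N\<^esub> y) = c \<odot>\<^bsub>N'\<^esub> h y" if c: "c \<in> carrier F" and y: "y \<in> carrier N" for c y
      using semilinear_graph.smult[OF c hQ[OF y, unfolded Q_def]] by (intro h[unfolded Q_def])
  qed
  have multQ: "(y \<otimes>\<^bsub>N\<^esub> y', z \<otimes>\<^bsub>N'\<^esub> z') \<in> Q" if "(y, z) \<in> Q" "(y', z') \<in> Q" for y y' z z'
    unfolding Q_def
  proof (rule semilinear_graph_mult[OF N N' _ _ Z])
    fix y z y' z' assume "(y, z) \<in> Z" "(y', z') \<in> Z"
    then obtain a a' where a: "a \<in> carrier A" "a' \<in> carrier A" "y = u a" "z = v a" "y' = u a'" "z' = v a'"
      by (auto simp: Z_def)
    then show "(y \<otimes>\<^bsub>N\<^esub> y', z \<otimes>\<^bsub>N'\<^esub> z') \<in> semilinear_graph (carrier F) (\<lambda>c. c) N N' Z"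
      using base[of "a \<otimes>\<^bsub>A\<^esub> a'"] A.mult_closed unfolding Q_def by (simp add: U.ext_mult V.ext_mult)
  qed (use that in \<open>simp_all add: Q_def\<close>)
  show ?thesis
  proof (rule nalg_isomorphicI[OF N hlin])
    show "h' \<in> carrier N' \<rightarrow> carrier N" using carr[OF h'Q] by auto
    show "h (y \<otimes>\<^bsub>N\<^esub> y') = h y \<otimes>\<^bsub>N'\<^esub> h y'" if "y \<in> carrier N" "y' \<in> carrier N" for y y'
      using that by (intro h multQ hQ)
    show "h' (h y) = y" if "y \<in> carrier N" for y using that by (intro h' hQ)
    show "h (h' z) = z" if "z \<in> carrier N'" for z using that by (intro h h'Q)
  qed
qed

section \<open>Descent to an algebraically closed field\<close>

lemma linear_multiplicative_on_basis:
  assumes A: "nonassoc_algebra K A" and B: "nonassoc_algebra K B"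
    and I: "module_basis K A I" and g: "g \<in> linear_maps K A B"
    and mult: "\<And>i j. \<lbrakk>i \<in> I; j \<in> I\<rbrakk> \<Longrightarrow> g (i \<otimes>\<^bsub>A\<^esub> j) = g i \<otimes>\<^bsub>B\<^esub> g j"
    and x: "x \<in> carrier A" and y: "y \<in> carrier A"
  shows "g (x \<otimes>\<^bsub>A\<^esub> y) = g x \<otimes>\<^bsub>B\<^esub> g y"
proof -
  interpret A: nonassoc_algebra K A by fact
  interpret B: nonassoc_algebra K B by fact
  note g_add = linear_maps_add[OF g] and g_smult = linear_maps_smult[OF g] and gc = linear_maps_closed[OF g]
  note g0 = linear_maps_zero[OF A.module_axioms B.module_axioms g]
  have left: "g (i \<otimes>\<^bsub>A\<^esub> y) = g i \<otimes>\<^bsub>B\<^esub> g y" if i: "i \<in> I" for i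
  proof -
    have iA: "i \<in> carrier A" by (rule A.basis_carrier[OF I i])
    show ?thesis using I y
    proof (induction rule: A.basis_induct)
      case (basis j)
      show ?case by (rule mult[OF i basis])
    next
      case zero
      show ?case using iA gc[OF iA] by (simp add: g0 nonassoc_mult_zero[OF A] nonassoc_mult_zero[OF B])
    next
      case (add y z)
      then show ?case using iA gc by (simp add: g_add A.mult_r_distr B.mult_r_distr A.mult_closed)
    next
      case (smult a y)
      then show ?case using iA gc by (simp add: g_smult A.smult_mult_right B.smult_mult_right A.mult_closed)
    qed
  qed
  show ?thesis using I x
  proof (induction rule: A.basis_induct)
    case (basis i)
    then show ?case by (rule left)
  next
    case zero
    show ?case using y gc[OF y] by (simp add: g0 nonassoc_mult_zero[OF A] nonassoc_mult_zero[OF B])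
  next
    case (add x z)
    then show ?case using y gc by (simp add: g_add A.mult_l_distr B.mult_l_distr A.mult_closed)
  next
    case (smult a x)
    then show ?case using y gc by (simp add: g_smult A.smult_mult_left B.smult_mult_left A.mult_closed)
  qed
qed

lemma algebra_structure_map:
  fixes F :: "('u, 'u) module"
  assumes "algebra K F"
  shows "(\<lambda>k. k \<odot>\<^bsub>F\<^esub> \<one>\<^bsub>F\<^esub>) \<in> ring_hom K F"
proof -
  interpret algebra K F by fact
  show ?thesis
  proof (rule ring_hom_memI)
    fix k l assume k: "k \<in> carrier K" and l: "l \<in> carrier K"
    show "(k \<otimes>\<^bsub>K\<^esub> l) \<odot>\<^bsub>F\<^esub> \<one>\<^bsub>F\<^esub> = (k \<odot>\<^bsub>F\<^esub> \<one>\<^bsub>F\<^esub>) \<otimes>\<^bsub>F\<^esub> (l \<odot>\<^bsub>F\<^esub> \<one>\<^bsub>F\<^esub>)"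
      using smult_assoc2[OF k, of "\<one>\<^bsub>F\<^esub>" "l \<odot>\<^bsub>F\<^esub> \<one>\<^bsub>F\<^esub>"] smult_assoc1[OF k l] smult_closed[OF l] by simp
    show "(k \<oplus>\<^bsub>K\<^esub> l) \<odot>\<^bsub>F\<^esub> \<one>\<^bsub>F\<^esub> = k \<odot>\<^bsub>F\<^esub> \<one>\<^bsub>F\<^esub> \<oplus>\<^bsub>F\<^esub> l \<odot>\<^bsub>F\<^esub> \<one>\<^bsub>F\<^esub>"
      using smult_l_distr[OF k l] by simp
  qed simp_all
qed

text \<open>
  The set \<open>S\<close> consists of the scalars in an expression of \<open>y\<close> by the vectors \<open>v j\<close>. This is stated in the form in
  which it is used: as soon as \<open>R\<close> contains \<open>S\<close>, the vector \<open>y\<close> has a specialization in \<open>B\<close>.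
\<close>

lemma finite_coefficients:
  fixes F :: "('u, 'u) module"
  assumes F: "algebra K F" and B: "module K B" and N: "module F N"
    and V: "scalar_extension K F B N v" and J: "module_basis K B J" and y: "y \<in> carrier N"
  shows "\<exists>S. finite S \<and> S \<subseteq> carrier F \<and>
    (\<forall>R \<phi>. S \<subseteq> R \<longrightarrow> (\<exists>b. (y, b) \<in> semilinear_graph R \<phi> N B ((\<lambda>j. (v j, j)) ` J)))"
proof -
  interpret F: algebra K F by fact
  interpret B: module K B by fact
  interpret N: module F N by fact
  interpret V: scalar_extension K F B N v by fact
  define G where "G R \<phi> = semilinear_graph R \<phi> N B ((\<lambda>j. (v j, j)) ` J)" for R and \<phi> :: "_ \<Rightarrow> _"
  define P where "P y S \<longleftrightarrow> finite S \<and> S \<subseteq> carrier F \<and> (\<forall>R \<phi>. S \<subseteq> R \<longrightarrow> (\<exists>b. (y, b) \<in> G R \<phi>))" for y S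
  have add: "\<exists>S. P (y \<oplus>\<^bsub>N\<^esub> z) S" if yz: "\<exists>S. P y S" "\<exists>S. P z S" for y z
  proof -
    obtain S T where S: "P y S" and T: "P z T" using yz by blast
    have "\<exists>b. (y \<oplus>\<^bsub>N\<^esub> z, b) \<in> G R \<phi>" if R: "S \<union> T \<subseteq> R" for R \<phi>
    proof -
      have "S \<subseteq> R" "T \<subseteq> R" using R by auto
      then obtain b c where "(y, b) \<in> G R \<phi>" "(z, c) \<in> G R \<phi>" using S T unfolding P_def by meson
      then have "(y \<oplus>\<^bsub>N\<^esub> z, b \<oplus>\<^bsub>B\<^esub> c) \<in> G R \<phi>" unfolding G_def by (rule semilinear_graph.add)
      then show ?thesis ..
    qed
    then have "P (y \<oplus>\<^bsub>N\<^esub> z) (S \<union> T)" using S T unfolding P_def by simp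
    then show ?thesis ..
  qed
  have smult: "\<exists>S. P (c \<odot>\<^bsub>N\<^esub> y) S" if c: "c \<in> carrier F" and y: "\<exists>S. P y S" for c y
  proof -
    obtain S where S: "P y S" using y by blast
    have "\<exists>b. (c \<odot>\<^bsub>N\<^esub> y, b) \<in> G R \<phi>" if R: "insert c S \<subseteq> R" for R \<phi>
    proof -
      have "S \<subseteq> R" "c \<in> R" using R by auto
      then obtain b where "(y, b) \<in> G R \<phi>" using S unfolding P_def by meson
      then have "(c \<odot>\<^bsub>N\<^esub> y, \<phi> c \<odot>\<^bsub>B\<^esub> b) \<in> G R \<phi>" using \<open>c \<in> R\<close> unfolding G_def by (intro semilinear_graph.smult)
      then show ?thesis ..
    qed
    then have "P (c \<odot>\<^bsub>N\<^esub> y) (insert c S)" using S c unfolding P_def by simp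
    then show ?thesis ..
  qed
  have base: "\<exists>S. P (v x) S" if x: "x \<in> carrier B" for x
    using J x
  proof (induction rule: B.basis_induct)
    case (basis j)
    have "(v j, j) \<in> G R \<phi>" for R \<phi> unfolding G_def using basis by (intro semilinear_graph.gen) simp
    then have "P (v j) {}" unfolding P_def by blast
    then show ?case ..
  next
    case zero
    have v0: "v \<zero>\<^bsub>B\<^esub> = \<zero>\<^bsub>N\<^esub>"
      using V.ext_smult[of "\<zero>\<^bsub>K\<^esub>" "\<zero>\<^bsub>B\<^esub>"] V.ext_closed[of "\<zero>\<^bsub>B\<^esub>"] F.smult_l_null[of "\<one>\<^bsub>F\<^esub>"] by simp
    have "(v \<zero>\<^bsub>B\<^esub>, \<zero>\<^bsub>B\<^esub>) \<in> G R \<phi>" for R \<phi> unfolding G_def v0 by (rule semilinear_graph.zero)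
    then have "P (v \<zero>\<^bsub>B\<^esub>) {}" unfolding P_def by blast
    then show ?case ..
  next
    case (add x y)
    show ?case unfolding V.ext_add[OF add.hyps] by (rule \<open>\<And>y z. \<lbrakk>\<exists>S. P y S; \<exists>S. P z S\<rbrakk> \<Longrightarrow> \<exists>S. P (y \<oplus>\<^bsub>N\<^esub> z) S\<close>[OF add.IH])
  next
    case (smult k x)
    have "k \<odot>\<^bsub>F\<^esub> \<one>\<^bsub>F\<^esub> \<in> carrier F" using smult.hyps by simp
    then show ?case unfolding V.ext_smult[OF smult.hyps]
      by (rule \<open>\<And>c y. \<lbrakk>c \<in> carrier F; \<exists>S. P y S\<rbrakk> \<Longrightarrow> \<exists>S. P (c \<odot>\<^bsub>N\<^esub> y) S\<close>[OF _ smult.IH])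
  qed
  have "\<exists>S. P y S" using y
  proof (rule V.ext_induct)
    show "\<exists>S. P (v x) S" if "x \<in> carrier B" for x using that by (rule base)
    show "\<exists>S. P (y \<oplus>\<^bsub>N\<^esub> z) S" if "\<exists>S. P y S" "\<exists>S. P z S" for y z using that by (rule add)
    show "\<exists>S. P (c \<odot>\<^bsub>N\<^esub> y) S" if "c \<in> carrier F" "\<exists>S. P y S" for c y using that by (rule smult)
  qed
  then show ?thesis unfolding P_def G_def .
qed

text \<open>
  The set \<open>C\<close> consists of the scalars in an expression of \<open>x\<close> by basis vectors. If they are fixed by \<open>\<phi>\<close>,
  then \<open>x\<close> itself is a specialization of its image \<open>v x\<close>. This will be applied to products of basis vectors, where \<open>C\<close> takes the place of the
  structure constants.
\<close>

lemma finite_constants: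
  fixes F :: "('u, 'u) module"
  assumes F: "algebra K F" and B: "module K B"
    and V: "scalar_extension K F B N v" and J: "module_basis K B J" and N: "module F N" and x: "x \<in> carrier B"
  shows "\<exists>C. finite C \<and> C \<subseteq> carrier K \<and>
    (\<forall>R \<phi>. (\<forall>c \<in> C. c \<odot>\<^bsub>F\<^esub> \<one>\<^bsub>F\<^esub> \<in> R \<and> \<phi> (c \<odot>\<^bsub>F\<^esub> \<one>\<^bsub>F\<^esub>) = c) \<longrightarrow>
       (v x, x) \<in> semilinear_graph R \<phi> N B ((\<lambda>j. (v j, j)) ` J))"
proof -
  interpret F: algebra K F by fact
  interpret B: module K B by fact
  interpret N: module F N by fact
  interpret V: scalar_extension K F B N v by fact
  define G where "G R \<phi> = semilinear_graph R \<phi> N B ((\<lambda>j. (v j, j)) ` J)" for R and \<phi> :: "_ \<Rightarrow> _"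
  define ok where "ok C R \<phi> \<longleftrightarrow> (\<forall>c \<in> C. c \<odot>\<^bsub>F\<^esub> \<one>\<^bsub>F\<^esub> \<in> R \<and> \<phi> (c \<odot>\<^bsub>F\<^esub> \<one>\<^bsub>F\<^esub>) = c)" for C R \<phi>
  have ok_Un: "ok (C \<union> D) R \<phi> \<longleftrightarrow> ok C R \<phi> \<and> ok D R \<phi>" for C D R \<phi> by (auto simp: ok_def)
  define P where "P x C \<longleftrightarrow> finite C \<and> C \<subseteq> carrier K \<and> (\<forall>R \<phi>. ok C R \<phi> \<longrightarrow> (v x, x) \<in> G R \<phi>)" for x C
  have "\<exists>C. P x C" using J x
  proof (induction rule: B.basis_induct)
    case (basis j)
    have "(v j, j) \<in> G R \<phi>" for R \<phi> unfolding G_def using basis by (intro semilinear_graph.gen) simp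
    then have "P j {}" unfolding P_def by blast
    then show ?case ..
  next
    case zero
    have v0: "v \<zero>\<^bsub>B\<^esub> = \<zero>\<^bsub>N\<^esub>"
      using V.ext_smult[of "\<zero>\<^bsub>K\<^esub>" "\<zero>\<^bsub>B\<^esub>"] V.ext_closed[of "\<zero>\<^bsub>B\<^esub>"] F.smult_l_null[of "\<one>\<^bsub>F\<^esub>"] by simp
    have "(v \<zero>\<^bsub>B\<^esub>, \<zero>\<^bsub>B\<^esub>) \<in> G R \<phi>" for R \<phi> unfolding G_def v0 by (rule semilinear_graph.zero)
    then have "P \<zero>\<^bsub>B\<^esub> {}" unfolding P_def by blast
    then show ?case ..
  next
    case (add x y)
    then obtain C D where C: "P x C" and D: "P y D" by blast
    have "(v (x \<oplus>\<^bsub>B\<^esub> y), x \<oplus>\<^bsub>B\<^esub> y) \<in> G R \<phi>" if "ok (C \<union> D) R \<phi>" for R \<phi>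
    proof -
      have "(v x, x) \<in> G R \<phi>" "(v y, y) \<in> G R \<phi>" using that C D unfolding P_def ok_Un by simp_all
      then show ?thesis unfolding V.ext_add[OF add.hyps] G_def by (rule semilinear_graph.add)
    qed
    then have "P (x \<oplus>\<^bsub>B\<^esub> y) (C \<union> D)" using C D unfolding P_def by simp
    then show ?case ..
  next
    case (smult k x)
    then obtain C where C: "P x C" by blast
    have "(v (k \<odot>\<^bsub>B\<^esub> x), k \<odot>\<^bsub>B\<^esub> x) \<in> G R \<phi>" if "ok ({k} \<union> C) R \<phi>" for R \<phi>
    proof -
      have k: "k \<odot>\<^bsub>F\<^esub> \<one>\<^bsub>F\<^esub> \<in> R" "\<phi> (k \<odot>\<^bsub>F\<^esub> \<one>\<^bsub>F\<^esub>) = k" using that unfolding ok_def by simp_all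
      have "(v x, x) \<in> G R \<phi>" using that C unfolding P_def ok_Un by simp
      from semilinear_graph.smult[OF k(1) this[unfolded G_def]] show ?thesis
        unfolding V.ext_smult[OF smult.hyps] k(2) G_def .
    qed
    then have "P (k \<odot>\<^bsub>B\<^esub> x) ({k} \<union> C)" using C smult.hyps unfolding P_def by simp
    then show ?case ..
  qed
  then show ?thesis unfolding P_def G_def ok_def .
qed

text \<open>
  The \<open>j\<close>-th coordinate functional of \<open>B\<close> extends to \<open>N\<close>, and its value at \<open>y\<close> is mapped by \<open>\<phi>\<close> to the \<open>j\<close>-th coordinate
  of every specialization of \<open>y\<close>.
\<close>

lemma specialized_graph_unique:
  fixes F :: "('u, 'u) module" and K :: "('u, 'c) ring_scheme"
  assumes F: "algebra K F" and B: "module K B" and N: "module F N"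
    and V: "scalar_extension K F B N v" and J: "module_basis K B J"
    and R: "subring R F" and \<phi>: "\<phi> \<in> ring_hom (F\<lparr>carrier := R\<rparr>) K"
    and y: "(y, b) \<in> semilinear_graph R \<phi> N B ((\<lambda>j. (v j, j)) ` J)" "(y, b') \<in> semilinear_graph R \<phi> N B ((\<lambda>j. (v j, j)) ` J)"
  shows "b = b'"
proof -
  interpret F: algebra K F by fact
  interpret B: module K B by fact
  interpret N: module F N by fact
  interpret V: scalar_extension K F B N v by fact
  have RF: "R \<subseteq> carrier F" using subringE(1)[OF R] .
  have \<phi>c: "\<phi> \<in> R \<rightarrow> carrier K" using ring_hom_closed[OF \<phi>] by auto
  have Z: "(\<lambda>j. (v j, j)) ` J \<subseteq> carrier N \<times> carrier B" using V.ext_closed B.basis_carrier[OF J] by auto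
  show ?thesis
  proof (rule coordinate_functionals[OF B J], goal_cases)
    case (1 \<delta>)
    note \<delta> = 1(1,2) and sep = 1(3)
    show ?case
    proof (rule sep)
    show "b \<in> carrier B" "b' \<in> carrier B"
      using semilinear_graph_carrier(2)[OF N B RF \<phi>c Z] y by blast+
    fix j assume j: "j \<in> J"
    note \<delta>j = \<delta>(1)[OF j]
    have \<delta>c: "\<delta> j x \<in> carrier K" if "x \<in> carrier B" for x using linear_maps_closed[OF \<delta>j that] by simp
    have "(\<lambda>x. \<delta> j x \<odot>\<^bsub>F\<^esub> \<one>\<^bsub>F\<^esub>) \<in> linear_maps K B F"
      unfolding linear_maps_def
    proof (intro CollectI conjI ballI funcsetI)
      show "\<delta> j x \<odot>\<^bsub>F\<^esub> \<one>\<^bsub>F\<^esub> \<in> carrier F" if "x \<in> carrier B" for x using \<delta>c[OF that] by simp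
      show "\<delta> j (x \<oplus>\<^bsub>B\<^esub> y) \<odot>\<^bsub>F\<^esub> \<one>\<^bsub>F\<^esub> = \<delta> j x \<odot>\<^bsub>F\<^esub> \<one>\<^bsub>F\<^esub> \<oplus>\<^bsub>F\<^esub> \<delta> j y \<odot>\<^bsub>F\<^esub> \<one>\<^bsub>F\<^esub>"
        if "x \<in> carrier B" "y \<in> carrier B" for x y
        using linear_maps_add[OF \<delta>j that] F.smult_l_distr[OF \<delta>c[OF that(1)] \<delta>c[OF that(2)]] by simp
      show "\<delta> j (k \<odot>\<^bsub>B\<^esub> x) \<odot>\<^bsub>F\<^esub> \<one>\<^bsub>F\<^esub> = k \<odot>\<^bsub>F\<^esub> (\<delta> j x \<odot>\<^bsub>F\<^esub> \<one>\<^bsub>F\<^esub>)" if "k \<in> carrier K" "x \<in> carrier B" for k x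
        using linear_maps_smult[OF \<delta>j that] F.smult_assoc1[OF that(1) \<delta>c[OF that(2)]] by simp
    qed
    then obtain f where f: "f \<in> linear_maps F N (base_alg F)" "\<forall>x \<in> carrier B. f (v x) = \<delta> j x \<odot>\<^bsub>F\<^esub> \<one>\<^bsub>F\<^esub>"
      using V.ext_functional by blast
    have gens: "f x \<in> R \<and> \<phi> (f x) = \<delta> j z" if xz: "(x, z) \<in> (\<lambda>j. (v j, j)) ` J" for x z
    proof -
      have z: "z \<in> J" "x = v z" using xz by auto
      have fx: "f x = \<delta> j z \<odot>\<^bsub>F\<^esub> \<one>\<^bsub>F\<^esub>" using f(2) B.basis_carrier[OF J z(1)] z(2) by simp
      have "\<phi> \<one>\<^bsub>F\<^esub> = \<one>\<^bsub>K\<^esub>" "\<phi> \<zero>\<^bsub>F\<^esub> = \<zero>\<^bsub>K\<^esub>"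
        using ring_hom_one[OF \<phi>] ring_hom_zero[OF \<phi> ring.subring_is_ring[OF cring.axioms(1)[OF module.axioms(1)[OF N]] R] cring.axioms(1)[OF module.axioms(1)[OF B]]] by simp_all
      then show ?thesis unfolding fx \<delta>(2)[OF j z(1)] using subringE(2,3)[OF R] by simp
    qed
    have "\<phi> (f y) = \<delta> j b" "\<phi> (f y) = \<delta> j b'"
      using semilinear_graph_functionals[OF N B R \<phi> Z f(1) \<delta>j gens y(1)]
        semilinear_graph_functionals[OF N B R \<phi> Z f(1) \<delta>j gens y(2)] by simp_all
    then show "\<delta> j b = \<delta> j b'" by simp
  qed
  qed
qed

text \<open>
  The map \<open>g\<close> sends a basis vector \<open>i\<close> to a specialization \<open>g0 i\<close> of \<open>u i\<close> in \<open>B\<close>. The two relations are the specialization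
  maps from \<open>R\<close>-submodules of \<open>N\<close> to \<open>A\<close> and to \<open>B\<close>, and the last conclusion says that \<open>g\<close> carries the first to the
  second. It implies multiplicativity: \<open>g (i \<otimes> i')\<close> and \<open>g i \<otimes> g i'\<close> both specialize \<open>u i \<otimes> u i'\<close>.
\<close>

lemma specialized_hom:
  fixes F :: "('u, 'u) module" and K :: "('u, 'c) ring_scheme"
  assumes A: "nonassoc_algebra K A" and B: "nonassoc_algebra K B" and N: "nonassoc_algebra F N"
    and I: "module_basis K A I"
    and R: "R \<subseteq> carrier F" and \<phi>: "\<phi> \<in> R \<rightarrow> carrier K"
    and ZA: "ZA = (\<lambda>i. (u i, i)) ` I" and uI: "u \<in> I \<rightarrow> carrier N" and ZB: "ZB \<subseteq> carrier N \<times> carrier B"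
    and multA: "\<And>i i'. \<lbrakk>i \<in> I; i' \<in> I\<rbrakk> \<Longrightarrow> (u i \<otimes>\<^bsub>N\<^esub> u i', i \<otimes>\<^bsub>A\<^esub> i') \<in> semilinear_graph R \<phi> N A ZA"
    and multB: "\<And>x y x' y'. \<lbrakk>(x, y) \<in> ZB; (x', y') \<in> ZB\<rbrakk> \<Longrightarrow> (x \<otimes>\<^bsub>N\<^esub> x', y \<otimes>\<^bsub>B\<^esub> y') \<in> semilinear_graph R \<phi> N B ZB"
    and unique: "\<And>y b b'. \<lbrakk>(y, b) \<in> semilinear_graph R \<phi> N B ZB; (y, b') \<in> semilinear_graph R \<phi> N B ZB\<rbrakk> \<Longrightarrow> b = b'"
    and ex: "\<And>i. i \<in> I \<Longrightarrow> \<exists>b. (u i, b) \<in> semilinear_graph R \<phi> N B ZB"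
  obtains g where "g \<in> linear_maps K A B"
    "\<And>x y. \<lbrakk>x \<in> carrier A; y \<in> carrier A\<rbrakk> \<Longrightarrow> g (x \<otimes>\<^bsub>A\<^esub> y) = g x \<otimes>\<^bsub>B\<^esub> g y"
    "\<And>y a. (y, a) \<in> semilinear_graph R \<phi> N A ZA \<Longrightarrow> (y, g a) \<in> semilinear_graph R \<phi> N B ZB"
proof -
  let ?GA = "semilinear_graph R \<phi> N A ZA" and ?GB = "semilinear_graph R \<phi> N B ZB"
  interpret A: nonassoc_algebra K A by fact
  interpret B: nonassoc_algebra K B by fact
  interpret N: nonassoc_algebra F N by fact
  have ZA': "ZA \<subseteq> carrier N \<times> carrier A" using uI A.basis_carrier[OF I] unfolding ZA by auto
  note carrA = semilinear_graph_carrier[OF N.module_axioms A.module_axioms R \<phi> ZA']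
  note carrB = semilinear_graph_carrier[OF N.module_axioms B.module_axioms R \<phi> ZB]
  obtain g0 where g0: "\<And>i. i \<in> I \<Longrightarrow> (u i, g0 i) \<in> ?GB" using ex by metis
  have "g0 \<in> I \<rightarrow> carrier B" using carrB(2)[OF g0] by blast
  then obtain g where g: "g \<in> linear_maps K A B" and gI: "\<And>i. i \<in> I \<Longrightarrow> g i = g0 i"
    using linear_extension[OF A.module_axioms B.module_axioms I] by blast
  have key: "(y, g a) \<in> ?GB" if "(y, a) \<in> ?GA" for y a
    using that
  proof induction
    case (gen y a)
    then show ?case using g0 gI unfolding ZA by auto
  next
    case zero
    show ?case using semilinear_graph.zero by (simp add: linear_maps_zero[OF A.module_axioms B.module_axioms g])
  next
    case (add x y x' y')
    then show ?case using semilinear_graph.add[OF add.IH]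
        linear_maps_add[OF g carrA(2)[OF add.hyps(1)] carrA(2)[OF add.hyps(2)]] by simp
  next
    case (smult r x y)
    have "\<phi> r \<in> carrier K" using smult.hyps \<phi> by auto
    then show ?case using semilinear_graph.smult[OF smult.hyps(1) smult.IH]
        linear_maps_smult[OF g _ carrA(2)[OF smult.hyps(2)]] by simp
  qed
  have "g (i \<otimes>\<^bsub>A\<^esub> i') = g i \<otimes>\<^bsub>B\<^esub> g i'" if i: "i \<in> I" "i' \<in> I" for i i'
  proof (rule unique)
    show "(u i \<otimes>\<^bsub>N\<^esub> u i', g (i \<otimes>\<^bsub>A\<^esub> i')) \<in> ?GB" by (rule key[OF multA[OF i]])
    show "(u i \<otimes>\<^bsub>N\<^esub> u i', g i \<otimes>\<^bsub>B\<^esub> g i') \<in> ?GB"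
      unfolding gI[OF i(1)] gI[OF i(2)]
      by (rule semilinear_graph_mult[OF N B R \<phi> ZB multB g0[OF i(1)] g0[OF i(2)]])
  qed
  then show ?thesis using that[OF g] linear_multiplicative_on_basis[OF A B I g] key by blast
qed

lemma linear_inverse_on_basis:
  assumes A: "module K A" and B: "module K B" and I: "module_basis K A I"
    and g: "g \<in> linear_maps K A B" and h: "h \<in> linear_maps K B A"
    and inv: "\<And>i. i \<in> I \<Longrightarrow> h (g i) = i" and x: "x \<in> carrier A"
  shows "h (g x) = x"
proof -
  interpret A: module K A by fact
  interpret B: module K B by fact
  show ?thesis using I x
  proof (induction rule: A.basis_induct)
    case (basis i)
    then show ?case by (rule inv)
  next
    case zero
    show ?case using linear_maps_zero[OF A B g] linear_maps_zero[OF B A h] by simp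
  next
    case (add x y)
    then show ?case
      using linear_maps_add[OF g add.hyps] linear_maps_add[OF h linear_maps_closed[OF g add.hyps(1)] linear_maps_closed[OF g add.hyps(2)]] by simp
  next
    case (smult a x)
    then show ?case
      using linear_maps_smult[OF g smult.hyps] linear_maps_smult[OF h smult.hyps(1) linear_maps_closed[OF g smult.hyps(2)]] by simp
  qed
qed

text \<open>
  Here \<open>N\<close> is simultaneously \<open>A \<otimes> F\<close> and \<open>B \<otimes> F\<close>. The set \<open>S\<close> collects the scalars that express the basis \<open>u ` I\<close>
  of \<open>N\<close> by the basis \<open>v ` J\<close> and conversely, and \<open>C\<close> those that express products of basis vectors of \<open>A\<close> and of \<open>B\<close>. For a
  homomorphism \<open>\<phi>\<close> as in \<open>specialization\<close>, the maps \<open>g\<close> and \<open>h\<close> obtained from \<open>specialized_hom\<close> in both directions are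
  inverse to each other: \<open>h (g i)\<close> and \<open>i\<close> both specialize \<open>u i\<close> in \<open>A\<close>.
\<close>

lemma scalar_extension_descent:
  fixes F :: "('u, 'u) module" and K :: "('u, 'c) ring_scheme"
  assumes K: "algebraically_closed K" and F: "field F" "algebra K F"
    and A: "nonassoc_algebra K A" and B: "nonassoc_algebra K B" and N: "nonassoc_algebra F N"
    and U: "scalar_extension K F A N u" and V: "scalar_extension K F B N v"
    and I: "module_basis K A I" "|I| <o |carrier K|" and J: "module_basis K B J" "|J| <o |carrier K|"
  shows "nalg_isomorphic K A B"
proof -
  interpret K: algebraically_closed K by fact
  interpret F: field F by fact
  interpret KF: algebra K F by fact
  interpret A: nonassoc_algebra K A by fact
  interpret B: nonassoc_algebra K B by fact
  interpret N: nonassoc_algebra F N by fact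
  interpret U: scalar_extension K F A N u by fact
  interpret V: scalar_extension K F B N v by fact
  define \<iota> where "\<iota> = (\<lambda>k. k \<odot>\<^bsub>F\<^esub> \<one>\<^bsub>F\<^esub>)"
  interpret E: field_embedding F K \<iota>
    by unfold_locales (unfold \<iota>_def, rule algebra_structure_map[OF F(2)])
  define ZA ZB where "ZA = (\<lambda>i. (u i, i)) ` I" and "ZB = (\<lambda>j. (v j, j)) ` J"
  have ZA: "ZA \<subseteq> carrier N \<times> carrier A" unfolding ZA_def using U.ext_closed A.basis_carrier[OF I(1)] by auto
  have ZB: "ZB \<subseteq> carrier N \<times> carrier B" unfolding ZB_def using V.ext_closed B.basis_carrier[OF J(1)] by auto
  note IA = A.basis_carrier[OF I(1)] and JB = B.basis_carrier[OF J(1)]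
  have "\<forall>i \<in> I. \<exists>S. finite S \<and> S \<subseteq> carrier F \<and> (\<forall>R \<phi>. S \<subseteq> R \<longrightarrow> (\<exists>b. (u i, b) \<in> semilinear_graph R \<phi> N B ZB))"
    unfolding ZB_def using finite_coefficients[OF F(2) B.module_axioms N.module_axioms V J(1) U.ext_closed[OF IA]] by blast
  then obtain SI where SI: "\<And>i. i \<in> I \<Longrightarrow> finite (SI i)" "\<And>i. i \<in> I \<Longrightarrow> SI i \<subseteq> carrier F"
    "\<And>i R \<phi>. \<lbrakk>i \<in> I; SI i \<subseteq> R\<rbrakk> \<Longrightarrow> \<exists>b. (u i, b) \<in> semilinear_graph R \<phi> N B ZB"
    by metis
  have "\<forall>j \<in> J. \<exists>S. finite S \<and> S \<subseteq> carrier F \<and> (\<forall>R \<phi>. S \<subseteq> R \<longrightarrow> (\<exists>a. (v j, a) \<in> semilinear_graph R \<phi> N A ZA))"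
    unfolding ZA_def using finite_coefficients[OF F(2) A.module_axioms N.module_axioms U I(1) V.ext_closed[OF JB]] by blast
  then obtain SJ where SJ: "\<And>j. j \<in> J \<Longrightarrow> finite (SJ j)" "\<And>j. j \<in> J \<Longrightarrow> SJ j \<subseteq> carrier F"
    "\<And>j R \<phi>. \<lbrakk>j \<in> J; SJ j \<subseteq> R\<rbrakk> \<Longrightarrow> \<exists>a. (v j, a) \<in> semilinear_graph R \<phi> N A ZA"
    by metis
  have "\<forall>p \<in> I \<times> I. \<exists>C. finite C \<and> C \<subseteq> carrier K \<and> (\<forall>R \<phi>. (\<forall>c \<in> C. \<iota> c \<in> R \<and> \<phi> (\<iota> c) = c) \<longrightarrow>
      (u (fst p \<otimes>\<^bsub>A\<^esub> snd p), fst p \<otimes>\<^bsub>A\<^esub> snd p) \<in> semilinear_graph R \<phi> N A ZA)"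
    unfolding ZA_def \<iota>_def
    using finite_constants[OF F(2) A.module_axioms U I(1) N.module_axioms A.mult_closed[OF IA IA]] by auto
  then obtain CI where CI: "\<And>p. p \<in> I \<times> I \<Longrightarrow> finite (CI p)" "\<And>p. p \<in> I \<times> I \<Longrightarrow> CI p \<subseteq> carrier K"
    "\<And>p R \<phi>. \<lbrakk>p \<in> I \<times> I; \<forall>c \<in> CI p. \<iota> c \<in> R \<and> \<phi> (\<iota> c) = c\<rbrakk> \<Longrightarrow>
      (u (fst p \<otimes>\<^bsub>A\<^esub> snd p), fst p \<otimes>\<^bsub>A\<^esub> snd p) \<in> semilinear_graph R \<phi> N A ZA"
    by metis
  have "\<forall>p \<in> J \<times> J. \<exists>C. finite C \<and> C \<subseteq> carrier K \<and> (\<forall>R \<phi>. (\<forall>c \<in> C. \<iota> c \<in> R \<and> \<phi> (\<iota> c) = c) \<longrightarrow>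
      (v (fst p \<otimes>\<^bsub>B\<^esub> snd p), fst p \<otimes>\<^bsub>B\<^esub> snd p) \<in> semilinear_graph R \<phi> N B ZB)"
    unfolding ZB_def \<iota>_def
    using finite_constants[OF F(2) B.module_axioms V J(1) N.module_axioms B.mult_closed[OF JB JB]] by auto
  then obtain CJ where CJ: "\<And>p. p \<in> J \<times> J \<Longrightarrow> finite (CJ p)" "\<And>p. p \<in> J \<times> J \<Longrightarrow> CJ p \<subseteq> carrier K"
    "\<And>p R \<phi>. \<lbrakk>p \<in> J \<times> J; \<forall>c \<in> CJ p. \<iota> c \<in> R \<and> \<phi> (\<iota> c) = c\<rbrakk> \<Longrightarrow>
      (v (fst p \<otimes>\<^bsub>B\<^esub> snd p), fst p \<otimes>\<^bsub>B\<^esub> snd p) \<in> semilinear_graph R \<phi> N B ZB"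
    by metis
  define S where "S = \<Union>(SI ` I) \<union> \<Union>(SJ ` J)"
  define C where "C = \<Union>(CI ` (I \<times> I)) \<union> \<Union>(CJ ` (J \<times> J))"
  note small_Un = card_of_Un_ordLess_infinite[OF K.infinite_carrier]
    and small_UN = card_of_UNION_finite_ordLess[OF K.infinite_carrier]
    and small_Times = card_of_Times_ordLess_infinite[OF K.infinite_carrier]
  have S: "S \<subseteq> carrier F" "|S| <o |carrier K|"
  proof -
    show "S \<subseteq> carrier F" unfolding S_def using SI(2) SJ(2) by blast
    show "|S| <o |carrier K|" unfolding S_def by (intro small_Un small_UN I(2) J(2) SI(1) SJ(1))
  qed
  have C: "C \<subseteq> carrier K" "|C| <o |carrier K|"
  proof -
    show "C \<subseteq> carrier K" unfolding C_def using CI(2) CJ(2) by blast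
    show "|C| <o |carrier K|" unfolding C_def by (intro small_Un small_UN small_Times I(2) J(2) CI(1) CJ(1))
  qed
  obtain R \<phi> where R: "subring R F" "\<iota> ` C \<union> S \<subseteq> R" and \<phi>: "\<phi> \<in> ring_hom (F\<lparr>carrier := R\<rparr>) K"
    and \<phi>C: "\<And>c. c \<in> C \<Longrightarrow> \<phi> (\<iota> c) = c"
    using E.specialization[OF C S] by blast
  have RF: "R \<subseteq> carrier F" using subringE(1)[OF R(1)] .
  have \<phi>c: "\<phi> \<in> R \<rightarrow> carrier K" using ring_hom_closed[OF \<phi>] by auto
  let ?GA = "semilinear_graph R \<phi> N A ZA" and ?GB = "semilinear_graph R \<phi> N B ZB"
  have exB: "\<exists>b. (u i, b) \<in> ?GB" if "i \<in> I" for i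
    using that R(2) by (intro SI(3)) (auto simp: S_def)
  have exA: "\<exists>a. (v j, a) \<in> ?GA" if "j \<in> J" for j
    using that R(2) by (intro SJ(3)) (auto simp: S_def)
  have multA: "(u i \<otimes>\<^bsub>N\<^esub> u i', i \<otimes>\<^bsub>A\<^esub> i') \<in> ?GA" if i: "i \<in> I" "i' \<in> I" for i i'
  proof -
    have "\<forall>c \<in> CI (i, i'). \<iota> c \<in> R \<and> \<phi> (\<iota> c) = c" using i R(2) \<phi>C unfolding C_def by blast
    then have "(u (i \<otimes>\<^bsub>A\<^esub> i'), i \<otimes>\<^bsub>A\<^esub> i') \<in> ?GA" using CI(3)[of "(i, i')"] i by simp
    then show ?thesis using U.ext_mult[OF IA[OF i(1)] IA[OF i(2)]] by simp
  qed
  have multB: "(v j \<otimes>\<^bsub>N\<^esub> v j', j \<otimes>\<^bsub>B\<^esub> j') \<in> ?GB" if j: "j \<in> J" "j' \<in> J" for j j'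
  proof -
    have "\<forall>c \<in> CJ (j, j'). \<iota> c \<in> R \<and> \<phi> (\<iota> c) = c" using j R(2) \<phi>C unfolding C_def by blast
    then have "(v (j \<otimes>\<^bsub>B\<^esub> j'), j \<otimes>\<^bsub>B\<^esub> j') \<in> ?GB" using CJ(3)[of "(j, j')"] j by simp
    then show ?thesis using V.ext_mult[OF JB[OF j(1)] JB[OF j(2)]] by simp
  qed
  have multZA: "(x \<otimes>\<^bsub>N\<^esub> x', y \<otimes>\<^bsub>A\<^esub> y') \<in> ?GA" if "(x, y) \<in> ZA" "(x', y') \<in> ZA" for x y x' y'
    using that multA unfolding ZA_def by auto
  have multZB: "(x \<otimes>\<^bsub>N\<^esub> x', y \<otimes>\<^bsub>B\<^esub> y') \<in> ?GB" if "(x, y) \<in> ZB" "(x', y') \<in> ZB" for x y x' y'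
    using that multB unfolding ZB_def by auto
  note uniqueA = specialized_graph_unique[OF F(2) A.module_axioms N.module_axioms U I(1) R(1) \<phi>, folded ZA_def]
  note uniqueB = specialized_graph_unique[OF F(2) B.module_axioms N.module_axioms V J(1) R(1) \<phi>, folded ZB_def]
  have uI: "u \<in> I \<rightarrow> carrier N" using U.ext_closed IA by auto
  have vJ: "v \<in> J \<rightarrow> carrier N" using V.ext_closed JB by auto
  show ?thesis
  proof (rule specialized_hom[OF A B N I(1) RF \<phi>c ZA_def uI ZB], goal_cases)
    case 1 then show ?case by (rule multA)
  next
    case 2 then show ?case by (rule multZB)
  next
    case 3 then show ?case by (rule uniqueB)
  next
    case 4 then show ?case by (rule exB)
  next
    case (5 g)
    note g = this
    show ?case
    proof (rule specialized_hom[OF B A N J(1) RF \<phi>c ZB_def vJ ZA], goal_cases)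
      case 1 then show ?case by (rule multB)
    next
      case 2 then show ?case by (rule multZA)
    next
      case 3 then show ?case by (rule uniqueA)
    next
      case 4 then show ?case by (rule exA)
    next
      case (5 h)
      note h = this
      have hg: "h (g i) = i" if i: "i \<in> I" for i
      proof (rule uniqueA)
        have gen: "(u i, i) \<in> ?GA" using i by (intro semilinear_graph.gen) (simp add: ZA_def)
        show "(u i, i) \<in> ?GA" by (rule gen)
        show "(u i, h (g i)) \<in> ?GA" by (rule h(3)[OF g(3)[OF gen]])
      qed
      have gh: "g (h j) = j" if j: "j \<in> J" for j
      proof (rule uniqueB)
        have gen: "(v j, j) \<in> ?GB" using j by (intro semilinear_graph.gen) (simp add: ZB_def)
        show "(v j, j) \<in> ?GB" by (rule gen)
        show "(v j, g (h j)) \<in> ?GB" by (rule g(3)[OF h(3)[OF gen]])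
      qed
      show ?case
      proof (rule nalg_isomorphicI[OF A g(1)])
        show "g (x \<otimes>\<^bsub>A\<^esub> y) = g x \<otimes>\<^bsub>B\<^esub> g y" if "x \<in> carrier A" "y \<in> carrier A" for x y using that by (rule g(2))
        show "h \<in> carrier B \<rightarrow> carrier A" using linear_maps_closed[OF h(1)] by auto
        show "h (g x) = x" if "x \<in> carrier A" for x
          by (rule linear_inverse_on_basis[OF A.module_axioms B.module_axioms I(1) g(1) h(1) _ that]) (rule hg)
        show "g (h y) = y" if "y \<in> carrier B" for y
          by (rule linear_inverse_on_basis[OF B.module_axioms A.module_axioms J(1) h(1) g(1) _ that]) (rule gh)
      qed
    qed
  qed
qed

section \<open>The tensor product is an extension of scalars\<close>

lemma tensor_free_iff: "c \<in> tensor_free A R \<longleftrightarrow> Poly_Mapping.keys c \<subseteq> carrier A \<times> carrier R"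
  by (simp add: tensor_free_def)

lemma tensor_free_intros:
  "0 \<in> tensor_free A R"
  "\<lbrakk>x \<in> carrier A; r \<in> carrier R\<rbrakk> \<Longrightarrow> frag_of (x, r) \<in> tensor_free A R"
  "\<lbrakk>c \<in> tensor_free A R; d \<in> tensor_free A R\<rbrakk> \<Longrightarrow> c + d \<in> tensor_free A R"
  "\<lbrakk>c \<in> tensor_free A R; d \<in> tensor_free A R\<rbrakk> \<Longrightarrow> c - d \<in> tensor_free A R"
  using keys_add[of c d] keys_diff[of c d] by (auto simp: tensor_free_iff)

lemma equiv_tensor_rel: "equiv (tensor_free A R) (tensor_rel K A R)"
proof (rule equivI)
  show "tensor_rel K A R \<subseteq> tensor_free A R \<times> tensor_free A R" by (auto simp: tensor_rel_def)
  show "refl_on (tensor_free A R) (tensor_rel K A R)"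
    by (auto simp: tensor_rel_def refl_on_def intro: tensor_null.zero)
  show "sym (tensor_rel K A R)"
  proof (rule symI)
    fix c d assume "(c, d) \<in> tensor_rel K A R"
    then show "(d, c) \<in> tensor_rel K A R"
      using tensor_null.diff[OF tensor_null.zero, of "c - d" K A R] by (simp add: tensor_rel_def)
  qed
  show "trans (tensor_rel K A R)"
  proof (rule transI)
    fix c d e assume cd: "(c, d) \<in> tensor_rel K A R" and de: "(d, e) \<in> tensor_rel K A R"
    have "0 - (d - e) \<in> tensor_null K A R"
      using de by (intro tensor_null.diff[OF tensor_null.zero]) (simp add: tensor_rel_def)
    moreover have "c - d \<in> tensor_null K A R" using cd by (simp add: tensor_rel_def)
    ultimately have "(c - d) - (0 - (d - e)) \<in> tensor_null K A R" by (rule tensor_null.diff[rotated])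
    then show "(c, e) \<in> tensor_rel K A R" using cd de by (simp add: tensor_rel_def)
  qed
qed

text \<open>
  The operations on classes are unions over representatives. If such a union is known to be a class,
  then it is the class of any one of its members. Closure of the operations thus lets them be computed
  on representatives.
\<close>

lemma tensor_class_eqI:
  assumes "U \<in> tensor_free A R // tensor_rel K A R" "c \<in> U"
  shows "U = tensor_rel K A R `` {c}"
proof -
  obtain d where d: "d \<in> tensor_free A R" "U = tensor_rel K A R `` {d}" using assms(1) by (auto elim: quotientE)
  then show ?thesis using assms(2) equiv_class_eq[OF equiv_tensor_rel, of d c] by auto
qed

lemma tensor_class_refl: "c \<in> tensor_free A R \<Longrightarrow> c \<in> tensor_rel K A R `` {c}"
  using equiv_class_self[OF equiv_tensor_rel] .

text \<open>
  The map \<open>u\<close> takes \<open>x\<close> to the pure tensor of \<open>x\<close> and \<open>\<one>\<close>, transported to \<open>N\<close> along \<open>\<tau>\<close>. Since \<open>N\<close> is closed under its operations and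
  \<open>\<tau>\<close> is a homomorphism, sums, products and multiples of classes are classes, so \<open>tensor_class_eqI\<close> computes them
  on representatives. A \<open>K\<close>-linear \<open>f\<close> extends to \<open>N\<close> by sending the pure tensor of \<open>x\<close> and \<open>r\<close> to \<open>f x \<otimes> r\<close>; this is
  additive on the free abelian group and kills the relators.
\<close>

lemma tensor_scalar_extension:
  fixes K :: "('u, 'c) ring_scheme" and F :: "('u, 'u) module" and A :: "('u, 'v) module" and N :: "('u, 'w) module"
  assumes F: "algebra K F" and A: "nonassoc_algebra K A" and N: "nonassoc_algebra F N"
    and \<tau>: "\<tau> \<in> nalg_iso F N (tensor K A F)"
  shows "\<exists>u. scalar_extension K F A N u"
proof -
  interpret F: algebra K F by fact
  interpret A: nonassoc_algebra K A by fact
  interpret N: nonassoc_algebra F N by fact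
  let ?T = "tensor_free A F" and ?cls = "\<lambda>c. tensor_rel K A F `` {c}"
  have carrT: "carrier (tensor K A F) = ?T // tensor_rel K A F" by (simp add: tensor_def)
  note \<tau>c = nalg_isoD(1)[OF \<tau>] and \<tau>add = nalg_isoD(2)[OF \<tau>] and \<tau>mult = nalg_isoD(3)[OF \<tau>]
    and \<tau>smult = nalg_isoD(4)[OF \<tau>] and inj = nalg_isoD(6)[OF \<tau>]
  \<comment> \<open>the element of \<open>N\<close> represented by \<open>c\<close>; below, \<open>p x r\<close> is the one represented by a pure tensor\<close>
  define t where "t c = inv_into (carrier N) \<tau> (?cls c)" for c
  have cls: "?cls c \<in> \<tau> ` carrier N" if "c \<in> ?T" for c
    using that nalg_isoD(5)[OF \<tau>] by (simp add: carrT quotientI)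
  have t: "t c \<in> carrier N" "\<tau> (t c) = ?cls c" if "c \<in> ?T" for c
    unfolding t_def by (rule inv_into_into[OF cls[OF that]], rule f_inv_into_f[OF cls[OF that]])
  have t_eq: "t c = y" if c: "c \<in> ?T" and y: "y \<in> carrier N" and mem: "c \<in> \<tau> y" for c y
  proof -
    have "\<tau> y = ?cls c" using \<tau>c[OF y] mem unfolding carrT by (rule tensor_class_eqI)
    then show ?thesis using inj_onD[OF inj _ t(1)[OF c] y] t(2)[OF c] by simp
  qed
  have t_null: "t c = t d" if c: "c \<in> ?T" and d: "d \<in> ?T" and cd: "c - d \<in> tensor_null K A F" for c d
  proof -
    have "(c, d) \<in> tensor_rel K A F" using that by (simp add: tensor_rel_def)
    then show ?thesis unfolding t_def by (simp add: equiv_class_eq[OF equiv_tensor_rel])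
  qed
  have t_add: "t (c + d) = t c \<oplus>\<^bsub>N\<^esub> t d" if c: "c \<in> ?T" and d: "d \<in> ?T" for c d
  proof (rule t_eq)
    show "c + d \<in> ?T" using c d by (rule tensor_free_intros)
    show "t c \<oplus>\<^bsub>N\<^esub> t d \<in> carrier N" using t(1)[OF c] t(1)[OF d] by simp
    have "c + d \<in> (\<Union>c'\<in>?cls c. \<Union>d'\<in>?cls d. ?cls (c' + d'))"
      using tensor_class_refl[OF c, of K] tensor_class_refl[OF d, of K] tensor_class_refl[OF \<open>c + d \<in> ?T\<close>, of K] by blast
    then show "c + d \<in> \<tau> (t c \<oplus>\<^bsub>N\<^esub> t d)"
      unfolding \<tau>add[OF t(1)[OF c] t(1)[OF d]] t(2)[OF c] t(2)[OF d] by (simp add: tensor_def)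
  qed
  define p where "p x r = t (frag_of (x, r))" for x r
  have p_closed: "p x r \<in> carrier N" if "x \<in> carrier A" "r \<in> carrier F" for x r
    unfolding p_def using that by (intro t tensor_free_intros)
  have p_smult: "p x (s \<otimes>\<^bsub>F\<^esub> r) = s \<odot>\<^bsub>N\<^esub> p x r" if x: "x \<in> carrier A" and r: "r \<in> carrier F" and s: "s \<in> carrier F" for x r s
  proof -
    have c: "frag_of (x, r) \<in> ?T" "frag_of (x, s \<otimes>\<^bsub>F\<^esub> r) \<in> ?T" using x r s by (auto intro: tensor_free_intros)
    have "frag_of (x, s \<otimes>\<^bsub>F\<^esub> r) \<in> (\<Union>c\<in>?cls (frag_of (x, r)). ?cls (frag_extend (\<lambda>(x, r). frag_of (x, s \<otimes>\<^bsub>F\<^esub> r)) c))"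
      using tensor_class_refl[OF c(1), of K] tensor_class_refl[OF c(2), of K] by (intro UN_I[of "frag_of (x, r)"]) simp_all
    then have "frag_of (x, s \<otimes>\<^bsub>F\<^esub> r) \<in> \<tau> (s \<odot>\<^bsub>N\<^esub> t (frag_of (x, r)))"
      unfolding \<tau>smult[OF s t(1)[OF c(1)]] t(2)[OF c(1)] by (simp add: tensor_def)
    then show ?thesis unfolding p_def using t(1)[OF c(1)] s by (intro t_eq c(2)) simp_all
  qed
  have p_mult: "p (x \<otimes>\<^bsub>A\<^esub> y) (r \<otimes>\<^bsub>F\<^esub> s) = p x r \<otimes>\<^bsub>N\<^esub> p y s"
    if x: "x \<in> carrier A" "y \<in> carrier A" and r: "r \<in> carrier F" "s \<in> carrier F" for x y r s
  proof -
    have c: "frag_of (x, r) \<in> ?T" "frag_of (y, s) \<in> ?T" "frag_of (x \<otimes>\<^bsub>A\<^esub> y, r \<otimes>\<^bsub>F\<^esub> s) \<in> ?T"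
      using x r A.mult_closed by (auto intro: tensor_free_intros)
    have "tensor_mult A F (frag_of (x, r)) (frag_of (y, s)) = frag_of (x \<otimes>\<^bsub>A\<^esub> y, r \<otimes>\<^bsub>F\<^esub> s)"
      by (simp add: tensor_mult_def)
    then have "frag_of (x \<otimes>\<^bsub>A\<^esub> y, r \<otimes>\<^bsub>F\<^esub> s) \<in> (\<Union>c\<in>?cls (frag_of (x, r)). \<Union>d\<in>?cls (frag_of (y, s)). ?cls (tensor_mult A F c d))"
      using tensor_class_refl[OF c(1), of K] tensor_class_refl[OF c(2), of K] tensor_class_refl[OF c(3), of K]
      by (intro UN_I[of "frag_of (x, r)"] UN_I[of "frag_of (y, s)"]) simp_all
    then have "frag_of (x \<otimes>\<^bsub>A\<^esub> y, r \<otimes>\<^bsub>F\<^esub> s) \<in> \<tau> (t (frag_of (x, r)) \<otimes>\<^bsub>N\<^esub> t (frag_of (y, s)))"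
      unfolding \<tau>mult[OF t(1)[OF c(1)] t(1)[OF c(2)]] t(2)[OF c(1)] t(2)[OF c(2)] by (simp add: tensor_def)
    then show ?thesis unfolding p_def using t(1)[OF c(1)] t(1)[OF c(2)] by (intro t_eq c(3) N.mult_closed)
  qed
  have p_add: "p (x \<oplus>\<^bsub>A\<^esub> y) r = p x r \<oplus>\<^bsub>N\<^esub> p y r" if x: "x \<in> carrier A" "y \<in> carrier A" and r: "r \<in> carrier F" for x y r
  proof -
    have c: "frag_of (x, r) \<in> ?T" "frag_of (y, r) \<in> ?T" "frag_of (x \<oplus>\<^bsub>A\<^esub> y, r) \<in> ?T"
      using x r by (auto intro!: tensor_free_intros)
    have "p (x \<oplus>\<^bsub>A\<^esub> y) r = t (frag_of (x, r) + frag_of (y, r))"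
      unfolding p_def using x r c by (intro t_null tensor_null.add_left tensor_free_intros(3))
    then show ?thesis using t_add[OF c(1,2)] by (simp add: p_def)
  qed
  have p_balanced: "p (k \<odot>\<^bsub>A\<^esub> x) r = p x (k \<odot>\<^bsub>F\<^esub> r)" if "k \<in> carrier K" "x \<in> carrier A" "r \<in> carrier F" for k x r
    unfolding p_def using that by (intro t_null tensor_null.balanced tensor_free_intros A.smult_closed F.smult_closed)
  have onto: "\<exists>c \<in> ?T. z = t c" if z: "z \<in> carrier N" for z
  proof -
    obtain c where c: "c \<in> ?T" "\<tau> z = ?cls c" using \<tau>c[OF z] unfolding carrT by (auto elim: quotientE)
    then have "t c = z" using tensor_class_refl[OF c(1), of K] z by (intro t_eq) simp_all
    then show ?thesis using c(1) by blast
  qed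
  define u where "u x = p x \<one>\<^bsub>F\<^esub>" for x
  have pu: "p x r = r \<odot>\<^bsub>N\<^esub> u x" if "x \<in> carrier A" "r \<in> carrier F" for x r
    using p_smult[of x "\<one>\<^bsub>F\<^esub>" r] that by (simp add: u_def)
  have u_closed: "u x \<in> carrier N" if "x \<in> carrier A" for x unfolding u_def using that by (intro p_closed) simp_all
  have induct: "P z" if z: "z \<in> carrier N" and base: "\<And>x. x \<in> carrier A \<Longrightarrow> P (u x)"
      and add: "\<And>y z. \<lbrakk>y \<in> carrier N; z \<in> carrier N; P y; P z\<rbrakk> \<Longrightarrow> P (y \<oplus>\<^bsub>N\<^esub> z)"
      and smult: "\<And>c y. \<lbrakk>c \<in> carrier F; y \<in> carrier N; P y\<rbrakk> \<Longrightarrow> P (c \<odot>\<^bsub>N\<^esub> y)" for z P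
  proof -
    obtain c where c: "c \<in> ?T" "z = t c" using onto[OF z] by blast
    have "c \<in> ?T \<and> P (t c)" using c(1)[unfolded tensor_free_iff]
    proof (induction c rule: frag_induction)
      case zero
      have "t 0 \<oplus>\<^bsub>N\<^esub> t 0 = t 0" using t_add[of 0 0] by (simp add: tensor_free_intros)
      then have t0: "t 0 = \<zero>\<^bsub>N\<^esub>" using t(1)[of 0] by (simp add: tensor_free_intros)
      have "P (\<zero>\<^bsub>F\<^esub> \<odot>\<^bsub>N\<^esub> u \<zero>\<^bsub>A\<^esub>)" by (intro smult base u_closed) simp_all
      then have "P (t 0)" unfolding t0 using u_closed[of "\<zero>\<^bsub>A\<^esub>"] by simp
      then show ?case by (simp add: tensor_free_intros)
    next
      case (one q)
      obtain x r where q: "q = (x, r)" "x \<in> carrier A" "r \<in> carrier F" using one by auto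
      have "P (r \<odot>\<^bsub>N\<^esub> u x)" using q by (intro smult base u_closed)
      then show ?case using pu[OF q(2,3)] q by (simp add: p_def tensor_free_intros)
    next
      case (diff a b)
      then have a: "a \<in> ?T" "P (t a)" and b: "b \<in> ?T" "P (t b)" by simp_all
      have ab: "a - b \<in> ?T" using a b by (intro tensor_free_intros)
      have "t a = t (a - b) \<oplus>\<^bsub>N\<^esub> t b" using t_add[OF ab b(1)] by simp
      then have "t (a - b) = t a \<ominus>\<^bsub>N\<^esub> t b"
        using t(1)[OF ab] t(1)[OF b(1)] by (simp add: N.M.minus_eq N.M.a_assoc N.M.r_neg)
      also have "\<dots> = t a \<oplus>\<^bsub>N\<^esub> (\<ominus>\<^bsub>F\<^esub> \<one>\<^bsub>F\<^esub>) \<odot>\<^bsub>N\<^esub> t b"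
        using t(1)[OF b(1)] by (simp add: N.M.minus_eq N.smult_l_minus)
      finally have eq: "t (a - b) = t a \<oplus>\<^bsub>N\<^esub> (\<ominus>\<^bsub>F\<^esub> \<one>\<^bsub>F\<^esub>) \<odot>\<^bsub>N\<^esub> t b" .
      have m1: "\<ominus>\<^bsub>F\<^esub> \<one>\<^bsub>F\<^esub> \<in> carrier F" by simp
      have "P (t (a - b))" unfolding eq
        by (rule add[OF t(1)[OF a(1)] N.smult_closed[OF m1 t(1)[OF b(1)]] a(2) smult[OF m1 t(1)[OF b(1)] b(2)]])
      then show ?case using ab by simp
    qed
    then show ?thesis using c by simp
  qed
  have functional: "\<exists>g \<in> linear_maps F N (base_alg F). \<forall>x \<in> carrier A. g (u x) = f x" if f: "f \<in> linear_maps K A F" for f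
  proof -
    have fc: "f x \<in> carrier F" if "x \<in> carrier A" for x using linear_maps_closed[OF f that] .
    have im: "(\<lambda>(x, r). f x \<otimes>\<^bsub>F\<^esub> r) ` (carrier A \<times> carrier F) \<subseteq> carrier (add_monoid F)"
      using fc by auto
    obtain h where h: "h \<in> hom (free_Abelian_group (carrier A \<times> carrier F)) (add_monoid F)"
      and h_of: "\<And>q. q \<in> carrier A \<times> carrier F \<Longrightarrow> h (frag_of q) = (case q of (x, r) \<Rightarrow> f x \<otimes>\<^bsub>F\<^esub> r)"
      using comm_group.free_Abelian_group_universal[OF F.a_comm_group im] by blast
    have hc: "h c \<in> carrier F" if "c \<in> ?T" for c using h that by (auto simp: hom_def tensor_free_def)
    have hadd: "h (c + d) = h c \<oplus>\<^bsub>F\<^esub> h d" if "c \<in> ?T" "d \<in> ?T" for c d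
      using h that by (auto simp: hom_def tensor_free_def)
    have hdiff: "h (c - d) = h c \<ominus>\<^bsub>F\<^esub> h d" if c: "c \<in> ?T" and d: "d \<in> ?T" for c d
    proof -
      have cd: "c - d \<in> ?T" using c d by (rule tensor_free_intros)
      have "h c = h (c - d) \<oplus>\<^bsub>F\<^esub> h d" using hadd[OF cd d] by simp
      then show ?thesis using hc[OF cd] hc[OF d] by (simp add: F.minus_eq F.a_assoc F.r_neg)
    qed
    have hp: "h (frag_of (x, r)) = f x \<otimes>\<^bsub>F\<^esub> r" if "x \<in> carrier A" "r \<in> carrier F" for x r
      using h_of[of "(x, r)"] that by simp
    have null: "c \<in> ?T \<and> h c = \<zero>\<^bsub>F\<^esub>" if "c \<in> tensor_null K A F" for c
      using that
    proof induction
      case zero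
      have "h 0 = \<zero>\<^bsub>F\<^esub>" using hdiff[of 0 0] hc[of 0] by (simp add: tensor_free_intros F.minus_eq F.r_neg)
      then show ?case by (simp add: tensor_free_intros)
    next
      case (add_left x y r)
      have T: "frag_of (x, r) \<in> ?T" "frag_of (y, r) \<in> ?T" "frag_of (x \<oplus>\<^bsub>A\<^esub> y, r) \<in> ?T"
        using add_left by (auto intro: tensor_free_intros)
      note S = tensor_free_intros(3)[OF T(1,2)]
      show ?case
        using hdiff[OF T(3) S] hadd[OF T(1,2)] tensor_free_intros(4)[OF T(3) S] add_left fc
        by (simp add: hp linear_maps_add[OF f] F.l_distr F.minus_eq F.r_neg)
    next
      case (add_right x r s)
      have T: "frag_of (x, r) \<in> ?T" "frag_of (x, s) \<in> ?T" "frag_of (x, r \<oplus>\<^bsub>F\<^esub> s) \<in> ?T"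
        using add_right by (auto intro: tensor_free_intros)
      note S = tensor_free_intros(3)[OF T(1,2)]
      show ?case
        using hdiff[OF T(3) S] hadd[OF T(1,2)] tensor_free_intros(4)[OF T(3) S] add_right fc
        by (simp add: hp F.r_distr F.minus_eq F.r_neg)
    next
      case (balanced k x r)
      have T: "frag_of (k \<odot>\<^bsub>A\<^esub> x, r) \<in> ?T" "frag_of (x, k \<odot>\<^bsub>F\<^esub> r) \<in> ?T"
        using balanced by (auto intro: tensor_free_intros)
      have "f x \<otimes>\<^bsub>F\<^esub> (k \<odot>\<^bsub>F\<^esub> r) = k \<odot>\<^bsub>F\<^esub> (f x \<otimes>\<^bsub>F\<^esub> r)"
        using balanced fc F.smult_assoc2[of k r "f x"] by (simp add: F.m_comm)
      then have "f (k \<odot>\<^bsub>A\<^esub> x) \<otimes>\<^bsub>F\<^esub> r = f x \<otimes>\<^bsub>F\<^esub> (k \<odot>\<^bsub>F\<^esub> r)"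
        using balanced fc linear_maps_smult[OF f balanced(1,2)] F.smult_assoc2[of k "f x" r] by simp
      then show ?case
        using hdiff[OF T] tensor_free_intros(4)[OF T] balanced fc by (simp add: hp F.minus_eq F.r_neg)
    next
      case (diff c d)
      then show ?case using hdiff[of c d] tensor_free_intros(4)[of c A F d] by (simp add: F.minus_eq)
    qed
    have h_eq: "h c = h d" if c: "c \<in> ?T" and d: "d \<in> ?T" and eq: "t c = t d" for c d
    proof -
      have "?cls c = ?cls d" using t(2)[OF c] t(2)[OF d] eq by simp
      then have "(c, d) \<in> tensor_rel K A F" using eq_equiv_class_iff[OF equiv_tensor_rel c d] by blast
      then have "h (c - d) = \<zero>\<^bsub>F\<^esub>" using null by (simp add: tensor_rel_def)
      then show ?thesis using hdiff[OF c d] hc[OF c] hc[OF d] by simp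
    qed
    define g where "g z = h (SOME c. c \<in> ?T \<and> t c = z)" for z
    have g: "g (t c) = h c" if c: "c \<in> ?T" for c
    proof -
      have "(SOME d. d \<in> ?T \<and> t d = t c) \<in> ?T \<and> t (SOME d. d \<in> ?T \<and> t d = t c) = t c"
        by (rule someI[of "\<lambda>d. d \<in> ?T \<and> t d = t c" c]) (simp add: c)
      then show ?thesis unfolding g_def using h_eq c by blast
    qed
    have gc: "g z \<in> carrier F" if "z \<in> carrier N" for z using onto[OF that] g hc by auto
    have gadd: "g (y \<oplus>\<^bsub>N\<^esub> z) = g y \<oplus>\<^bsub>F\<^esub> g z" if y: "y \<in> carrier N" and z: "z \<in> carrier N" for y z
    proof -
      obtain c d where c: "c \<in> ?T" "y = t c" and d: "d \<in> ?T" "z = t d" using onto[OF y] onto[OF z] by blast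
      show ?thesis unfolding c(2) d(2) t_add[OF c(1) d(1), symmetric] g[OF c(1)] g[OF d(1)]
        using g[OF tensor_free_intros(3)[OF c(1) d(1)]] hadd[OF c(1) d(1)] by simp
    qed
    have gp: "g (r \<odot>\<^bsub>N\<^esub> u x) = f x \<otimes>\<^bsub>F\<^esub> r" if x: "x \<in> carrier A" and r: "r \<in> carrier F" for x r
      using g[OF tensor_free_intros(2)[OF x r]] hp[OF x r] pu[OF x r] by (simp add: p_def)
    have gu: "g (u x) = f x" if x: "x \<in> carrier A" for x
      using gp[OF x F.one_closed] fc[OF x] u_closed[OF x] by simp
    have gsmult: "\<forall>s \<in> carrier F. g (s \<odot>\<^bsub>N\<^esub> z) = s \<otimes>\<^bsub>F\<^esub> g z" if "z \<in> carrier N" for z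
      using that
    proof (rule induct)
      show "\<forall>s \<in> carrier F. g (s \<odot>\<^bsub>N\<^esub> u x) = s \<otimes>\<^bsub>F\<^esub> g (u x)" if x: "x \<in> carrier A" for x
        using gp[OF x] gu[OF x] fc[OF x] by (simp add: F.m_comm)
      show "\<forall>s \<in> carrier F. g (s \<odot>\<^bsub>N\<^esub> (y \<oplus>\<^bsub>N\<^esub> z)) = s \<otimes>\<^bsub>F\<^esub> g (y \<oplus>\<^bsub>N\<^esub> z)"
        if "y \<in> carrier N" "z \<in> carrier N" "\<forall>s \<in> carrier F. g (s \<odot>\<^bsub>N\<^esub> y) = s \<otimes>\<^bsub>F\<^esub> g y"
          "\<forall>s \<in> carrier F. g (s \<odot>\<^bsub>N\<^esub> z) = s \<otimes>\<^bsub>F\<^esub> g z" for y z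
        using that gc by (simp add: N.smult_r_distr gadd F.r_distr)
      show "\<forall>s \<in> carrier F. g (s \<odot>\<^bsub>N\<^esub> (c \<odot>\<^bsub>N\<^esub> y)) = s \<otimes>\<^bsub>F\<^esub> g (c \<odot>\<^bsub>N\<^esub> y)"
        if "c \<in> carrier F" "y \<in> carrier N" "\<forall>s \<in> carrier F. g (s \<odot>\<^bsub>N\<^esub> y) = s \<otimes>\<^bsub>F\<^esub> g y" for c y
        using that gc by (simp add: F.m_assoc flip: N.smult_assoc1)
    qed
    have "g \<in> linear_maps F N (base_alg F)"
      unfolding linear_maps_def using gc gadd gsmult by simp
    then show ?thesis using gu by blast
  qed
  have "scalar_extension K F A N u"
  proof
    show "u (k \<odot>\<^bsub>A\<^esub> x) = (k \<odot>\<^bsub>F\<^esub> \<one>\<^bsub>F\<^esub>) \<odot>\<^bsub>N\<^esub> u x" if k: "k \<in> carrier K" and x: "x \<in> carrier A" for k x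
      using p_balanced[OF k x F.one_closed] pu[OF x, of "k \<odot>\<^bsub>F\<^esub> \<one>\<^bsub>F\<^esub>"] k by (simp add: u_def)
    show "u (x \<otimes>\<^bsub>A\<^esub> y) = u x \<otimes>\<^bsub>N\<^esub> u y" if "x \<in> carrier A" "y \<in> carrier A" for x y
      using p_mult[OF that F.one_closed F.one_closed] by (simp add: u_def)
    show "u (x \<oplus>\<^bsub>A\<^esub> y) = u x \<oplus>\<^bsub>N\<^esub> u y" if "x \<in> carrier A" "y \<in> carrier A" for x y
      using p_add[OF that F.one_closed] by (simp add: u_def)
  qed (fact u_closed, rule induct, assumption+, rule functional)
  then show ?thesis by (intro exI)
qed

section \<open>Extension invariant functors over different fields\<close>

lemma cring_base_alg:
  assumes "cring K"
  shows "cring (base_alg K)"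
proof -
  interpret K: cring K by fact
  interpret B: module K "base_alg K" by (rule module_base_alg[OF assms])
  show ?thesis
  proof (rule cringI)
    show "abelian_group (base_alg K)" by (rule B.M.abelian_group_axioms)
    show "comm_monoid (base_alg K)" by (rule comm_monoidI) (simp_all add: K.m_ac)
  qed (simp add: K.l_distr)
qed

lemma base_alg_in_alg_obj:
  assumes "cring K" "\<one>\<^bsub>K\<^esub> \<noteq> \<zero>\<^bsub>K\<^esub>"
  shows "base_alg K \<in> alg_obj K"
proof -
  interpret K: cring K by fact
  have "algebra K (base_alg K)"
    by (intro algebra.intro algebra_axioms.intro module_base_alg cring_base_alg assms(1)) (simp add: K.m_assoc)
  then show ?thesis using assms(2) by (simp add: alg_obj_def)
qed

lemma nonassoc_algebra_over_base:
  assumes K: "cring K" and M: "nonassoc_algebra (base_alg K) M"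
  shows "nonassoc_algebra K M"
proof -
  interpret M: nonassoc_algebra "base_alg K" M by fact
  have "module K M"
  proof (rule moduleI[OF K])
    show "abelian_group M" by (rule M.M.abelian_group_axioms)
  qed (use M.smult_closed M.smult_l_distr M.smult_r_distr M.smult_assoc1 M.smult_one in simp_all)
  then show ?thesis
    by (rule nonassoc_algebra.intro, intro nonassoc_algebra_axioms.intro)
      (use M.mult_closed M.mult_l_distr M.mult_r_distr M.smult_mult_left M.smult_mult_right in simp_all)
qed

lemma extension_invariant_functor_scalar_extension:
  fixes K :: "('u, 'c) ring_scheme" and Fo :: "('u, 'u) module \<Rightarrow> ('u, 'v) module"
  assumes K: "cring K" "\<one>\<^bsub>K\<^esub> \<noteq> \<zero>\<^bsub>K\<^esub>" and Fo: "extension_invariant_functor K Fo Fm" and R: "R \<in> alg_obj K"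
  shows "nonassoc_algebra K (Fo (base_alg K))" "nonassoc_algebra R (Fo R)"
    "\<exists>u. scalar_extension K R (Fo (base_alg K)) (Fo R) u"
proof -
  interpret Fo: extension_invariant_functor K Fo Fm by fact
  show A: "nonassoc_algebra K (Fo (base_alg K))"
    by (rule nonassoc_algebra_over_base[OF K(1) Fo.obj[OF base_alg_in_alg_obj[OF K]]])
  show N: "nonassoc_algebra R (Fo R)" by (rule Fo.obj[OF R])
  obtain \<tau> where "\<forall>R \<in> alg_obj K. \<tau> R \<in> nalg_iso R (Fo R) (tensor K (Fo (base_alg K)) R)"
    using Fo.ext_inv by blast
  then have "\<tau> R \<in> nalg_iso R (Fo R) (tensor K (Fo (base_alg K)) R)" using R by blast
  moreover have "algebra K R" using R by (simp add: alg_obj_def)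
  ultimately show "\<exists>u. scalar_extension K R (Fo (base_alg K)) (Fo R) u"
    using A N by (intro tensor_scalar_extension)
qed

lemma small_basis:
  assumes "field K" "module K M" "module_dim K M <o r"
  obtains B where "module_basis K M B" "|B| <o r"
proof
  show "module_basis K M (SOME B. module_basis K M B)"
    using basis_exists[OF assms(1,2)] by (rule someI_ex)
  show "|SOME B. module_basis K M B| <o r" using assms(3) by (simp add: module_dim_def)
qed

text \<open>
  The algebra \<open>Fo F\<close> is the extension of scalars of \<open>Fo (base_alg K)\<close>, and likewise for \<open>Go\<close>. An isomorphism
  over \<open>F\<close> makes \<open>Go F\<close> an extension of both algebras over \<open>K\<close>, which descends; an isomorphism over \<open>K\<close> makes \<open>Fo F\<close> and \<open>Go F\<close>
  extensions of the same algebra.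
\<close>

lemma isomorphic_over_field_iff_over_base:
  fixes K :: "('u, 'c) ring_scheme" and F :: "('u, 'u) module"
    and Fo :: "('u, 'u) module \<Rightarrow> ('u, 'v) module" and Go :: "('u, 'u) module \<Rightarrow> ('u, 'w) module"
  assumes K: "algebraically_closed K" and F: "field F" "F \<in> alg_obj K"
    and Fo: "extension_invariant_functor K Fo Fm" and Go: "extension_invariant_functor K Go Gm"
    and dim: "module_dim K (Fo (base_alg K)) <o |carrier K|" "module_dim K (Go (base_alg K)) <o |carrier K|"
  shows "nalg_isomorphic F (Fo F) (Go F) \<longleftrightarrow> nalg_isomorphic K (Fo (base_alg K)) (Go (base_alg K))"
proof -
  interpret K: algebraically_closed K by fact
  have alg: "algebra K F" using F(2) by (simp add: alg_obj_def)
  note fo = extension_invariant_functor_scalar_extension[OF K.cring_axioms K.one_not_zero Fo F(2)]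
  note go = extension_invariant_functor_scalar_extension[OF K.cring_axioms K.one_not_zero Go F(2)]
  obtain u where u: "scalar_extension K F (Fo (base_alg K)) (Fo F) u" using fo(3) by blast
  obtain v where v: "scalar_extension K F (Go (base_alg K)) (Go F) v" using go(3) by blast
  have modF: "module K (Fo (base_alg K))" and modG: "module K (Go (base_alg K))"
    using fo(1) go(1) by (auto simp: nonassoc_algebra_def)
  show ?thesis
  proof
    assume "nalg_isomorphic F (Fo F) (Go F)"
    then obtain h where h: "h \<in> nalg_iso F (Fo F) (Go F)" unfolding nalg_isomorphic_def by blast
    obtain I where I: "module_basis K (Fo (base_alg K)) I" "|I| <o |carrier K|"
      by (rule small_basis[OF K.field_axioms modF dim(1)])
    obtain J where J: "module_basis K (Go (base_alg K)) J" "|J| <o |carrier K|"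
      by (rule small_basis[OF K.field_axioms modG dim(2)])
    show "nalg_isomorphic K (Fo (base_alg K)) (Go (base_alg K))"
      by (rule scalar_extension_descent[OF K F(1) alg fo(1) go(1,2) scalar_extension_postcomp[OF u h alg fo(2)] v I J])
  next
    assume "nalg_isomorphic K (Fo (base_alg K)) (Go (base_alg K))"
    then obtain g where g: "g \<in> nalg_iso K (Fo (base_alg K)) (Go (base_alg K))" unfolding nalg_isomorphic_def by blast
    show "nalg_isomorphic F (Fo F) (Go F)"
      by (rule scalar_extension_unique[OF F(1) alg fo(1,2) go(2) u scalar_extension_precomp[OF v g fo(1)]])
  qed
qed

theorem theorem5p7:
  fixes K :: "'u ring" and F1 F2 :: "('u, 'u) module"
    and Fo :: "('u, 'u) module \<Rightarrow> ('u, 'v) module"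
    and Fm :: "('u, 'u) module \<Rightarrow> ('u, 'u) module \<Rightarrow> ('u \<Rightarrow> 'u) \<Rightarrow> 'v \<Rightarrow> 'v"
    and Go :: "('u, 'u) module \<Rightarrow> ('u, 'w) module"
    and Gm :: "('u, 'u) module \<Rightarrow> ('u, 'u) module \<Rightarrow> ('u \<Rightarrow> 'u) \<Rightarrow> 'w \<Rightarrow> 'w"
  assumes "algebraically_closed K"
    and "field F1" and "F1 \<in> alg_obj K"
    and "field F2" and "F2 \<in> alg_obj K"
    and "extension_invariant_functor K Fo Fm"
    and "extension_invariant_functor K Go Gm"
    and "module_dim K (Fo (base_alg K)) <o |carrier K|"
    and "module_dim K (Go (base_alg K)) <o |carrier K|"
  shows "nalg_isomorphic F1 (Fo F1) (Go F1) \<longleftrightarrow> nalg_isomorphic F2 (Fo F2) (Go F2)"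
  using isomorphic_over_field_iff_over_base[OF assms(1,2,3,6-9)]
    isomorphic_over_field_iff_over_base[OF assms(1,4,5,6-9)] by simp

end
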